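(* There is a polynomial-time $O(\log^2 k)$-approximation algorithm for the connected $k$-center problem with disjoint clusters and for the connected $k$-diameter problem with disjoint clusters. The approximation ratio improves (a) to $O(2^{3\cdot\mathrm{dim}(M)})$ if the metric space $M=(V,d)$ has bounded doubling dimension $\mathrm{dim}(M)$, and (b) to $O(d^{2+1/p})$ if the points lie in $\mathbb{R}^d$ and the distance is the $L_p$-metric.
   Context: An instance of a connected $k$-clustering problem consists of a finite set $V$ of points, a metric $d$ on $V$, an integer $k\ge 1$, and an unweighted undirected connectivity graph $G=(V,E)$. In the version with disjoint clusters, a feasible solution is a partition of $V$ into $k$ clusters $C_1,\dots,C_k$ such that for every $i$ the subgraph of $G$ induced by $C_i$ is connected. In the connected $k$-center problem the solution also specifies centers $c_i\in C_i$, and the cost is $\max_{i}\max_{x\in C_i} d(x,c_i)$; in the connected $k$-diameter problem the cost is $\max_i\max_{x,y\in C_i}d(x,y)$. The goal is to minimize the cost. An $\alpha$-approximation algorithm outputs a feasible solution of cost at most $\alpha$ times the optimum. The doubling constant of a metric space $M=(X,d)$ is the smallest $K$ such that every ball $B_\rho(x)=\{y\in X: d(x,y)\le \rho\}$ ($x\in X,\rho>0$) is contained in the union of at most $K$ balls of radius $\rho/2$ centered at points of $X$; the doubling dimension is $\mathrm{dim}(M)=\lceil \log_2 K\rceil$. *)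

theory Defs
  imports
    "HOL-Analysis.Analysis"
    "HOL-Library.Landau_Symbols"
    "HOL-Computational_Algebra.Polynomial"
begin

section \<open>Machine model\<close>

text \<open>
  Algorithms are programs of an additive real RAM: a uniform While language over natural-number
  cells and real cells, with addition, subtraction and comparison, and neither multiplication nor
  rounding.  A memory cell is addressed by an array name and two computed natural-number indices;
  scalars are cells with both indices 0.  Each assignment and each test costs one time unit; this
  charges expressions up to a constant factor, because their size is fixed by the program.

  Since every step adds only O(1) bits to the longest number in memory, polynomial time in
  this model with rational inputs is also polynomial time on a Turing machine.  For the same reason
  the constants of a program are rational: real constants could carry non-uniform advice.
\<close>

type_synonym name = string

record store =
  nats :: "name \<Rightarrow> nat \<Rightarrow> nat \<Rightarrow> nat"
  reals :: "name \<Rightarrow> nat \<Rightarrow> nat \<Rightarrow> real"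

datatype nexp =
    NConst nat
  | NRead name nexp nexp
  | NAdd nexp nexp
  | NSub nexp nexp

datatype rexp =
    RConst rat
  | RRead name nexp nexp
  | RAdd rexp rexp
  | RSub rexp rexp

datatype bexp =
    NLess nexp nexp
  | RLess rexp rexp
  | Not bexp
  | And bexp bexp

datatype com =
    Skip
  | NAssign name nexp nexp nexp
  | RAssign name nexp nexp rexp
  | Seq com com
  | If bexp com com
  | While bexp com

primrec nval :: "nexp \<Rightarrow> store \<Rightarrow> nat" where
  "nval (NConst m) s = m"
| "nval (NRead x a b) s = nats s x (nval a s) (nval b s)"
| "nval (NAdd a b) s = nval a s + nval b s"
| "nval (NSub a b) s = nval a s - nval b s"

primrec rval :: "rexp \<Rightarrow> store \<Rightarrow> real" where
  "rval (RConst q) s = of_rat q"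
| "rval (RRead x a b) s = reals s x (nval a s) (nval b s)"
| "rval (RAdd a b) s = rval a s + rval b s"
| "rval (RSub a b) s = rval a s - rval b s"

primrec bval :: "bexp \<Rightarrow> store \<Rightarrow> bool" where
  "bval (NLess a b) s \<longleftrightarrow> nval a s < nval b s"
| "bval (RLess a b) s \<longleftrightarrow> rval a s < rval b s"
| "bval (Not b) s \<longleftrightarrow> \<not> bval b s"
| "bval (And a b) s \<longleftrightarrow> bval a s \<and> bval b s"

definition write_cell ::
    "(name \<Rightarrow> nat \<Rightarrow> nat \<Rightarrow> 'v) \<Rightarrow> name \<Rightarrow> nat \<Rightarrow> nat \<Rightarrow> 'v \<Rightarrow> name \<Rightarrow> nat \<Rightarrow> nat \<Rightarrow> 'v" where
  "write_cell m x i j v = m(x := (m x)(i := (m x i)(j := v)))"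

text \<open>In \<open>exec c s t s'\<close>, the number \<open>t\<close> is the running time of \<open>c\<close> from \<open>s\<close>.\<close>

inductive exec :: "com \<Rightarrow> store \<Rightarrow> nat \<Rightarrow> store \<Rightarrow> bool" where
  Skip: "exec Skip s 1 s"
| NAssign: "exec (NAssign x a b e) s 1
    (s\<lparr>nats := write_cell (nats s) x (nval a s) (nval b s) (nval e s)\<rparr>)"
| RAssign: "exec (RAssign x a b e) s 1
    (s\<lparr>reals := write_cell (reals s) x (nval a s) (nval b s) (rval e s)\<rparr>)"
| Seq: "exec c1 s1 t1 s2 \<Longrightarrow> exec c2 s2 t2 s3 \<Longrightarrow> exec (Seq c1 c2) s1 (t1 + t2) s3"
| IfTrue: "bval b s \<Longrightarrow> exec c1 s t s' \<Longrightarrow> exec (If b c1 c2) s (1 + t) s'"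
| IfFalse: "\<not> bval b s \<Longrightarrow> exec c2 s t s' \<Longrightarrow> exec (If b c1 c2) s (1 + t) s'"
| WhileFalse: "\<not> bval b s \<Longrightarrow> exec (While b c) s 1 s"
| WhileTrue: "bval b s1 \<Longrightarrow> exec c s1 t1 s2 \<Longrightarrow> exec (While b c) s2 t2 s3 \<Longrightarrow>
    exec (While b c) s1 (1 + t1 + t2) s3"

inductive_cases SkipE: "exec Skip s t s'"
inductive_cases NAssignE: "exec (NAssign x a b e) s t s'"
inductive_cases RAssignE: "exec (RAssign x a b e) s t s'"
inductive_cases SeqE: "exec (Seq c1 c2) s t s'"
inductive_cases IfE: "exec (If b c1 c2) s t s'"
inductive_cases WhileE: "exec (While b c) s t s'"

lemma exec_deterministic:
  "exec c s t s' \<Longrightarrow> exec c s u s'' \<Longrightarrow> u = t \<and> s'' = s'"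
proof (induction arbitrary: u s'' rule: exec.induct)
  case (Skip s)
  then show ?case by (elim SkipE) simp
next
  case (NAssign x a b e s)
  then show ?case by (elim NAssignE) simp
next
  case (RAssign x a b e s)
  then show ?case by (elim RAssignE) simp
next
  case (Seq c1 s1 t1 s2 c2 t2 s3)
  from Seq.prems show ?case by (rule SeqE) (metis Seq.IH)
next
  case (IfTrue b s c1 t s' c2)
  from IfTrue.prems show ?case by (rule IfE) (metis IfTrue.IH IfTrue.hyps(1) plus_1_eq_Suc)+
next
  case (IfFalse b s c2 t s' c1)
  from IfFalse.prems show ?case by (rule IfE) (metis IfFalse.IH IfFalse.hyps(1) plus_1_eq_Suc)+
next
  case (WhileFalse b s c)
  from WhileFalse.prems show ?case by (rule WhileE) (use WhileFalse.hyps in simp_all)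
next
  case (WhileTrue b s1 c t1 s2 t2 s3)
  from WhileTrue.prems show ?case by (rule WhileE) (metis WhileTrue.IH WhileTrue.hyps(1) plus_1_eq_Suc add_Suc)+
qed


section \<open>Connected clusterings\<close>

definition connected_in :: "('a \<times> 'a) set \<Rightarrow> 'a set \<Rightarrow> bool" where
  "connected_in E C \<longleftrightarrow> (\<forall>x\<in>C. \<forall>y\<in>C. (x, y) \<in> (Restr E C)\<^sup>*)"

text \<open>The parts of a \<^const>\<open>partition_on\<close> are nonempty and, by injectivity, there are exactly \<open>k\<close>.\<close>

definition connected_clustering :: "'a set \<Rightarrow> ('a \<times> 'a) set \<Rightarrow> nat \<Rightarrow> (nat \<Rightarrow> 'a set) \<Rightarrow> bool" where
  "connected_clustering V E k C \<longleftrightarrow>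
     partition_on V (C ` {..<k}) \<and> inj_on C {..<k} \<and> (\<forall>i<k. connected_in E (C i))"

definition center_cost :: "('a \<Rightarrow> 'a \<Rightarrow> real) \<Rightarrow> nat \<Rightarrow> (nat \<Rightarrow> 'a set) \<Rightarrow> (nat \<Rightarrow> 'a) \<Rightarrow> real" where
  "center_cost d k C c = (MAX i\<in>{..<k}. MAX x\<in>C i. d x (c i))"

definition diameter_cost :: "('a \<Rightarrow> 'a \<Rightarrow> real) \<Rightarrow> nat \<Rightarrow> (nat \<Rightarrow> 'a set) \<Rightarrow> real" where
  "diameter_cost d k C = (MAX i\<in>{..<k}. MAX x\<in>C i. MAX y\<in>C i. d x y)"


section \<open>Doubling dimension and Lp metrics\<close>

definition doubling_constant :: "'a set \<Rightarrow> ('a \<Rightarrow> 'a \<Rightarrow> real) \<Rightarrow> nat" where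
  "doubling_constant X d = (LEAST K. \<forall>x\<in>X. \<forall>\<rho>>0. \<exists>S\<subseteq>X. finite S \<and> card S \<le> K \<and>
     Metric_space.mcball X d x \<rho> \<subseteq> (\<Union>y\<in>S. Metric_space.mcball X d y (\<rho> / 2)))"

definition doubling_dim :: "'a set \<Rightarrow> ('a \<Rightarrow> 'a \<Rightarrow> real) \<Rightarrow> nat" where
  "doubling_dim X d = nat \<lceil>log 2 (real (doubling_constant X d))\<rceil>"

text \<open>A vector of dimension \<open>D\<close> is given by its coordinates with indices below \<open>D\<close>.\<close>

definition lp_dist :: "ereal \<Rightarrow> nat \<Rightarrow> (nat \<Rightarrow> real) \<Rightarrow> (nat \<Rightarrow> real) \<Rightarrow> real" where
  "lp_dist p D x y =
     (if p = \<infinity> then (MAX j\<in>{..<D}. \<bar>x j - y j\<bar>)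
      else (\<Sum>j<D. \<bar>x j - y j\<bar> powr real_of_ereal p) powr (1 / real_of_ereal p))"


section \<open>Instances and their encodings\<close>

text \<open>The points of an instance are numbered: they are \<open>0, ..., num_points - 1\<close>.\<close>

record cluster_inst =
  num_points :: nat
  distance :: "nat \<Rightarrow> nat \<Rightarrow> real"
  num_clusters :: nat
  edges :: "(nat \<times> nat) set"

abbreviation points :: "'z cluster_inst_scheme \<Rightarrow> nat set" where
  "points I \<equiv> {..<num_points I}"

definition valid_inst :: "'z cluster_inst_scheme \<Rightarrow> bool" where
  "valid_inst I \<longleftrightarrow>
     Metric_space (points I) (distance I) \<and> num_clusters I \<ge> 1 \<and>
     edges I \<subseteq> points I \<times> points I \<and> sym (edges I)"

record lp_inst = cluster_inst +
  space_dim :: nat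
  coord :: "nat \<Rightarrow> nat \<Rightarrow> real"

definition valid_lp_inst :: "ereal \<Rightarrow> lp_inst \<Rightarrow> bool" where
  "valid_lp_inst p I \<longleftrightarrow> valid_inst I \<and> space_dim I \<ge> 1 \<and>
     (\<forall>x\<in>points I. \<forall>y\<in>points I. distance I x y = lp_dist p (space_dim I) (coord I x) (coord I y))"

text \<open>
  All cells not mentioned below are initially 0.  In particular a program has no access to
  values of \<^const>\<open>distance\<close> outside the point set.
\<close>

definition encode :: "'z cluster_inst_scheme \<Rightarrow> store" where
  "encode I =
     \<lparr>nats = (\<lambda>x i j.
        if x = ''n'' \<and> i = 0 \<and> j = 0 then num_points I
        else if x = ''k'' \<and> i = 0 \<and> j = 0 then num_clusters I
        else if x = ''edge'' \<and> (i, j) \<in> edges I then 1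
        else 0),
      reals = (\<lambda>x i j.
        if x = ''dist'' \<and> i \<in> points I \<and> j \<in> points I then distance I i j
        else 0)\<rparr>"

text \<open>An Lp instance is presented by its distance matrix together with the coordinates.\<close>

definition encode_lp :: "lp_inst \<Rightarrow> store" where
  "encode_lp I =
     \<lparr>nats = (nats (encode I))(''dim'' := (\<lambda>i j. if i = 0 \<and> j = 0 then space_dim I else 0)),
      reals = (reals (encode I))(''coord'' :=
        (\<lambda>i j. if i \<in> points I \<and> j < space_dim I then coord I i j else 0))\<rparr>"


section \<open>The two problems and approximation algorithms\<close>

text \<open>The component \<open>decode\<close> reads a candidate solution off the final store.\<close>

record ('i, 's) min_problem =
  solutions :: "'i \<Rightarrow> 's set"
  cost :: "'i \<Rightarrow> 's \<Rightarrow> real"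
  decode :: "'i \<Rightarrow> store \<Rightarrow> 's"

definition output_clusters :: "'z cluster_inst_scheme \<Rightarrow> store \<Rightarrow> nat \<Rightarrow> nat set" where
  "output_clusters I s i = {x \<in> points I. nats s ''cluster'' x 0 = i}"

definition connected_k_center ::
    "('z cluster_inst_scheme, (nat \<Rightarrow> nat set) \<times> (nat \<Rightarrow> nat)) min_problem" where
  "connected_k_center =
     \<lparr>solutions = (\<lambda>I. {(C, c). connected_clustering (points I) (edges I) (num_clusters I) C \<and>
                        (\<forall>i<num_clusters I. c i \<in> C i)}),
      cost = (\<lambda>I (C, c). center_cost (distance I) (num_clusters I) C c),
      decode = (\<lambda>I s. (output_clusters I s, \<lambda>i. nats s ''center'' i 0))\<rparr>"

definition connected_k_diameter :: "('z cluster_inst_scheme, nat \<Rightarrow> nat set) min_problem" where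
  "connected_k_diameter =
     \<lparr>solutions = (\<lambda>I. {C. connected_clustering (points I) (edges I) (num_clusters I) C}),
      cost = (\<lambda>I C. diameter_cost (distance I) (num_clusters I) C),
      decode = output_clusters\<rparr>"

text \<open>
  The set of solutions may be infinite, since a family of clusters is unconstrained at indices
  \<open>\<ge> k\<close>, but the set of costs is finite: every cost is one of the distances.
\<close>

definition opt :: "('i, 's) min_problem \<Rightarrow> 'i \<Rightarrow> real" where
  "opt P I = Min (cost P I ` solutions P I)"

text \<open>
  The program has to halt within the time bound on all valid instances; if an instance has no
  feasible solution at all, then its output is irrelevant.
\<close>

definition poly_time_approx ::
    "('i, 's) min_problem \<Rightarrow> ('i \<Rightarrow> bool) \<Rightarrow> ('i \<Rightarrow> store) \<Rightarrow> ('i \<Rightarrow> nat) \<Rightarrow> ('i \<Rightarrow> real) \<Rightarrow> com \<Rightarrow> bool"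
  where
  "poly_time_approx P valid enc size_of ratio prog \<longleftrightarrow>
     (\<exists>q :: nat poly. \<forall>I. valid I \<longrightarrow>
        (\<exists>t s. exec prog (enc I) t s \<and> t \<le> poly q (size_of I) \<and>
           (solutions P I \<noteq> {} \<longrightarrow>
              decode P I s \<in> solutions P I \<and> cost P I (decode P I s) \<le> ratio I * opt P I)))"

text \<open>
  Running times are measured in the number of points, which bounds the input length of an
  instance polynomially in the unit-cost model, respectively in the number of points plus the
  dimension of the ambient space.
\<close>

definition approx_alg :: "(cluster_inst, 's) min_problem \<Rightarrow> (cluster_inst \<Rightarrow> real) \<Rightarrow> com \<Rightarrow> bool" where
  "approx_alg P ratio prog \<longleftrightarrow> poly_time_approx P valid_inst encode num_points ratio prog"

definition lp_approx_alg ::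
    "ereal \<Rightarrow> (lp_inst, 's) min_problem \<Rightarrow> (lp_inst \<Rightarrow> real) \<Rightarrow> com \<Rightarrow> bool" where
  "lp_approx_alg p P ratio prog \<longleftrightarrow>
     poly_time_approx P (valid_lp_inst p) encode_lp (\<lambda>I. num_points I + space_dim I) ratio prog"

end

(*
  For a radius r, let T(v) be the connected component of v in the subgraph induced by the ball of
  radius r around v.  If r is at least the optimal diameter, then the greedy choice of vertices v not
  contained in earlier sets T(v) yields at most k sets covering all points, since two chosen vertices
  cannot belong to the same optimal cluster.  The algorithm takes the smallest distance r for which
  this works.

  To make the sets T(c) disjoint, they are processed by increasing rank of the centre c, and the
  unassigned vertices of T(c) are attached, within T(c), to clusters already present.  The chain of
  sets that leads from a vertex to the root of its cluster has nonincreasing ranks and consecutive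
  sets intersect.  With L ranks such that a chain of constant rank reaches at most distance h, the
  final radius is at most L * (h + 2r).  The three cases of the theorem differ in the ranks only:
  ball growing gives L = O(log k) and h = O(r log k); colouring an r-net of a doubling metric gives
  L = K^3 and h = 2r; for points in D-dimensional space, each coordinate is cut into zones of length
  2r, and the rank is a residue modulo D + 1 that is missed by the zone numbers of all D coordinates,
  which gives L = D + 1 and h = O(r D^(1 + 1/p)).
*)
theory Submission
  imports Defs
begin

section \<open>Loop programs\<close>

text \<open>A layer costs \<open>h + 2 * r\<close> because a route from a vertex leads to the centre
  of its set, along a chain of centres of one rank, and from the last centre to a vertex that was
  close to the root before. The number \<open>L\<close> of ranks exists in the analysis only: the
  program runs through all conceivable ranks, and a layer without centres adds nothing to the
  radius. The machine shapes the rest of the proof. Halting in polynomial time has to be shown for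
  While programs, so the algorithms are written with counting loops bounded by input parameters; the
  time bound then follows from the syntax, and only values remain to be verified. Fixed points, such
  as reachability, become \<open>n * n\<close> repetitions of one sweep. There is neither division
  nor rounding, so a coordinate cannot be sent to a grid cell by arithmetic. Zones start at data
  points instead, their residue is kept by a cyclic counter, and a long gap is crossed in one step,
  since filling it with empty zones would take a number of rounds that depends on the
  distances.\<close>

datatype prog =
    Skp
  | NAsn name nexp nexp nexp
  | RAsn name nexp nexp rexp
  | Sq prog prog (infixr ";;" 60)
  | Cnd bexp prog prog
  | For name nexp prog

abbreviation "N0 \<equiv> NConst 0"
abbreviation "N1 \<equiv> NConst 1"
abbreviation nvar :: "name \<Rightarrow> nexp" where "nvar x \<equiv> NRead x N0 N0"
abbreviation rvar :: "name \<Rightarrow> rexp" where "rvar x \<equiv> RRead x N0 N0"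
abbreviation narr :: "name \<Rightarrow> name \<Rightarrow> nexp" where "narr a x \<equiv> NRead a (nvar x) N0"
abbreviation nmat :: "name \<Rightarrow> name \<Rightarrow> name \<Rightarrow> nexp" where "nmat a x y \<equiv> NRead a (nvar x) (nvar y)"
abbreviation rmat :: "name \<Rightarrow> name \<Rightarrow> name \<Rightarrow> rexp" where "rmat a x y \<equiv> RRead a (nvar x) (nvar y)"
abbreviation nset :: "name \<Rightarrow> nexp \<Rightarrow> prog" where "nset x e \<equiv> NAsn x N0 N0 e"
abbreviation rset :: "name \<Rightarrow> rexp \<Rightarrow> prog" where "rset x e \<equiv> RAsn x N0 N0 e"
abbreviation aset :: "name \<Rightarrow> name \<Rightarrow> nexp \<Rightarrow> prog" where "aset a x e \<equiv> NAsn a (nvar x) N0 e"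
abbreviation mset :: "name \<Rightarrow> name \<Rightarrow> name \<Rightarrow> nexp \<Rightarrow> prog" where "mset a x y e \<equiv> NAsn a (nvar x) (nvar y) e"
abbreviation pos :: "nexp \<Rightarrow> bexp" where "pos e \<equiv> NLess N0 e"
abbreviation zer :: "nexp \<Rightarrow> bexp" where "zer e \<equiv> Not (NLess N0 e)"
abbreviation rle :: "rexp \<Rightarrow> rexp \<Rightarrow> bexp" where "rle a b \<equiv> Not (RLess b a)"
abbreviation neq :: "nexp \<Rightarrow> nexp \<Rightarrow> bexp" where "neq a b \<equiv> And (Not (NLess a b)) (Not (NLess b a))"
abbreviation orb :: "bexp \<Rightarrow> bexp \<Rightarrow> bexp" where "orb a b \<equiv> Not (And (Not a) (Not b))"
abbreviation whn :: "bexp \<Rightarrow> prog \<Rightarrow> prog" where "whn b p \<equiv> Cnd b p Skp"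
abbreviation incr :: "name \<Rightarrow> prog" where "incr x \<equiv> nset x (NAdd (nvar x) N1)"

definition setN :: "name \<Rightarrow> nat \<Rightarrow> store \<Rightarrow> store" where
  "setN x i s = s\<lparr>nats := write_cell (nats s) x 0 0 i\<rparr>"

primrec iter :: "(nat \<Rightarrow> 'a \<Rightarrow> 'a) \<Rightarrow> nat \<Rightarrow> 'a \<Rightarrow> 'a" where
  "iter f 0 s = s"
| "iter f (Suc i) s = f i (iter f i s)"

text \<open>Total, since every loop is bounded. The bound is evaluated once, before the loop, and
  the counter ends at the bound because this is the value with which the While loop produced by
  \<open>com_of\<close> exits; so both semantics agree on the whole store.\<close>

primrec ev :: "prog \<Rightarrow> store \<Rightarrow> store" where
  "ev Skp = (\<lambda>s. s)"
| "ev (NAsn x a b e) = (\<lambda>s. s\<lparr>nats := write_cell (nats s) x (nval a s) (nval b s) (nval e s)\<rparr>)"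
| "ev (RAsn x a b e) = (\<lambda>s. s\<lparr>reals := write_cell (reals s) x (nval a s) (nval b s) (rval e s)\<rparr>)"
| "ev (p ;; q) = (\<lambda>s. ev q (ev p s))"
| "ev (Cnd b p q) = (\<lambda>s. if bval b s then ev p s else ev q s)"
| "ev (For x b p) = (\<lambda>s. setN x (nval b s) (iter (\<lambda>i t. ev p (setN x i t)) (nval b s) s))"

primrec com_of :: "prog \<Rightarrow> com" where
  "com_of Skp = Skip"
| "com_of (NAsn x a b e) = NAssign x a b e"
| "com_of (RAsn x a b e) = RAssign x a b e"
| "com_of (p ;; q) = Seq (com_of p) (com_of q)"
| "com_of (Cnd b p q) = If b (com_of p) (com_of q)"
| "com_of (For x b p) = Seq (NAssign x N0 N0 N0)
     (While (NLess (nvar x) b) (Seq (com_of p) (NAssign x N0 N0 (NAdd (nvar x) N1))))"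

primrec nw :: "prog \<Rightarrow> name set" where
  "nw Skp = {}"
| "nw (NAsn x a b e) = {x}"
| "nw (RAsn x a b e) = {}"
| "nw (p ;; q) = nw p \<union> nw q"
| "nw (Cnd b p q) = nw p \<union> nw q"
| "nw (For x b p) = insert x (nw p)"

primrec rw :: "prog \<Rightarrow> name set" where
  "rw Skp = {}"
| "rw (NAsn x a b e) = {}"
| "rw (RAsn x a b e) = {x}"
| "rw (p ;; q) = rw p \<union> rw q"
| "rw (Cnd b p q) = rw p \<union> rw q"
| "rw (For x b p) = rw p"

abbreviation "nN \<equiv> nvar ''n''"
abbreviation "nD \<equiv> nvar ''dim''"
abbreviation "nL \<equiv> NAdd (NAdd nN nD) N1"

text \<open>The While loop evaluates its bound at every test. As \<open>n\<close> and
  \<open>dim\<close> are never written and the body leaves the counter alone, the bound keeps its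
  value, and a loop has at most \<open>n + dim + 1\<close> rounds.\<close>

primrec wf_prog :: "prog \<Rightarrow> bool" where
  "wf_prog Skp = True"
| "wf_prog (NAsn x a b e) = (x \<noteq> ''n'' \<and> x \<noteq> ''dim'')"
| "wf_prog (RAsn x a b e) = True"
| "wf_prog (p ;; q) = (wf_prog p \<and> wf_prog q)"
| "wf_prog (Cnd b p q) = (wf_prog p \<and> wf_prog q)"
| "wf_prog (For x b p) = (x \<noteq> ''n'' \<and> x \<noteq> ''dim'' \<and> b \<in> {nN, nD, nL} \<and> x \<notin> nw p \<and> wf_prog p)"

text \<open>The variable of the polynomial stands for a number \<open>M\<close> above all loop
  bounds. A round pays for its body, one test and one increment; the constant 2 pays for the
  initialisation and the failing test.\<close>

primrec time_poly :: "prog \<Rightarrow> nat poly" where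
  "time_poly Skp = 1"
| "time_poly (NAsn x a b e) = 1"
| "time_poly (RAsn x a b e) = 1"
| "time_poly (p ;; q) = time_poly p + time_poly q"
| "time_poly (Cnd b p q) = 1 + time_poly p + time_poly q"
| "time_poly (For x b p) = 2 + [:0, 1:] * (time_poly p + 2)"

section \<open>Frame conditions and the invariant rule for loops\<close>

lemma nats_setN: "nats (setN x i s) y = (if y = x then (nats s x)(0 := (nats s x 0)(0 := i)) else nats s y)"
  and reals_setN [simp]: "reals (setN x i s) = reals s"
  by (auto simp: setN_def write_cell_def)

lemma nats_setN_same [simp]: "nats (setN x i s) x 0 0 = i"
  and nats_setN_other [simp]: "y \<noteq> x \<Longrightarrow> nats (setN x i s) y = nats s y"
  by (simp_all add: nats_setN)

lemma write_cell_apply [simp]: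
  "write_cell m x i j v y = (if y = x then (m x)(i := (m x i)(j := v)) else m y)"
  by (auto simp: write_cell_def)

text \<open>Footprints are kept per array name and not per cell: indices are computed at run time,
  whereas names are part of the syntax, so \<open>nw\<close> and \<open>rw\<close> can be evaluated
  by the simplifier.\<close>

definition frame :: "name set \<Rightarrow> name set \<Rightarrow> store \<Rightarrow> store \<Rightarrow> bool" where
  "frame A B s t \<longleftrightarrow> (\<forall>y. y \<notin> A \<longrightarrow> nats t y = nats s y) \<and> (\<forall>y. y \<notin> B \<longrightarrow> reals t y = reals s y)"

lemma frame_refl [simp]: "frame A B s s"
  by (simp add: frame_def)

lemma frame_trans: "frame A B s t \<Longrightarrow> frame A B t u \<Longrightarrow> frame A B s u"
  by (simp add: frame_def)

lemma frame_mono: "frame A B s t \<Longrightarrow> A \<subseteq> A' \<Longrightarrow> B \<subseteq> B' \<Longrightarrow> frame A' B' s t"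
  by (auto simp: frame_def)

lemma frame_nats: "frame A B s t \<Longrightarrow> y \<notin> A \<Longrightarrow> nats t y = nats s y"
  and frame_reals: "frame A B s t \<Longrightarrow> y \<notin> B \<Longrightarrow> reals t y = reals s y"
  by (simp_all add: frame_def)

lemma frame_setN: "x \<in> A \<Longrightarrow> frame A B s t \<Longrightarrow> frame A B s (setN x i t)"
  by (auto simp: frame_def nats_setN)

lemma frame_iter:
  assumes "\<And>i t. frame A B t (f i t)"
  shows "frame A B s (iter f m s)"
  by (induction m) (auto intro: frame_trans assms)

lemma frame_ev: "frame (nw p) (rw p) s (ev p s)"
proof (induction p arbitrary: s)
  case (Sq p q)
  have "frame (nw (p ;; q)) (rw (p ;; q)) s (ev p s)"
    using frame_mono[OF Sq(1)] by simp
  moreover have "frame (nw (p ;; q)) (rw (p ;; q)) (ev p s) (ev q (ev p s))"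
    using frame_mono[OF Sq(2)] by simp
  ultimately show ?case by (auto intro: frame_trans)
next
  case (Cnd b p q)
  show ?case using frame_mono[OF Cnd(1)] frame_mono[OF Cnd(2)] by auto
next
  case (For x b p)
  have "frame (insert x (nw p)) (rw p) t (ev p (setN x i t))" for i t
    by (rule frame_trans[OF frame_setN[OF _ frame_refl] frame_mono[OF For]]) auto
  then show ?case by (auto intro!: frame_setN frame_iter)
qed (auto simp: frame_def write_cell_def)

lemma nats_ev: "y \<notin> nw p \<Longrightarrow> nats (ev p s) y = nats s y"
  and reals_ev: "y \<notin> rw p \<Longrightarrow> reals (ev p s) y = reals s y"
  using frame_ev[of p s] by (simp_all add: frame_def)

text \<open>The step also receives a frame condition relative to the start of the loop, which
  supplies the values of all arrays that the body never writes. The condition \<open>var\<close>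
  makes the invariant blind to the counter, which is overwritten before each round and after the
  last one.\<close>

lemma For_inv:
  assumes N: "nval b s = N"
    and init: "Inv 0 s"
    and var: "\<And>i t j. Inv i t \<Longrightarrow> Inv i (setN x j t)"
    and step: "\<And>i t. i < N \<Longrightarrow> Inv i t \<Longrightarrow> nats t x 0 0 = i \<Longrightarrow>
      frame (insert x (nw p)) (rw p) s t \<Longrightarrow> Inv (Suc i) (ev p t)"
  shows "Inv N (ev (For x b p) s)"
proof -
  define f where "f = (\<lambda>i t. ev p (setN x i t))"
  have fr: "frame (insert x (nw p)) (rw p) t (f i t)" for i t
    unfolding f_def by (rule frame_trans[OF frame_setN[OF _ frame_refl] frame_mono[OF frame_ev]]) auto
  have "i \<le> N \<Longrightarrow> Inv i (iter f i s)" for i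
  proof (induction i)
    case (Suc i)
    have "Inv (Suc i) (ev p (setN x i (iter f i s)))"
    proof (rule step)
      show "frame (insert x (nw p)) (rw p) s (setN x i (iter f i s))"
        by (intro frame_setN frame_iter fr) simp
    qed (use Suc in \<open>auto intro: var\<close>)
    then show ?case by (simp add: f_def)
  qed (simp add: init)
  then show ?thesis using N var by (simp add: f_def)
qed

lemma wf_prog_nw: "wf_prog p \<Longrightarrow> ''n'' \<notin> nw p \<and> ''dim'' \<notin> nw p"
  by (induction p) auto

text \<open>Induction on the program, with the final store given by \<open>ev\<close>. Preservation
  of \<open>n\<close> and \<open>dim\<close> carries the bound \<open>M\<close> from one command to
  the next.\<close>

lemma exec_com_of:
  assumes "wf_prog p" "nats s ''n'' 0 0 + nats s ''dim'' 0 0 + 1 \<le> M"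
  shows "\<exists>t\<le>poly (time_poly p) M. exec (com_of p) s t (ev p s)"
  using assms
proof (induction p arbitrary: s)
  case Skp
  then show ?case using exec.Skip by (intro exI[of _ 1]) auto
next
  case (NAsn x a b e)
  then show ?case using exec.NAssign by (intro exI[of _ 1]) auto
next
  case (RAsn x a b e)
  then show ?case using exec.RAssign by (intro exI[of _ 1]) auto
next
  case (Sq p q)
  have "nats (ev p s) ''n'' = nats s ''n''" "nats (ev p s) ''dim'' = nats s ''dim''"
    using Sq.prems wf_prog_nw[of p] by (auto simp: nats_ev)
  then obtain t1 t2 where "t1 \<le> poly (time_poly p) M" "exec (com_of p) s t1 (ev p s)"
    "t2 \<le> poly (time_poly q) M" "exec (com_of q) (ev p s) t2 (ev q (ev p s))"
    using Sq.IH(1)[of s] Sq.IH(2)[of "ev p s"] Sq.prems by auto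
  then show ?case by (auto intro!: exI[of _ "t1 + t2"] exec.Seq)
next
  case (Cnd b p q)
  show ?case
  proof (cases "bval b s")
    case True
    then obtain t where "t \<le> poly (time_poly p) M" "exec (com_of p) s t (ev p s)"
      using Cnd by auto
    then show ?thesis using True by (auto intro!: exI[of _ "1 + t"] exec.IfTrue[simplified])
  next
    case False
    then obtain t where "t \<le> poly (time_poly q) M" "exec (com_of q) s t (ev q s)"
      using Cnd by auto
    then show ?thesis using False by (auto intro!: exI[of _ "1 + t"] exec.IfFalse[simplified])
  qed
next
  case (For x b p)
  define f where "f = (\<lambda>i t. ev p (setN x i t))"
  define N where "N = nval b s"
  have fr: "frame (insert x (nw p)) (rw p) t (f i t)" for i t
    unfolding f_def by (rule frame_trans[OF frame_setN[OF _ frame_refl] frame_mono[OF frame_ev]]) auto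
  have fr_iter: "frame (insert x (nw p)) (rw p) s (setN x j (iter f i s))" for i j
    by (intro frame_setN frame_iter fr) simp
  have b: "b \<in> {nN, nD, nL}" and x: "x \<notin> {''n'', ''dim''}" "x \<notin> nw p" and "wf_prog p"
    using For.prems by auto
  have nd: "nats (setN x j (iter f i s)) ''n'' = nats s ''n''"
    "nats (setN x j (iter f i s)) ''dim'' = nats s ''dim''" for i j
    using fr_iter[of j i] wf_prog_nw[OF \<open>wf_prog p\<close>] x by (auto simp: frame_def)
  have bN: "nval b (setN x j (iter f i s)) = N" for i j
    using b nd[of j i] by (auto simp: N_def)
  have "N \<le> M" using b For.prems by (auto simp: N_def)
  \<comment> \<open>Downward induction from the exit state. A round from counter \<open>i\<close>
    costs the test, the body and the increment, at most \<open>poly (time_poly p) M + 2\<close>; the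
    remaining 1 is the failing test.\<close>
  have loop: "i \<le> N \<Longrightarrow> \<exists>t\<le>1 + (N - i) * (poly (time_poly p) M + 2).
     exec (While (NLess (nvar x) b) (Seq (com_of p) (NAssign x N0 N0 (NAdd (nvar x) N1))))
       (setN x i (iter f i s)) t (setN x N (iter f N s))" for i
  proof (induction i rule: inc_induct)
    case base
    then show ?case using exec.WhileFalse[of "NLess (nvar x) b" "setN x N (iter f N s)"] bN by auto
  next
    case (step i)
    obtain t where t: "t \<le> 1 + (N - Suc i) * (poly (time_poly p) M + 2)"
      "exec (While (NLess (nvar x) b) (Seq (com_of p) (NAssign x N0 N0 (NAdd (nvar x) N1))))
       (setN x (Suc i) (iter f (Suc i) s)) t (setN x N (iter f N s))"
      using step by blast
    obtain u where u: "u \<le> poly (time_poly p) M"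
      "exec (com_of p) (setN x i (iter f i s)) u (ev p (setN x i (iter f i s)))"
      using For.IH[of "setN x i (iter f i s)"] \<open>wf_prog p\<close> For.prems(2) nd by auto
    let ?t = "ev p (setN x i (iter f i s))"
    have "nats ?t x 0 0 = i" using x by (simp add: nats_ev)
    then have "exec (NAssign x N0 N0 (NAdd (nvar x) N1)) ?t 1 (setN x (Suc i) (iter f (Suc i) s))"
      using exec.NAssign[of x N0 N0 "NAdd (nvar x) N1" ?t] by (simp add: setN_def f_def)
    from exec.Seq[OF u(2) this]
    have "exec (While (NLess (nvar x) b) (Seq (com_of p) (NAssign x N0 N0 (NAdd (nvar x) N1))))
       (setN x i (iter f i s)) (1 + (u + 1) + t) (setN x N (iter f N s))"
      by (rule exec.WhileTrue[rotated]) (use step bN t in auto)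
    moreover have "1 + (u + 1) + t \<le> 1 + (N - i) * (poly (time_poly p) M + 2)"
    proof -
      have "N - i = Suc (N - Suc i)" using step by auto
      then show ?thesis using t u by simp
    qed
    ultimately show ?case by blast
  qed
  obtain t where t: "t \<le> 1 + N * (poly (time_poly p) M + 2)"
     "exec (While (NLess (nvar x) b) (Seq (com_of p) (NAssign x N0 N0 (NAdd (nvar x) N1))))
       (setN x 0 s) t (setN x N (iter f N s))"
    using loop[of 0] by auto
  have "exec (NAssign x N0 N0 N0) s 1 (setN x 0 s)"
    using exec.NAssign[of x N0 N0 N0 s] by (simp add: setN_def)
  from exec.Seq[OF this t(2)] have "exec (com_of (For x b p)) s (1 + t) (ev (For x b p) s)"
    by (simp add: f_def N_def)
  moreover have "1 + t \<le> poly (time_poly (For x b p)) M"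
  proof -
    have "N * (poly (time_poly p) M + 2) \<le> M * (poly (time_poly p) M + 2)"
      using \<open>N \<le> M\<close> by (rule mult_le_mono1)
    then show ?thesis using t(1) by (simp add: algebra_simps)
  qed
  ultimately show ?case by blast
qed

text \<open>Loops stay folded from here on: the simplifier executes straight-line code, and every
  loop is handled by an invariant rule.\<close>

declare ev.simps(6) [simp del]

section \<open>Connected clusterings\<close>

lemma connected_clusteringD:
  assumes "connected_clustering V E k C" "finite V" "i < k"
  shows "C i \<subseteq> V" "finite (C i)" "C i \<noteq> {}"
proof -
  have "\<Union> (C ` {..<k}) = V" "{} \<notin> C ` {..<k}"
    using assms(1) unfolding connected_clustering_def partition_on_def by auto
  then show "C i \<subseteq> V" "C i \<noteq> {}" using assms(3) by auto
  then show "finite (C i)" using assms(2) finite_subset by auto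
qed

lemma center_cost_le_iff:
  assumes "connected_clustering V E k C" "finite V" "k \<ge> 1"
  shows "center_cost d k C c \<le> r \<longleftrightarrow> (\<forall>i<k. \<forall>x\<in>C i. d x (c i) \<le> r)"
proof -
  have "{..<k} \<noteq> {}" using assms(3) by (auto simp: lessThan_empty_iff)
  then show ?thesis unfolding center_cost_def
    using connected_clusteringD[OF assms(1,2)] by simp (simp only: Ball_def lessThan_iff)
qed

lemma diameter_cost_le_iff:
  assumes "connected_clustering V E k C" "finite V" "k \<ge> 1"
  shows "diameter_cost d k C \<le> r \<longleftrightarrow> (\<forall>i<k. \<forall>x\<in>C i. \<forall>y\<in>C i. d x y \<le> r)"
proof -
  have "{..<k} \<noteq> {}" using assms(3) by (auto simp: lessThan_empty_iff)
  then show ?thesis unfolding diameter_cost_def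
    using connected_clusteringD[OF assms(1,2)] by simp (simp only: Ball_def lessThan_iff)
qed

text \<open>The maxima are over finite nonempty sets. Hence the optimal diameter is among the
  \<open>n * n\<close> distances tried by the search, and \<open>opt\<close> is a minimum over a
  finite set.\<close>

lemma diameter_cost_attained:
  assumes "connected_clustering V E k C" "finite V" "k \<ge> 1"
  shows "\<exists>a\<in>V. \<exists>b\<in>V. diameter_cost d k C = d a b"
proof -
  define f where "f = (\<lambda>i. MAX x\<in>C i. MAX y\<in>C i. d x y)"
  note C = connected_clusteringD[OF assms(1,2)]
  have "{..<k} \<noteq> {}" using assms(3) by (auto simp: lessThan_empty_iff)
  then have "diameter_cost d k C \<in> f ` {..<k}"
    unfolding diameter_cost_def f_def by (intro Max_in) auto
  then obtain i where i: "i < k" "diameter_cost d k C = f i" by auto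
  have "f i \<in> (\<lambda>x. MAX y\<in>C i. d x y) ` C i"
    unfolding f_def using C[OF i(1)] by (intro Max_in) auto
  then obtain x where x: "x \<in> C i" "f i = (MAX y\<in>C i. d x y)" by auto
  have "f i \<in> (\<lambda>y. d x y) ` C i"
    unfolding x(2) using C[OF i(1)] by (intro Max_in) auto
  then show ?thesis using i x C(1)[OF i(1)] by auto
qed

lemma center_cost_attained:
  assumes "connected_clustering V E k C" "finite V" "k \<ge> 1" "\<forall>i<k. c i \<in> C i"
  shows "\<exists>a\<in>V. \<exists>b\<in>V. center_cost d k C c = d a b"
proof -
  define f where "f = (\<lambda>i. MAX x\<in>C i. d x (c i))"
  note C = connected_clusteringD[OF assms(1,2)]
  have "{..<k} \<noteq> {}" using assms(3) by (auto simp: lessThan_empty_iff)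
  then have "center_cost d k C c \<in> f ` {..<k}"
    unfolding center_cost_def f_def by (intro Max_in) auto
  then obtain i where i: "i < k" "center_cost d k C c = f i" by auto
  have "f i \<in> (\<lambda>x. d x (c i)) ` C i"
    unfolding f_def using C[OF i(1)] by (intro Max_in) auto
  then show ?thesis using i C(1)[OF i(1)] assms(4) by auto
qed

text \<open>Representatives of disjoint nonempty parts are distinct. This guarantees that there are
  enough points for \<open>k\<close> roots.\<close>

lemma clustering_card_le:
  assumes "connected_clustering V E k C" "finite V"
  shows "k \<le> card V"
proof -
  have c: "\<forall>i<k. C i \<noteq> {}" and sub: "\<forall>i<k. C i \<subseteq> V"
    using connected_clusteringD[OF assms] by auto
  define g where "g i = (SOME x. x \<in> C i)" for i
  have g: "g i \<in> C i" if "i < k" for i unfolding g_def using c that by (simp add: some_in_eq)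
  have "inj_on g {..<k}"
  proof (rule inj_onI)
    fix i j assume ij: "i \<in> {..<k}" "j \<in> {..<k}" "g i = g j"
    then have "C i = C j"
      using assms(1) g[of i] g[of j] unfolding connected_clustering_def partition_on_def disjoint_def
      by (metis disjoint_iff imageI lessThan_iff)
    then show "i = j" using assms(1) ij unfolding connected_clustering_def inj_on_def by blast
  qed
  moreover have "g ` {..<k} \<subseteq> V" using g sub by auto
  ultimately show ?thesis using card_inj_on_le[of g "{..<k}" V] assms(2) by simp
qed

section \<open>The greedy cover and its comparison with the optimum\<close>

locale conn_inst = Metric_space "{..<n}" d for n :: nat and d :: "nat \<Rightarrow> nat \<Rightarrow> real" +
  fixes k :: nat and E :: "(nat \<times> nat) set"
  assumes k1: "k \<ge> 1" and E_sub: "E \<subseteq> {..<n} \<times> {..<n}" and sym_E: "sym E"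
begin

text \<open>The set \<open>T(c)\<close> of the overview. The reflexive closure puts \<open>c\<close>
  into its own component whatever the radius is.\<close>

definition component :: "real \<Rightarrow> nat \<Rightarrow> nat set" where
  "component r c = {w. (c, w) \<in> (Restr E {x. x < n \<and> d c x \<le> r})\<^sup>*}"

text \<open>\<open>greedy r m\<close> is the choice made after the vertices below \<open>m\<close>
  have been examined in the order of their indices, the order in which the loop of
  \<open>greedy_prog\<close> visits them.\<close>

primrec greedy :: "real \<Rightarrow> nat \<Rightarrow> nat set" where
  "greedy r 0 = {}"
| "greedy r (Suc m) = (if \<exists>c\<in>greedy r m. m \<in> component r c then greedy r m else insert m (greedy r m))"

lemma component_self [simp]: "c \<in> component r c"
  by (simp add: component_def)

lemma componentD:
  assumes "w \<in> component r c" "c < n" "0 \<le> r"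
  shows "w < n" "d c w \<le> r"
  using assms by (auto simp: component_def elim: rtranclE)

lemma component_step:
  assumes "u \<in> component r c" "(u, w) \<in> E" "c < n" "0 \<le> r" "d c w \<le> r"
  shows "w \<in> component r c"
proof -
  have "u < n" "d c u \<le> r" using componentD assms by blast+
  then have "(u, w) \<in> Restr E {x. x < n \<and> d c x \<le> r}" using assms E_sub by blast
  then show ?thesis using assms(1) unfolding component_def mem_Collect_eq by (rule rtrancl_into_rtrancl[rotated])
qed

lemma greedy_sub: "greedy r m \<subseteq> {..<m}"
  by (induction m) (auto simp: less_Suc_eq)

lemma finite_greedy [simp]: "finite (greedy r m)"
  using greedy_sub finite_subset by blast

lemma greedy_covers: "v < m \<Longrightarrow> \<exists>c\<in>greedy r m. v \<in> component r c"
  by (induction m) (auto simp: less_Suc_eq)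

text \<open>The later vertex is chosen only if no earlier component contains it. Nothing is claimed
  in the other direction: membership is not symmetric, because the ball is centred at
  \<open>c\<close>.\<close>

lemma greedy_separated: "c \<in> greedy r m \<Longrightarrow> c' \<in> greedy r m \<Longrightarrow> c < c' \<Longrightarrow> c' \<notin> component r c"
proof (induction m)
  case (Suc m)
  have "c < m"
    using Suc.prems greedy_sub[of r "Suc m"] by fastforce
  then have "c \<in> greedy r m" using Suc.prems(1) by (simp split: if_split_asm)
  then show ?case using Suc by (simp split: if_split_asm) blast
qed simp

text \<open>A cluster of diameter at most \<open>r\<close> that contains \<open>v\<close> lies in
  the ball of radius \<open>r\<close> around \<open>v\<close>; being connected, it lies in
  \<open>component r v\<close>. Two chosen vertices in one cluster would contradict separation, so
  mapping the chosen vertices to their clusters is injective.\<close>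

lemma card_greedy_le:
  assumes C: "connected_clustering {..<n} E k C" and r: "diameter_cost d k C \<le> r"
  shows "card (greedy r n) \<le> k"
proof -
  have d: "\<And>i x y. i < k \<Longrightarrow> x \<in> C i \<Longrightarrow> y \<in> C i \<Longrightarrow> d x y \<le> r"
    using r diameter_cost_le_iff[OF C _ k1, of d r] by auto
  have "\<exists>i<k. v \<in> C i" if "v < n" for v
    using C that unfolding connected_clustering_def partition_on_def by auto
  then obtain f where f: "\<And>v. v < n \<Longrightarrow> f v < k \<and> v \<in> C (f v)" by metis
  have no: False if "v \<in> greedy r n" "w \<in> greedy r n" "v < w" "f v = f w" for v w
  proof -
    have vw: "v < n" "w < n" using that greedy_sub by auto
    have "(v, w) \<in> (Restr E (C (f v)))\<^sup>*"
      using C f[of v] f[of w] that vw unfolding connected_clustering_def connected_in_def by metis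
    moreover have "C (f v) \<subseteq> {x. x < n \<and> d v x \<le> r}"
      using d[of "f v" v] f[of v] vw connected_clusteringD(1)[OF C, of "f v"] by auto
    then have "(Restr E (C (f v)))\<^sup>* \<subseteq> (Restr E {x. x < n \<and> d v x \<le> r})\<^sup>*"
      by (intro rtrancl_mono) auto
    ultimately have "w \<in> component r v" by (auto simp: component_def)
    then show False using greedy_separated that by blast
  qed
  have "inj_on f (greedy r n)"
  proof (rule inj_onI)
    fix v w assume "v \<in> greedy r n" "w \<in> greedy r n" "f v = f w"
    then show "v = w" using no[of v w] no[of w v] by (cases v w rule: linorder_cases) auto
  qed
  moreover have "f ` greedy r n \<subseteq> {..<k}" using f greedy_sub by blast
  ultimately show ?thesis using card_inj_on_le[of f "greedy r n" "{..<k}"] by simp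
qed

text \<open>The comparison is with all distances at which the greedy choice succeeds. Success is not
  assumed to be monotone in the radius, so the search tries every distance instead of
  bisecting.\<close>

definition best_radius :: "real \<Rightarrow> bool" where
  "best_radius r \<longleftrightarrow> 0 \<le> r \<and> card (greedy r n) \<le> k \<and>
     (\<forall>a<n. \<forall>b<n. card (greedy (d a b) n) \<le> k \<longrightarrow> r \<le> d a b)"

lemma best_radius_le_diameter:
  assumes "best_radius r" "connected_clustering {..<n} E k C"
  shows "r \<le> diameter_cost d k C"
proof -
  obtain a b where ab: "a < n" "b < n" "diameter_cost d k C = d a b"
    using diameter_cost_attained[OF assms(2) _ k1, of d] by auto
  have "card (greedy (d a b) n) \<le> k" using card_greedy_le[OF assms(2)] ab by auto
  then show ?thesis using assms(1) ab unfolding best_radius_def by auto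
qed

text \<open>The triangle inequality through the centre. It serves the lower bound, turning a
  comparison with the optimal diameter into one with the optimal radius, and the upper bound on the
  diameter of the output.\<close>

lemma diameter_le_center:
  assumes C: "connected_clustering {..<n} E k C" and c: "\<forall>i<k. c i \<in> C i"
  shows "diameter_cost d k C \<le> 2 * center_cost d k C c"
proof -
  let ?r = "center_cost d k C c"
  have r: "d x (c i) \<le> ?r" if "i < k" "x \<in> C i" for i x
    using center_cost_le_iff[OF C _ k1, of d c ?r] that by simp
  have "d x y \<le> 2 * ?r" if "i < k" "x \<in> C i" "y \<in> C i" for i x y
  proof -
    have "c i \<in> {..<n}" "x \<in> {..<n}" "y \<in> {..<n}"
      using connected_clusteringD(1)[OF C _ that(1)] that c by auto
    then show ?thesis
      using triangle[of x "c i" y] commute[of "c i" y] r[OF that(1,2)] r[OF that(1,3)] by linarith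
  qed
  then show ?thesis using diameter_cost_le_iff[OF C _ k1, of d "2 * ?r"] by simp
qed

text \<open>Joining each point to the centre of its cluster suffices: edges are symmetric, so any
  two points of a cluster are connected through the centre. The centres also witness that the
  clusters are nonempty and distinct.\<close>

lemma clustering_of_labels:
  assumes lab: "\<And>v. v < n \<Longrightarrow> lab v < k"
    and ctr: "\<And>i. i < k \<Longrightarrow> ctr i < n \<and> lab (ctr i) = i"
    and conn: "\<And>v. v < n \<Longrightarrow> (ctr (lab v), v) \<in> (Restr E {x. x < n \<and> lab x = lab v})\<^sup>*"
  shows "connected_clustering {..<n} E k (\<lambda>i. {x \<in> {..<n}. lab x = i})"
proof -
  let ?C = "\<lambda>i. {x \<in> {..<n}. lab x = i}"
  have ne: "ctr i \<in> ?C i" if "i < k" for i using ctr that by auto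
  have "connected_in E (?C i)" for i
    unfolding connected_in_def
  proof (intro ballI)
    fix x y assume xy: "x \<in> ?C i" "y \<in> ?C i"
    have "sym ((Restr E (?C i))\<^sup>*)" using sym_E by (intro sym_rtrancl) (auto simp: sym_def)
    moreover have "{v. v < n \<and> lab v = i} = ?C i" by auto
    then have "(ctr i, x) \<in> (Restr E (?C i))\<^sup>*" and y: "(ctr i, y) \<in> (Restr E (?C i))\<^sup>*"
      using conn[of x] conn[of y] xy by simp_all
    ultimately have "(x, ctr i) \<in> (Restr E (?C i))\<^sup>*" by (blast dest: symD)
    then show "(x, y) \<in> (Restr E (?C i))\<^sup>*" using y by (rule rtrancl_trans)
  qed
  moreover have "partition_on {..<n} (?C ` {..<k})"
    unfolding partition_on_def disjoint_def
  proof (intro conjI ballI impI)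
    show "\<Union> (?C ` {..<k}) = {..<n}" using lab by blast
    show "{} \<notin> ?C ` {..<k}" using ne by blast
  qed auto
  moreover have "inj_on ?C {..<k}"
  proof (rule inj_onI)
    fix i j assume "i \<in> {..<k}" "j \<in> {..<k}" "?C i = ?C j"
    then have "ctr i \<in> ?C j" using ne[of i] by blast
    then show "i = j" using ne[of i] \<open>i \<in> {..<k}\<close> by simp
  qed
  ultimately show ?thesis unfolding connected_clustering_def by blast
qed

lemma cost_of_labels:
  assumes C: "connected_clustering {..<n} E k (\<lambda>i. {x \<in> {..<n}. lab x = i})"
    and ctr: "\<And>i. i < k \<Longrightarrow> ctr i < n \<and> lab (ctr i) = i"
    and B: "\<And>v. v < n \<Longrightarrow> d v (ctr (lab v)) \<le> B"
  shows "center_cost d k (\<lambda>i. {x \<in> {..<n}. lab x = i}) ctr \<le> B"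
    and "diameter_cost d k (\<lambda>i. {x \<in> {..<n}. lab x = i}) \<le> 2 * B"
proof -
  show c: "center_cost d k (\<lambda>i. {x \<in> {..<n}. lab x = i}) ctr \<le> B"
    by (subst center_cost_le_iff[OF C _ k1]) (use B in auto)
  show "diameter_cost d k (\<lambda>i. {x \<in> {..<n}. lab x = i}) \<le> 2 * B"
    using diameter_le_center[OF C, of ctr] c ctr by simp
qed

text \<open>
  Overlapping clusters have centres at distance at most \<open>2 * r\<close>, so that \<open>h\<close> bounds how far a chain of
  successively intersecting clusters of equal rank can reach.
\<close>

definition rank_ok :: "real \<Rightarrow> nat set \<Rightarrow> (nat \<Rightarrow> nat) \<Rightarrow> nat \<Rightarrow> real \<Rightarrow> bool" where
  "rank_ok r X rk L h \<longleftrightarrow> (\<forall>c\<in>X. rk c < L) \<and>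
     (\<forall>c\<in>X. \<forall>c'\<in>X. (c, c') \<in> (Restr {(x, y). d x y \<le> 2 * r} {x\<in>X. rk x = rk c})\<^sup>* \<longrightarrow> d c c' \<le> h)"

end

section \<open>Non-disjoint clusters and the search for the radius\<close>

text \<open>Round \<open>(a, b)\<close> of the nested loops is round \<open>a * N + b\<close> of a
  single loop of length \<open>N * N\<close>. Fixed point iterations use this form, as loop bounds
  are linear in the input parameters.\<close>

lemma For2_inv:
  assumes N: "nats s ''n'' 0 0 = N" and n: "''n'' \<notin> insert i (insert j (nw p))"
    and init: "Inv 0 s"
    and var: "\<And>m t l. Inv m t \<Longrightarrow> Inv m (setN i l t)" "\<And>m t l. Inv m t \<Longrightarrow> Inv m (setN j l t)"
    and step: "\<And>m t. Inv m t \<Longrightarrow> frame (insert i (insert j (nw p))) (rw p) s t \<Longrightarrow> Inv (Suc m) (ev p t)"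
  shows "Inv (N * N) (ev (For i nN (For j nN p)) s)"
proof (rule For_inv[where Inv = "\<lambda>a. Inv (a * N)"])
  fix a t assume a: "Inv (a * N) t"
    and fr: "frame (insert i (nw (For j nN p))) (rw (For j nN p)) s t"
  have "Inv (a * N + N) (ev (For j nN p) t)"
  proof (rule For_inv[where Inv = "\<lambda>b. Inv (a * N + b)"])
    show "nval nN t = N" using frame_nats[OF fr, of "''n''"] N n by simp
    fix b u assume "Inv (a * N + b) u" "frame (insert j (nw p)) (rw p) t u"
    then show "Inv (a * N + Suc b) (ev p u)"
      using step[of "a * N + b" u] frame_trans[OF fr[simplified], of u]
        frame_mono[of "insert j (nw p)" "rw p" t u "insert i (insert j (nw p))" "rw p"] by auto
  qed (use a var in auto)
  then show "Inv (Suc a * N) (ev (For j nN p) t)" by (simp add: add.commute)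
qed (use assms in auto)

text \<open>\<open>Q a b\<close> is what round \<open>(a, b)\<close> achieves and later rounds keep,
  \<open>P\<close> is an ordinary invariant. The counter \<open>x\<close> is not written by the
  inner loop, so that its value can be read in the body.\<close>

lemma For_pairs:
  assumes N: "nats s ''n'' 0 0 = N" and n: "''n'' \<notin> insert x (insert y (nw p))" and x: "x \<notin> insert y (nw p)"
    and init: "P s"
    and var: "\<And>t l. P t \<Longrightarrow> P (setN x l t)" "\<And>t l. P t \<Longrightarrow> P (setN y l t)"
      "\<And>a b t l. Q a b t \<Longrightarrow> Q a b (setN x l t)" "\<And>a b t l. Q a b t \<Longrightarrow> Q a b (setN y l t)"
    and step: "\<And>a b t. P t \<Longrightarrow> nats t x 0 0 = a \<Longrightarrow> nats t y 0 0 = b \<Longrightarrow> a < N \<Longrightarrow> b < N \<Longrightarrow>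
       frame (insert x (insert y (nw p))) (rw p) s t \<Longrightarrow>
       P (ev p t) \<and> Q a b (ev p t) \<and> (\<forall>a' b'. Q a' b' t \<longrightarrow> Q a' b' (ev p t))"
  shows "P (ev (For x nN (For y nN p)) s) \<and> (\<forall>a<N. \<forall>b<N. Q a b (ev (For x nN (For y nN p)) s))"
proof (rule For_inv[where Inv = "\<lambda>i t. P t \<and> (\<forall>a<i. \<forall>b<N. Q a b t)"])
  let ?q = "For y nN p"
  fix a t assume a: "a < N" "P t \<and> (\<forall>a'<a. \<forall>b<N. Q a' b t)" "nats t x 0 0 = a"
    and fr: "frame (insert x (nw ?q)) (rw ?q) s t"
  have "P (ev ?q t) \<and> (\<forall>b<N. Q a b (ev ?q t)) \<and> (\<forall>a' b'. Q a' b' t \<longrightarrow> Q a' b' (ev ?q t))"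
  proof (rule For_inv[where Inv = "\<lambda>i u. P u \<and> (\<forall>b<i. Q a b u) \<and> (\<forall>a' b'. Q a' b' t \<longrightarrow> Q a' b' u)"])
    show "nval nN t = N" using frame_nats[OF fr, of "''n''"] N n by simp
    fix b u assume b: "b < N" "P u \<and> (\<forall>b'<b. Q a b' u) \<and> (\<forall>a' b'. Q a' b' t \<longrightarrow> Q a' b' u)" "nats u y 0 0 = b"
      and fr': "frame (insert y (nw p)) (rw p) t u"
    have "frame (insert x (insert y (nw p))) (rw p) s u"
      using frame_trans[OF fr[simplified] frame_mono[OF fr']] by auto
    moreover have "nats u x 0 0 = a" using frame_nats[OF fr' x] a by simp
    ultimately show "P (ev p u) \<and> (\<forall>b'<Suc b. Q a b' (ev p u)) \<and> (\<forall>a' b'. Q a' b' t \<longrightarrow> Q a' b' (ev p u))"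
      using step[of u a b] a b by (auto simp: less_Suc_eq)
  qed (use a var in auto)
  then show "P (ev ?q t) \<and> (\<forall>a'<Suc a. \<forall>b<N. Q a' b (ev ?q t))"
    using a by (auto simp: less_Suc_eq)
qed (use assms in auto)

text \<open>\<open>relpow_finite_bounded\<close> limits the length of a walk by the number of edges.
  The crude bound \<open>n * n\<close> is exactly the number of rounds of a double loop.\<close>

lemma rtrancl_relpow_bound:
  fixes R :: "(nat \<times> nat) set"
  assumes "R \<subseteq> {..<n} \<times> {..<n}" "(x, y) \<in> R\<^sup>*"
  shows "\<exists>m\<le>n * n. (x, y) \<in> R ^^ m"
proof -
  have fin: "finite R" using assms(1) by (rule finite_subset) simp
  have "card R \<le> card ({..<n} \<times> {..<n})" using assms(1) by (intro card_mono) simp_all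
  then have "card R \<le> n * n" by simp
  moreover obtain m where "(x, y) \<in> R ^^ m" using assms(2) rtrancl_imp_relpow by blast
  then have "\<exists>m\<le>card R. (x, y) \<in> R ^^ m"
    using relpow_finite_bounded[OF fin, of m] by auto
  ultimately show ?thesis by (meson order_trans)
qed

text \<open>Row \<open>v\<close> of \<open>T\<close> marks the vertices found so far in the
  component of \<open>v\<close>. Only \<open>w\<close> is compared with the radius, since the marked
  vertex \<open>u\<close> is already in the ball.\<close>

definition reach_step :: prog where
  "reach_step = whn (And (pos (nmat ''T'' ''v'' ''u'')) (And (pos (nmat ''edge'' ''u'' ''w''))
     (rle (rmat ''dist'' ''v'' ''w'') (rvar ''R'')))) (mset ''T'' ''v'' ''w'' N1)"

definition reach_sweep :: prog where
  "reach_sweep = For ''u'' nN (For ''w'' nN reach_step)"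

definition reach_prog :: prog where
  "reach_prog = For ''v'' nN
     (For ''w'' nN (mset ''T'' ''v'' ''w'' N0) ;;
      mset ''T'' ''v'' ''v'' N1 ;;
      For ''i'' nN (For ''j'' nN reach_sweep))"

definition greedy_prog :: prog where
  "greedy_prog = nset ''cnt'' N0 ;;
     For ''w'' nN (aset ''cov'' ''w'' N0) ;;
     For ''v'' nN
       (Cnd (pos (narr ''cov'' ''v'')) (aset ''cen'' ''v'' N0)
         (aset ''cen'' ''v'' N1 ;; incr ''cnt'' ;;
          For ''w'' nN (whn (pos (nmat ''T'' ''v'' ''w'')) (aset ''cov'' ''w'' N1))))"

text \<open>The last three commands repeat the computation for the best radius: after the loops,
  \<open>T\<close>, \<open>cen\<close> and \<open>cnt\<close> belong to the last pair that was
  tried.\<close>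

definition search_prog :: prog where
  "search_prog = For ''a'' nN (For ''b'' nN
      (rset ''R'' (rmat ''dist'' ''a'' ''b'') ;; reach_prog ;; greedy_prog ;;
       whn (And (Not (NLess (nvar ''k'') (nvar ''cnt'')))
                (orb (zer (nvar ''found'')) (RLess (rvar ''R'') (rvar ''best''))))
         (nset ''found'' N1 ;; rset ''best'' (rvar ''R'')))) ;;
     rset ''R'' (rvar ''best'') ;; reach_prog ;; greedy_prog"

context conn_inst
begin

definition input :: "store \<Rightarrow> bool" where
  "input s \<longleftrightarrow> nats s ''n'' 0 0 = n \<and> nats s ''k'' 0 0 = k \<and>
     (\<forall>u w. 0 < nats s ''edge'' u w \<longleftrightarrow> (u, w) \<in> E) \<and> (\<forall>i<n. \<forall>j<n. reals s ''dist'' i j = d i j)"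

lemma input_frame:
  assumes "frame A B s t" "input s" "''n'' \<notin> A" "''k'' \<notin> A" "''edge'' \<notin> A" "''dist'' \<notin> B"
  shows "input t"
  using assms unfolding input_def frame_def by auto

lemma input_ev:
  assumes "input s" "''n'' \<notin> nw p" "''k'' \<notin> nw p" "''edge'' \<notin> nw p" "''dist'' \<notin> rw p"
  shows "input (ev p s)"
  using input_frame[OF frame_ev assms(1)] assms by auto

text \<open>Marks are written in place and may travel along several edges during one sweep. So an
  exact description is avoided: no mark leaves the component, none is lost, and every edge from a
  marked vertex to a vertex of the ball is followed.\<close>

lemma reach_sweep_correct:
  assumes "input s" "nats s ''v'' 0 0 = v" "v < n" "reals s ''R'' 0 0 = r" "0 \<le> r"
    and "\<forall>w<n. 0 < nats s ''T'' v w \<longrightarrow> w \<in> component r v"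
  shows "0 < nats s ''T'' v u \<Longrightarrow> 0 < nats (ev reach_sweep s) ''T'' v u"
    and "\<forall>w<n. 0 < nats (ev reach_sweep s) ''T'' v w \<longrightarrow> w \<in> component r v"
    and "v' \<noteq> v \<Longrightarrow> nats (ev reach_sweep s) ''T'' v' = nats s ''T'' v'"
    and "0 < nats s ''T'' v u \<Longrightarrow> (u, w) \<in> E \<Longrightarrow> d v w \<le> r \<Longrightarrow> 0 < nats (ev reach_sweep s) ''T'' v w"
proof -
  define P where "P t \<longleftrightarrow> (\<forall>w. 0 < nats s ''T'' v w \<longrightarrow> 0 < nats t ''T'' v w) \<and>
    (\<forall>w<n. 0 < nats t ''T'' v w \<longrightarrow> w \<in> component r v) \<and> (\<forall>v'. v' \<noteq> v \<longrightarrow> nats t ''T'' v' = nats s ''T'' v')" for t :: store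
  define Q where "Q u w t \<longleftrightarrow> (0 < nats s ''T'' v u \<and> (u, w) \<in> E \<and> d v w \<le> r \<longrightarrow> 0 < nats t ''T'' v w)" for u w and t :: store
  have "P (ev reach_sweep s) \<and> (\<forall>u<n. \<forall>w<n. Q u w (ev reach_sweep s))"
    unfolding reach_sweep_def
  proof (rule For_pairs)
    fix t u j
    assume t: "P t" "nats t ''u'' 0 0 = u" "nats t ''w'' 0 0 = j" "u < n" "j < n"
      and fr: "frame (insert ''u'' (insert ''w'' (nw reach_step))) (rw reach_step) s t"
    have "input t" using input_frame[OF fr] assms by (simp add: reach_step_def)
    have [simp]: "nats t ''v'' = nats s ''v''" "reals t ''R'' = reals s ''R''"
      using frame_nats[OF fr] frame_reals[OF fr] by (simp_all add: reach_step_def)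
    have b: "0 < nats t ''edge'' u j \<longleftrightarrow> (u, j) \<in> E" "reals t ''dist'' v j = d v j"
      using \<open>input t\<close> t assms unfolding input_def by auto
    show "P (ev reach_step t) \<and> Q u j (ev reach_step t) \<and> (\<forall>u' j'. Q u' j' t \<longrightarrow> Q u' j' (ev reach_step t))"
      using t assms b component_step[of u r v j] unfolding reach_step_def P_def Q_def
      by (auto simp: not_less)
  qed (use assms in \<open>auto simp: P_def Q_def input_def reach_step_def\<close>)
  then show "0 < nats s ''T'' v u \<Longrightarrow> 0 < nats (ev reach_sweep s) ''T'' v u"
    and "\<forall>w<n. 0 < nats (ev reach_sweep s) ''T'' v w \<longrightarrow> w \<in> component r v"
    and "v' \<noteq> v \<Longrightarrow> nats (ev reach_sweep s) ''T'' v' = nats s ''T'' v'"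
    and "0 < nats s ''T'' v u \<Longrightarrow> (u, w) \<in> E \<Longrightarrow> d v w \<le> r \<Longrightarrow> 0 < nats (ev reach_sweep s) ''T'' v w"
    using E_sub unfolding P_def Q_def by auto
qed

lemma nw_reach [simp]: "nw reach_sweep = {''u'', ''w'', ''T''}" "rw reach_sweep = {}"
    "nw reach_prog = {''v'', ''u'', ''w'', ''i'', ''j'', ''T''}" "rw reach_prog = {}"
  by (auto simp: reach_sweep_def reach_step_def reach_prog_def)

lemma nw_greedy [simp]: "nw greedy_prog = {''v'', ''w'', ''cnt'', ''cov'', ''cen''}" "rw greedy_prog = {}"
  by (auto simp: greedy_prog_def)

text \<open>After \<open>m\<close> sweeps all walks of at most \<open>m\<close> edges in the ball
  are marked, and soundness of a sweep keeps the marks inside the component; \<open>n * n\<close>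
  sweeps reach everything.\<close>

lemma reach_row:
  assumes "input s" "nats s ''v'' 0 0 = v" "v < n" "reals s ''R'' 0 0 = r" "0 \<le> r"
    and T: "\<forall>w<n. 0 < nats s ''T'' v w \<longleftrightarrow> w = v"
  defines "s' \<equiv> ev (For ''i'' nN (For ''j'' nN reach_sweep)) s"
  shows "\<forall>w<n. 0 < nats s' ''T'' v w \<longleftrightarrow> w \<in> component r v"
    and "\<forall>v'. v' \<noteq> v \<longrightarrow> nats s' ''T'' v' = nats s ''T'' v'"
proof -
  define R where "R = Restr E {x. x < n \<and> d v x \<le> r}"
  define Inv where "Inv m t \<longleftrightarrow> (\<forall>w<n. 0 < nats t ''T'' v w \<longrightarrow> w \<in> component r v) \<and>
    (\<forall>v'. v' \<noteq> v \<longrightarrow> nats t ''T'' v' = nats s ''T'' v') \<and>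
    (\<forall>l\<le>m. \<forall>w. (v, w) \<in> R ^^ l \<longrightarrow> 0 < nats t ''T'' v w)" for m and t :: store
  have "Inv (n * n) s'"
    unfolding s'_def
  proof (rule For2_inv)
    show "Inv 0 s" using T \<open>v < n\<close> by (auto simp: Inv_def)
    fix m t assume I: "Inv m t" and fr: "frame (insert ''i'' (insert ''j'' (nw reach_sweep))) (rw reach_sweep) s t"
    have t: "input t" "nats t ''v'' 0 0 = v" "reals t ''R'' 0 0 = r"
      using input_frame[OF fr assms(1)] frame_nats[OF fr, of "''v''"] frame_reals[OF fr, of "''R''"] assms
      by simp_all
    note sw = reach_sweep_correct[OF t(1,2) \<open>v < n\<close> t(3) \<open>0 \<le> r\<close>]
    have T': "\<forall>w<n. 0 < nats t ''T'' v w \<longrightarrow> w \<in> component r v" using I by (simp add: Inv_def)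
    have "0 < nats (ev reach_sweep t) ''T'' v w" if "l \<le> Suc m" "(v, w) \<in> R ^^ l" for l w
    proof (cases "l \<le> m")
      case True
      then show ?thesis using sw(1)[OF T'] I that by (auto simp: Inv_def)
    next
      case False
      then have "(v, w) \<in> R ^^ m O R" using that by (auto simp: le_Suc_eq)
      then obtain u where "(v, u) \<in> R ^^ m" "(u, w) \<in> R" by auto
      then show ?thesis using sw(4)[OF T', of u w] I by (auto simp: Inv_def R_def)
    qed
    then show "Inv (Suc m) (ev reach_sweep t)"
      using sw(2,3)[OF T'] I unfolding Inv_def by auto
  qed (use assms in \<open>auto simp: Inv_def input_def\<close>)
  moreover have "\<exists>m\<le>n * n. (v, w) \<in> R ^^ m" if "w \<in> component r v" for w
    using rtrancl_relpow_bound[of R n v w] that unfolding R_def component_def by auto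
  ultimately show "\<forall>w<n. 0 < nats s' ''T'' v w \<longleftrightarrow> w \<in> component r v"
    and "\<forall>v'. v' \<noteq> v \<longrightarrow> nats s' ''T'' v' = nats s ''T'' v'"
    unfolding Inv_def by metis+
qed

lemma reach_correct:
  assumes "input s" "reals s ''R'' 0 0 = r" "0 \<le> r" "v < n" "w < n"
  shows "0 < nats (ev reach_prog s) ''T'' v w \<longleftrightarrow> w \<in> component r v"
proof -
  define body where "body = For ''w'' nN (mset ''T'' ''v'' ''w'' N0) ;;
      mset ''T'' ''v'' ''v'' N1 ;; For ''i'' nN (For ''j'' nN reach_sweep)"
  define Inv where "Inv a t \<longleftrightarrow> (\<forall>v<a. \<forall>w<n. 0 < nats t ''T'' v w \<longleftrightarrow> w \<in> component r v)" for a and t :: store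
  have "Inv n (ev (For ''v'' nN body) s)"
  proof (rule For_inv)
    fix i t assume i: "i < n" "Inv i t" "nats t ''v'' 0 0 = i" and fr: "frame (insert ''v'' (nw body)) (rw body) s t"
    have t: "input t" "reals t ''R'' 0 0 = r"
      using input_frame[OF fr assms(1)] frame_reals[OF fr, of "''R''"] assms by (simp_all add: body_def)
    define t1 where "t1 = ev (For ''w'' nN (mset ''T'' ''v'' ''w'' N0)) t"
    define t2 where "t2 = ev (mset ''T'' ''v'' ''v'' N1) t1"
    have t1: "(\<forall>w<n. nats t1 ''T'' i w = 0) \<and> (\<forall>v. v \<noteq> i \<longrightarrow> nats t1 ''T'' v = nats t ''T'' v)"
      unfolding t1_def
    proof (rule For_inv[where Inv = "\<lambda>j u. (\<forall>w<j. nats u ''T'' i w = 0) \<and> (\<forall>v. v \<noteq> i \<longrightarrow> nats u ''T'' v = nats t ''T'' v)"])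
      fix j u assume j: "nats u ''w'' 0 0 = j"
         "frame (insert ''w'' (nw (mset ''T'' ''v'' ''w'' N0))) (rw (mset ''T'' ''v'' ''w'' N0)) t u"
         "(\<forall>w<j. nats u ''T'' i w = 0) \<and> (\<forall>v. v \<noteq> i \<longrightarrow> nats u ''T'' v = nats t ''T'' v)"
      then show "(\<forall>w<Suc j. nats (ev (mset ''T'' ''v'' ''w'' N0) u) ''T'' i w = 0) \<and>
          (\<forall>v. v \<noteq> i \<longrightarrow> nats (ev (mset ''T'' ''v'' ''w'' N0) u) ''T'' v = nats t ''T'' v)"
        using i frame_nats[OF j(2), of "''v''"] by (auto simp: less_Suc_eq)
    qed (use t in \<open>auto simp: input_def\<close>)
    have v1: "nats t1 ''v'' = nats t ''v''" by (simp add: t1_def nats_ev del: ev.simps)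
    have t2: "\<forall>w<n. 0 < nats t2 ''T'' i w \<longleftrightarrow> w = i" "\<forall>v. v \<noteq> i \<longrightarrow> nats t2 ''T'' v = nats t ''T'' v"
      using t1 v1 i by (auto simp: t2_def)
    have t2': "input t2" "nats t2 ''v'' 0 0 = i" "reals t2 ''R'' 0 0 = r"
      using t v1 i by (auto simp: t2_def t1_def nats_ev reals_ev input_ev simp del: ev.simps)
    show "Inv (Suc i) (ev body t)"
      using reach_row[OF t2'(1,2) i(1) t2'(3) \<open>0 \<le> r\<close> t2(1)] t2(2) i
      unfolding Inv_def body_def ev.simps(4) t1_def[symmetric] t2_def[symmetric]
      by (auto simp: less_Suc_eq simp del: ev.simps)
  qed (use assms in \<open>auto simp: Inv_def input_def\<close>)
  then show ?thesis using assms by (simp add: Inv_def reach_prog_def body_def)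
qed

text \<open>\<open>cov\<close> holds the union of the components chosen so far, which turns the
  existential test in the recursion of \<open>greedy\<close> into the reading of one cell.\<close>

lemma greedy_correct:
  assumes "input s" and T: "\<And>v w. v < n \<Longrightarrow> w < n \<Longrightarrow> 0 < nats s ''T'' v w \<longleftrightarrow> w \<in> component r v"
  shows "v < n \<Longrightarrow> 0 < nats (ev greedy_prog s) ''cen'' v 0 \<longleftrightarrow> v \<in> greedy r n"
    and "nats (ev greedy_prog s) ''cnt'' 0 0 = card (greedy r n)"
proof -
  define upd where "upd = For ''w'' nN (whn (pos (nmat ''T'' ''v'' ''w'')) (aset ''cov'' ''w'' N1))"
  define body where "body = Cnd (pos (narr ''cov'' ''v'')) (aset ''cen'' ''v'' N0)
         (aset ''cen'' ''v'' N1 ;; incr ''cnt'' ;; upd)"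
  define s1 where "s1 = ev (nset ''cnt'' N0) s"
  define s2 where "s2 = ev (For ''w'' nN (aset ''cov'' ''w'' N0)) s1"
  have s1: "input s1" "nats s1 ''cnt'' 0 0 = 0" "nats s1 ''T'' = nats s ''T''"
    using assms by (auto simp: s1_def input_def)
  have "\<forall>w<n. nats s2 ''cov'' w 0 = 0"
    unfolding s2_def by (rule For_inv[where Inv = "\<lambda>j u. (\<forall>w<j. nats u ''cov'' w 0 = 0)"])
      (use s1 in \<open>auto simp: input_def less_Suc_eq\<close>)
  moreover have s2: "input s2" "nats s2 ''cnt'' 0 0 = 0" "nats s2 ''T'' = nats s ''T''"
    using s1 by (auto simp: s2_def nats_ev reals_ev input_ev simp del: ev.simps)
  define Inv where "Inv a t \<longleftrightarrow> nats t ''cnt'' 0 0 = card (greedy r a) \<and>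
    (\<forall>u<a. 0 < nats t ''cen'' u 0 \<longleftrightarrow> u \<in> greedy r a) \<and>
    (\<forall>w<n. 0 < nats t ''cov'' w 0 \<longleftrightarrow> (\<exists>c\<in>greedy r a. w \<in> component r c))" for a and t :: store
  have "Inv n (ev (For ''v'' nN body) s2)"
  proof (rule For_inv)
    show "Inv 0 s2" using calculation s2 by (simp add: Inv_def)
    fix a t assume a: "a < n" "Inv a t" "nats t ''v'' 0 0 = a" and fr: "frame (insert ''v'' (nw body)) (rw body) s2 t"
    have t: "input t" "nats t ''T'' = nats s ''T''"
      using input_frame[OF fr s2(1)] frame_nats[OF fr, of "''T''"] s2 by (simp_all add: body_def upd_def)
    have "a \<notin> greedy r a" using greedy_sub[of r a] by auto
    show "Inv (Suc a) (ev body t)"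
    proof (cases "0 < nats t ''cov'' a 0")
      case True
      then have "greedy r (Suc a) = greedy r a" using a by (simp add: Inv_def)
      moreover have "ev body t = ev (aset ''cen'' ''v'' N0) t" using True a by (simp add: body_def)
      ultimately show ?thesis using a \<open>a \<notin> greedy r a\<close> by (auto simp: Inv_def less_Suc_eq)
    next
      case False
      then have g: "greedy r (Suc a) = insert a (greedy r a)" using a by (auto simp: Inv_def)
      define t1 where "t1 = ev (aset ''cen'' ''v'' N1 ;; incr ''cnt'') t"
      have b: "ev body t = ev upd t1" using False a by (simp add: body_def t1_def)
      have t1: "input t1" "nats t1 ''T'' = nats s ''T''" "nats t1 ''v'' 0 0 = a" "nats t1 ''cov'' = nats t ''cov''"
        "nats t1 ''cnt'' 0 0 = Suc (nats t ''cnt'' 0 0)" "\<forall>u. 0 < nats t1 ''cen'' u 0 \<longleftrightarrow> u = a \<or> 0 < nats t ''cen'' u 0"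
        using t a by (auto simp: t1_def input_def)
      define J where "J j u \<longleftrightarrow> (\<forall>w<n. 0 < nats u ''cov'' w 0 \<longleftrightarrow>
        (w < j \<and> w \<in> component r a) \<or> 0 < nats t ''cov'' w 0)" for j and u :: store
      have "J n (ev upd t1)"
        unfolding upd_def
      proof (rule For_inv)
        let ?p = "whn (pos (nmat ''T'' ''v'' ''w'')) (aset ''cov'' ''w'' N1)"
        fix j u assume j: "j < n" "nats u ''w'' 0 0 = j" "J j u" and fr: "frame (insert ''w'' (nw ?p)) (rw ?p) t1 u"
        then show "J (Suc j) (ev ?p u)"
          using T[of a j] a t1 frame_nats[OF fr, of "''v''"] frame_nats[OF fr, of "''T''"]
          by (auto simp: less_Suc_eq J_def)
      qed (use t1 in \<open>auto simp: input_def J_def\<close>)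
      moreover have "nats (ev upd t1) ''cnt'' = nats t1 ''cnt''" "nats (ev upd t1) ''cen'' = nats t1 ''cen''"
        by (simp_all add: upd_def nats_ev del: ev.simps)
      ultimately show ?thesis using a t1 g \<open>a \<notin> greedy r a\<close> unfolding b Inv_def J_def
        by (auto simp: less_Suc_eq simp del: greedy.simps)
    qed
  qed (use s2 in \<open>auto simp: Inv_def input_def\<close>)
  moreover have "ev (For ''v'' nN body) s2 = ev greedy_prog s"
    by (simp add: greedy_prog_def s2_def s1_def body_def upd_def del: ev.simps) (simp only: ev.simps)
  ultimately show "v < n \<Longrightarrow> 0 < nats (ev greedy_prog s) ''cen'' v 0 \<longleftrightarrow> v \<in> greedy r n"
    and "nats (ev greedy_prog s) ''cnt'' 0 0 = card (greedy r n)"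
    by (auto simp: Inv_def simp del: ev.simps)
qed

lemma search_correct:
  assumes "input s" "nats s ''found'' 0 0 = 0"
    and ex: "\<exists>a<n. \<exists>b<n. card (greedy (d a b) n) \<le> k"
  defines "r \<equiv> reals (ev search_prog s) ''R'' 0 0"
  shows "best_radius r"
    and "v < n \<Longrightarrow> w < n \<Longrightarrow> 0 < nats (ev search_prog s) ''T'' v w \<longleftrightarrow> w \<in> component r v"
    and "v < n \<Longrightarrow> 0 < nats (ev search_prog s) ''cen'' v 0 \<longleftrightarrow> v \<in> greedy r n"
    and "nats (ev search_prog s) ''cnt'' 0 0 = card (greedy r n)"
proof -
  define att where "att = rset ''R'' (rmat ''dist'' ''a'' ''b'') ;; reach_prog ;; greedy_prog"
  define keep where "keep = whn (And (Not (NLess (nvar ''k'') (nvar ''cnt'')))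
                (orb (zer (nvar ''found'')) (RLess (rvar ''R'') (rvar ''best''))))
         (nset ''found'' N1 ;; rset ''best'' (rvar ''R''))"
  define fin where "fin = rset ''R'' (rvar ''best'') ;; reach_prog ;; greedy_prog"
  define P where "P t \<longleftrightarrow> (0 < nats t ''found'' 0 0 \<longrightarrow>
      0 \<le> reals t ''best'' 0 0 \<and> card (greedy (reals t ''best'' 0 0) n) \<le> k)" for t :: store
  \<comment> \<open>It survives later rounds because \<open>found\<close> is never reset and
    \<open>best\<close> only decreases once it is set.\<close>
  define Q where "Q a b t \<longleftrightarrow> (card (greedy (d a b) n) \<le> k \<longrightarrow>
      0 < nats t ''found'' 0 0 \<and> reals t ''best'' 0 0 \<le> d a b)" for a b and t :: store
  have nw_att: "nw att = {''v'', ''u'', ''w'', ''i'', ''j'', ''T'', ''cnt'', ''cov'', ''cen''}" "rw att = {''R''}"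
    by (auto simp: att_def)
  have body: "ev (rset ''R'' (rmat ''dist'' ''a'' ''b'') ;; reach_prog ;; greedy_prog ;; keep) t = ev keep (ev att t)" for t
    by (simp only: att_def ev.simps)
  have step: "P (ev keep (ev att t)) \<and> Q a b (ev keep (ev att t)) \<and> (\<forall>a' b'. Q a' b' t \<longrightarrow> Q a' b' (ev keep (ev att t)))"
    if "input t" "P t" "nats t ''a'' 0 0 = a" "nats t ''b'' 0 0 = b" "a < n" "b < n" for t a b
  proof -
    define t1 where "t1 = ev (rset ''R'' (rmat ''dist'' ''a'' ''b'')) t"
    have t1: "input t1" "reals t1 ''R'' 0 0 = d a b" using that by (auto simp: t1_def input_def)
    have tr: "ev att t = ev greedy_prog (ev reach_prog t1)" by (simp only: att_def ev.simps t1_def)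
    have "input (ev reach_prog t1)" by (rule input_ev[OF t1(1)]) auto
    from greedy_correct(2)[OF this reach_correct[OF t1 nonneg]]
    have "nats (ev att t) ''cnt'' 0 0 = card (greedy (d a b) n)" by (simp add: tr)
    moreover have "reals (ev att t) ''R'' 0 0 = d a b" by (simp add: tr reals_ev t1)
    moreover have "nats (ev att t) ''k'' 0 0 = k" "nats (ev att t) ''found'' = nats t ''found''"
      "reals (ev att t) ''best'' = reals t ''best''"
      using that by (auto simp: nats_ev reals_ev nw_att input_def)
    ultimately show ?thesis using that(2) nonneg by (auto simp: keep_def P_def Q_def)
  qed
  define s1 where "s1 = ev (For ''a'' nN (For ''b'' nN (att ;; keep))) s"
  have "P s1 \<and> (\<forall>a<n. \<forall>b<n. Q a b s1)"
    unfolding s1_def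
  proof (rule For_pairs)
    fix a b t assume "P t" "nats t ''a'' 0 0 = a" "nats t ''b'' 0 0 = b" "a < n" "b < n"
      and fr: "frame (insert ''a'' (insert ''b'' (nw (att ;; keep)))) (rw (att ;; keep)) s t"
    moreover have "input t" using input_frame[OF fr assms(1)] by (simp add: nw_att keep_def)
    ultimately show "P (ev (att ;; keep) t) \<and> Q a b (ev (att ;; keep) t) \<and>
        (\<forall>a' b'. Q a' b' t \<longrightarrow> Q a' b' (ev (att ;; keep) t))"
      using step[of t a b] by simp
  qed (use assms in \<open>auto simp: P_def Q_def input_def nw_att keep_def\<close>)
  then have best: "best_radius (reals s1 ''best'' 0 0)"
    using ex unfolding P_def Q_def best_radius_def by (elim exE conjE) metis
  define s2 where "s2 = ev (rset ''R'' (rvar ''best'')) s1"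
  have "input s1"
    unfolding s1_def by (rule input_ev[OF assms(1)]) (auto simp: nw_att keep_def)
  then have s2: "input s2" "reals s2 ''R'' 0 0 = reals s1 ''best'' 0 0"
    by (auto simp: s2_def input_def)
  have end': "ev search_prog s = ev greedy_prog (ev reach_prog s2)"
    by (simp only: search_prog_def ev.simps s2_def s1_def att_def keep_def)
  have r: "r = reals s1 ''best'' 0 0" by (simp add: r_def end' reals_ev s2)
  show "best_radius r" using best by (simp add: r)
  have "0 \<le> reals s1 ''best'' 0 0" using best by (simp add: best_radius_def)
  note T = reach_correct[OF s2 this]
  have "input (ev reach_prog s2)" by (rule input_ev[OF s2(1)]) auto
  note G = greedy_correct[OF this T]
  show "v < n \<Longrightarrow> w < n \<Longrightarrow> 0 < nats (ev search_prog s) ''T'' v w \<longleftrightarrow> w \<in> component r v"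
    using T unfolding r by (simp add: end' nats_ev)
  show "v < n \<Longrightarrow> 0 < nats (ev search_prog s) ''cen'' v 0 \<longleftrightarrow> v \<in> greedy r n"
    and "nats (ev search_prog s) ''cnt'' 0 0 = card (greedy r n)"
    using G unfolding r end' by simp_all
qed

lemma nw_search [simp]: "nw search_prog = {''a'', ''b'', ''v'', ''u'', ''w'', ''i'', ''j'', ''T'', ''cnt'', ''cov'', ''cen'', ''found''}"
    "rw search_prog = {''R'', ''best''}"
  by (auto simp: search_prog_def)

end

section \<open>Disjoint clusters\<close>

text \<open>
  Besides all centres of the overlapping clusters, arbitrary further points become roots until there
  are \<open>k\<close> of them.  Every root starts its own cluster, so exactly \<open>k\<close> nonempty clusters result.
\<close>

definition root_step :: prog where
  "root_step = whn (orb (pos (narr ''cen'' ''v'')) (NLess (nvar ''cnt'') (nvar ''k'')))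
     (whn (zer (narr ''cen'' ''v'')) (incr ''cnt'') ;;
      aset ''cluster'' ''v'' (nvar ''m'') ;; aset ''center'' ''m'' (nvar ''v'') ;;
      aset ''asg'' ''v'' N1 ;; incr ''m'')"

definition root_prog :: prog where
  "root_prog = nset ''m'' N0 ;; For ''v'' nN root_step"

definition flood_step :: prog where
  "flood_step = whn (And (And (pos (nmat ''T'' ''c'' ''u'')) (pos (nmat ''T'' ''c'' ''w'')))
       (And (pos (nmat ''edge'' ''u'' ''w'')) (And (pos (narr ''asg'' ''u'')) (zer (narr ''asg'' ''w'')))))
     (aset ''asg'' ''w'' N1 ;; aset ''cluster'' ''w'' (narr ''cluster'' ''u''))"

definition flood_center :: prog where
  "flood_center = For ''i'' nN (For ''j'' nN (For ''u'' nN (For ''w'' nN flood_step)))"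

definition flood_layer :: prog where
  "flood_layer = For ''c'' nN (whn (And (pos (narr ''cen'' ''c'')) (neq (narr ''rank'' ''c'') (nvar ''l''))) flood_center)"

text \<open>The loop covers every value that a rank computation may produce, from 0 to
  \<open>n + dim\<close>, in increasing order.\<close>

definition flood_prog :: prog where
  "flood_prog = For ''l'' nL flood_layer"

lemma nw_flood [simp]:
  "nw root_prog = {''v'', ''m'', ''cnt'', ''cluster'', ''center'', ''asg''}" "rw root_prog = {}"
  "nw flood_step = {''asg'', ''cluster''}" "rw flood_step = {}"
  "nw flood_center = {''i'', ''j'', ''u'', ''w'', ''asg'', ''cluster''}" "rw flood_center = {}"
  "nw flood_layer = {''c'', ''i'', ''j'', ''u'', ''w'', ''asg'', ''cluster''}" "rw flood_layer = {}"
  "nw flood_prog = {''l'', ''c'', ''i'', ''j'', ''u'', ''w'', ''asg'', ''cluster''}" "rw flood_prog = {}"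
  by (auto simp: root_prog_def root_step_def flood_step_def flood_center_def flood_layer_def flood_prog_def)

lemma card_less_Suc:
  fixes S :: "nat set"
  shows "card {y\<in>S. y < Suc b} = (if b \<in> S then Suc (card {y\<in>S. y < b}) else card {y\<in>S. y < b})"
proof -
  have "{y\<in>S. y < Suc b} = (if b \<in> S then insert b {y\<in>S. y < b} else {y\<in>S. y < b})" by (auto simp: less_Suc_eq)
  then show ?thesis by simp
qed

context conn_inst
begin

section \<open>Choosing the roots\<close>

definition rooted :: "store \<Rightarrow> bool" where
  "rooted s \<longleftrightarrow> (\<forall>i<k. nats s ''center'' i 0 < n \<and> 0 < nats s ''asg'' (nats s ''center'' i 0) 0 \<and>
      nats s ''cluster'' (nats s ''center'' i 0) 0 = i)"

lemma root_correct:
  assumes "input s" and asg: "\<And>v. nats s ''asg'' v 0 = 0" and X: "X \<subseteq> {..<n}"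
    and cen: "\<And>v. v < n \<Longrightarrow> 0 < nats s ''cen'' v 0 \<longleftrightarrow> v \<in> X"
    and cnt: "nats s ''cnt'' 0 0 = card X" and "card X \<le> k" "k \<le> n"
  shows "rooted (ev root_prog s)"
    and "v < n \<Longrightarrow> 0 < nats (ev root_prog s) ''asg'' v 0 \<Longrightarrow> nats (ev root_prog s) ''cluster'' v 0 < k \<and>
           nats (ev root_prog s) ''center'' (nats (ev root_prog s) ''cluster'' v 0) 0 = v"
    and "v \<in> X \<Longrightarrow> 0 < nats (ev root_prog s) ''asg'' v 0"
proof -
  \<comment> \<open>\<open>cnt\<close> counts all members of \<open>X\<close> in advance together
    with the extra roots, \<open>m\<close> only the roots created so far; the first equation
    balances them and gives \<open>m = cnt\<close> at the end. The last clause says that no visited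
    point has been refused as long as \<open>cnt\<close> is below \<open>k\<close>.\<close>
  define Inv where "Inv a t \<longleftrightarrow> nats t ''m'' 0 0 + card X = card {u\<in>X. u < a} + nats t ''cnt'' 0 0 \<and>
     nats t ''cnt'' 0 0 \<le> k \<and>
     (\<forall>i<nats t ''m'' 0 0. nats t ''center'' i 0 < a \<and> 0 < nats t ''asg'' (nats t ''center'' i 0) 0 \<and>
        nats t ''cluster'' (nats t ''center'' i 0) 0 = i) \<and>
     (\<forall>u. 0 < nats t ''asg'' u 0 \<longrightarrow> u < a \<and> nats t ''cluster'' u 0 < nats t ''m'' 0 0 \<and>
        nats t ''center'' (nats t ''cluster'' u 0) 0 = u) \<and>
     (\<forall>u\<in>X. u < a \<longrightarrow> 0 < nats t ''asg'' u 0) \<and>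
     (nats t ''cnt'' 0 0 < k \<longrightarrow> (\<forall>u<a. 0 < nats t ''asg'' u 0))" for a and t :: store
  define s' where "s' = ev root_prog s"
  have "Inv n s'"
    unfolding root_prog_def ev.simps(4) s'_def
  proof (rule For_inv)
    fix a t assume a: "a < n" "Inv a t" "nats t ''v'' 0 0 = a"
      and fr: "frame (insert ''v'' (nw root_step)) (rw root_step) (ev (nset ''m'' N0) s) t"
    have t: "nats t ''cen'' = nats s ''cen''" "nats t ''k'' 0 0 = k"
      using frame_nats[OF fr] assms by (simp_all add: root_step_def input_def)
    note c = card_less_Suc[of X a]
    have ca: "0 < nats t ''cen'' a 0 \<longleftrightarrow> a \<in> X" using cen a t by simp
    have na: "nats t ''asg'' a 0 = 0" using a(2) unfolding Inv_def by (metis less_irrefl gr0I)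
    show "Inv (Suc a) (ev root_step t)"
    proof (cases "a \<in> X \<or> nats t ''cnt'' 0 0 < k")
      case False
      then have "ev root_step t = t" using ca a(3) t by (simp add: root_step_def)
      then show ?thesis using a(2) False c unfolding Inv_def by (auto simp: less_Suc_eq)
    next
      case True
      let ?t = "ev root_step t"
      have m: "nats ?t ''m'' 0 0 = Suc (nats t ''m'' 0 0)"
        and cnt: "nats ?t ''cnt'' 0 0 = (if a \<in> X then nats t ''cnt'' 0 0 else Suc (nats t ''cnt'' 0 0))"
        and as: "\<And>u. nats ?t ''asg'' u 0 = (if u = a then 1 else nats t ''asg'' u 0)"
        and cl: "\<And>u. nats ?t ''cluster'' u 0 = (if u = a then nats t ''m'' 0 0 else nats t ''cluster'' u 0)"
        and ce: "\<And>i. nats ?t ''center'' i 0 = (if i = nats t ''m'' 0 0 then a else nats t ''center'' i 0)"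
        using True ca a(3) t by (auto simp: root_step_def)
      have I: "nats t ''m'' 0 0 + card X = card {u\<in>X. u < a} + nats t ''cnt'' 0 0" "nats t ''cnt'' 0 0 \<le> k"
        "\<And>i. i < nats t ''m'' 0 0 \<Longrightarrow> nats t ''center'' i 0 < a \<and> 0 < nats t ''asg'' (nats t ''center'' i 0) 0 \<and>
           nats t ''cluster'' (nats t ''center'' i 0) 0 = i"
        "\<And>u. 0 < nats t ''asg'' u 0 \<Longrightarrow> u < a \<and> nats t ''cluster'' u 0 < nats t ''m'' 0 0 \<and>
           nats t ''center'' (nats t ''cluster'' u 0) 0 = u"
        "\<And>u. u \<in> X \<Longrightarrow> u < a \<Longrightarrow> 0 < nats t ''asg'' u 0"
        "\<And>u. nats t ''cnt'' 0 0 < k \<Longrightarrow> u < a \<Longrightarrow> 0 < nats t ''asg'' u 0"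
        using a(2) unfolding Inv_def by blast+
      show ?thesis
        unfolding Inv_def
      proof (intro conjI allI ballI impI)
        show "nats ?t ''m'' 0 0 + card X = card {u\<in>X. u < Suc a} + nats ?t ''cnt'' 0 0"
          using I(1) unfolding m cnt c by simp
        show "nats ?t ''cnt'' 0 0 \<le> k" using I(2) True unfolding cnt by auto
      next
        fix i assume "i < nats ?t ''m'' 0 0"
        then consider "i < nats t ''m'' 0 0" | "i = nats t ''m'' 0 0" unfolding m by linarith
        note * = this
        show "nats ?t ''center'' i 0 < Suc a" using * by cases (auto simp: ce dest: I(3))
        show "0 < nats ?t ''asg'' (nats ?t ''center'' i 0) 0" using * by cases (auto simp: ce as dest: I(3))
        show "nats ?t ''cluster'' (nats ?t ''center'' i 0) 0 = i"
          using * by cases (use I(3)[of i] in \<open>auto simp: ce cl\<close>)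
      next
        fix u assume "0 < nats ?t ''asg'' u 0"
        then have "u = a \<or> 0 < nats t ''asg'' u 0" by (simp add: as split: if_split_asm)
        then show "u < Suc a" "nats ?t ''cluster'' u 0 < nats ?t ''m'' 0 0"
          "nats ?t ''center'' (nats ?t ''cluster'' u 0) 0 = u"
          using I(4)[of u] by (auto simp: m cl ce)
      next
        fix u assume "u \<in> X" "u < Suc a"
        then show "0 < nats ?t ''asg'' u 0" using I(5)[of u] by (auto simp: as less_Suc_eq)
      next
        fix u assume "nats ?t ''cnt'' 0 0 < k" "u < Suc a"
        then show "0 < nats ?t ''asg'' u 0" using I(6)[of u] True by (auto simp: as cnt less_Suc_eq split: if_split_asm)
      qed
    qed
  qed (use assms in \<open>auto simp: Inv_def input_def\<close>)
  then have I: "Inv n s'" .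
  have "{u\<in>X. u < n} = X" using X by auto
  then have m: "nats s' ''m'' 0 0 = nats s' ''cnt'' 0 0" using I by (simp add: Inv_def)
  \<comment> \<open>Otherwise all \<open>n\<close> points are roots with distinct indices below
    \<open>m\<close>, and \<open>m = cnt\<close> is less than \<open>k \<le> n\<close>.\<close>
  have "nats s' ''cnt'' 0 0 = k"
  proof (rule ccontr)
    assume "nats s' ''cnt'' 0 0 \<noteq> k"
    then have less: "nats s' ''cnt'' 0 0 < k" using I by (auto simp: Inv_def)
    define f where "f u = nats s' ''cluster'' u 0" for u
    have f: "f u < nats s' ''m'' 0 0 \<and> nats s' ''center'' (f u) 0 = u" if "u < n" for u
      using I less that unfolding Inv_def f_def by blast
    have "inj_on f {..<n}" using f by (intro inj_on_inverseI[of _ "\<lambda>i. nats s' ''center'' i 0"]) auto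
    moreover have "f ` {..<n} \<subseteq> {..<nats s' ''m'' 0 0}" using f by auto
    ultimately have "n \<le> nats s' ''m'' 0 0" using card_inj_on_le[of f "{..<n}" "{..<nats s' ''m'' 0 0}"] by simp
    then show False using m less \<open>k \<le> n\<close> by simp
  qed
  then show "rooted (ev root_prog s)"
    and "v < n \<Longrightarrow> 0 < nats (ev root_prog s) ''asg'' v 0 \<Longrightarrow> nats (ev root_prog s) ''cluster'' v 0 < k \<and>
           nats (ev root_prog s) ''center'' (nats (ev root_prog s) ''cluster'' v 0) 0 = v"
    and "v \<in> X \<Longrightarrow> 0 < nats (ev root_prog s) ''asg'' v 0"
    using I m X unfolding Inv_def rooted_def s'_def[symmetric] by auto
qed

section \<open>Flooding the components by increasing rank\<close>

definition chain :: "real \<Rightarrow> nat set \<Rightarrow> (nat \<Rightarrow> nat) \<Rightarrow> nat \<Rightarrow> (nat \<times> nat) set" where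
  "chain r X rk l = Restr {(x, y). d x y \<le> 2 * r} {x\<in>X. rk x = l}"

text \<open>The guard on \<open>asg\<close> is essential: an unassigned vertex may carry the default
  label 0 without belonging to cluster 0.\<close>

definition linked :: "store \<Rightarrow> bool" where
  "linked t \<longleftrightarrow> (\<forall>v<n. 0 < nats t ''asg'' v 0 \<longrightarrow> nats t ''cluster'' v 0 < k \<and>
     (nats t ''center'' (nats t ''cluster'' v 0) 0, v) \<in>
       (Restr E {x. x < n \<and> 0 < nats t ''asg'' x 0 \<and> nats t ''cluster'' x 0 = nats t ''cluster'' v 0})\<^sup>*)"

text \<open>
  A vertex assigned in layer \<open>l\<close> is reached through clusters of rank \<open>l\<close> that successively
  intersect, the last of which contains a vertex assigned before the layer (with the same root).
\<close>

definition near :: "real \<Rightarrow> nat set \<Rightarrow> (nat \<Rightarrow> nat) \<Rightarrow> nat \<Rightarrow> real \<Rightarrow> store \<Rightarrow> bool" where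
  "near r X rk l B t \<longleftrightarrow> (\<forall>v<n. 0 < nats t ''asg'' v 0 \<longrightarrow>
     (let q = nats t ''center'' (nats t ''cluster'' v 0) 0 in
      d v q \<le> B \<or> (\<exists>c\<in>X. \<exists>c'\<in>X. \<exists>w<n. rk c = l \<and> rk c' = l \<and> v \<in> component r c \<and> w \<in> component r c' \<and>
        (c, c') \<in> (chain r X rk l)\<^sup>* \<and> d w q \<le> B)))"

text \<open>The main argument concerns \<open>near\<close>. The vertex \<open>u\<close> lies in the
  component of \<open>c\<close> and in that of the first centre of its own chain, so these centres
  are at distance at most \<open>2 * r\<close> and \<open>c\<close> can be put in front of the
  chain; \<open>w\<close> inherits the extended chain together with the root.\<close>

lemma flood_step_correct:
  assumes "input t" and T: "\<forall>v<n. \<forall>w<n. 0 < nats t ''T'' v w \<longleftrightarrow> w \<in> component r v"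
    and X: "X \<subseteq> {..<n}" and "0 \<le> r"
    and inv: "rooted t" "linked t" "near r X rk l B t"
    and c: "c \<in> X" "rk c = l" "nats t ''c'' 0 0 = c" and uw: "nats t ''u'' 0 0 = u" "nats t ''w'' 0 0 = w" "u < n" "w < n"
  shows "rooted (ev flood_step t)" "linked (ev flood_step t)" "near r X rk l B (ev flood_step t)"
    and "0 < nats t ''asg'' v 0 \<Longrightarrow> 0 < nats (ev flood_step t) ''asg'' v 0"
    and "0 < nats t ''asg'' u 0 \<Longrightarrow> u \<in> component r c \<Longrightarrow> w \<in> component r c \<Longrightarrow> (u, w) \<in> E \<Longrightarrow> 0 < nats (ev flood_step t) ''asg'' w 0"
proof -
  let ?t = "ev flood_step t"
  let ?G = "u \<in> component r c \<and> w \<in> component r c \<and> (u, w) \<in> E \<and> 0 < nats t ''asg'' u 0 \<and> nats t ''asg'' w 0 = 0"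
  have "c < n" using c X by auto
  define g where "g = And (And (pos (nmat ''T'' ''c'' ''u'')) (pos (nmat ''T'' ''c'' ''w'')))
       (And (pos (nmat ''edge'' ''u'' ''w'')) (And (pos (narr ''asg'' ''u'')) (zer (narr ''asg'' ''w''))))"
  have G: "bval g t \<longleftrightarrow> ?G"
    using T assms \<open>c < n\<close> by (auto simp: g_def input_def)
  have ev_step: "ev flood_step t =
      (if ?G then ev (aset ''asg'' ''w'' N1 ;; aset ''cluster'' ''w'' (narr ''cluster'' ''u'')) t else t)"
    using G unfolding flood_step_def g_def[symmetric] ev.simps(1,5) by simp
  have *: "(rooted ?t \<and> linked ?t \<and> near r X rk l B ?t) \<and> (0 < nats t ''asg'' v 0 \<longrightarrow> 0 < nats ?t ''asg'' v 0) \<and>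
     (0 < nats t ''asg'' u 0 \<longrightarrow> u \<in> component r c \<longrightarrow> w \<in> component r c \<longrightarrow> (u, w) \<in> E \<longrightarrow> 0 < nats ?t ''asg'' w 0)"
  proof (cases ?G)
    case False
    then have "?t = t" unfolding ev_step by (rule if_not_P)
    then show ?thesis using inv False by auto
  next
    case True
    let ?L = "\<lambda>v. nats t ''cluster'' v 0" and ?L' = "\<lambda>v. nats ?t ''cluster'' v 0"
    let ?A = "\<lambda>v. 0 < nats t ''asg'' v 0" and ?A' = "\<lambda>v. 0 < nats ?t ''asg'' v 0"
    have t': "nats ?t ''center'' = nats t ''center''" "?A' = (\<lambda>v. v = w \<or> ?A v)" "?L' = ?L(w := ?L u)"
      using True ev_step uw by auto
    have L': "?L' x = (if x = w then ?L u else ?L x)" for x using fun_cong[OF t'(3), of x] by simp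
    have A': "?A' x \<longleftrightarrow> x = w \<or> ?A x" for x using fun_cong[OF t'(2), of x] by simp
    have "rooted ?t" using inv(1) True unfolding rooted_def A' L' t'(1) by auto
    moreover have "linked ?t"
      unfolding linked_def
    proof (intro allI impI)
      fix v assume v: "v < n" "?A' v"
      define S where "S x = Restr E {y. y < n \<and> ?A y \<and> ?L y = x}" for x
      define S' where "S' x = Restr E {y. y < n \<and> ?A' y \<and> ?L' y = x}" for x
      have "S x \<subseteq> S' x" for x unfolding S_def S'_def A' L' using True by auto
      then have SS: "(S x)\<^sup>* \<subseteq> (S' x)\<^sup>*" for x by (rule rtrancl_mono)
      have old: "?L v < k \<and> (nats t ''center'' (?L v) 0, v) \<in> (S (?L v))\<^sup>*" if "v < n" "?A v" for v
        using inv(2) that unfolding linked_def S_def by blast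
      have "?L' v < k \<and> (nats t ''center'' (?L' v) 0, v) \<in> (S' (?L' v))\<^sup>*"
      proof (cases "v = w")
        case True
        have u: "?L u < k" "(nats t ''center'' (?L u) 0, u) \<in> (S' (?L u))\<^sup>*"
          using old[of u] \<open>?G\<close> uw SS by auto
        moreover have "(u, w) \<in> S' (?L u)" using \<open>?G\<close> uw unfolding S'_def A' L' by auto
        ultimately show ?thesis using True by (auto simp: L' intro: rtrancl_into_rtrancl)
      next
        case False
        then show ?thesis using old[of v] v SS by (auto simp: L' A')
      qed
      then show "?L' v < k \<and> (nats ?t ''center'' (?L' v) 0, v) \<in> (Restr E {x. x < n \<and> ?A' x \<and> ?L' x = ?L' v})\<^sup>*"
        unfolding S'_def t'(1) .
    qed
    moreover have "near r X rk l B ?t"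
      unfolding near_def
    proof (intro allI impI)
      fix v assume v: "v < n" "?A' v"
      define new where "new v q \<longleftrightarrow> d v q \<le> B \<or> (\<exists>c\<in>X. \<exists>c'\<in>X. \<exists>w<n. rk c = l \<and> rk c' = l \<and> v \<in> component r c \<and> w \<in> component r c' \<and>
        (c, c') \<in> (chain r X rk l)\<^sup>* \<and> d w q \<le> B)" for v q
      have old: "new v (nats t ''center'' (?L v) 0)" if "v < n" "?A v" for v
        using inv(3) that unfolding near_def new_def Let_def by blast
      have "new v (nats t ''center'' (?L' v) 0)"
      proof (cases "v = w")
        case True
        let ?q = "nats t ''center'' (?L u) 0"
        have "new u ?q" using old[of u] \<open>?G\<close> uw by simp
        then have "new w ?q"
          unfolding new_def[of u]
        proof (elim disjE bexE exE conjE)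
          \<comment> \<open>Here a chain starts: it consists of \<open>c\<close> alone, and
            \<open>u\<close> is its vertex within distance \<open>B\<close> of the root.\<close>
          assume "d u ?q \<le> B"
          then show ?thesis unfolding new_def using c \<open>?G\<close> uw by (intro disjI2 bexI[of _ c] exI[of _ u]) auto
        next
          fix c1 c' x assume x: "c1 \<in> X" "c' \<in> X" "rk c1 = l" "rk c' = l" "x < n" "u \<in> component r c1" "x \<in> component r c'"
            "(c1, c') \<in> (chain r X rk l)\<^sup>*" "d x ?q \<le> B"
          have "c1 < n" using x X by auto
          have "d c u \<le> r" "d c1 u \<le> r" using componentD \<open>?G\<close> \<open>c < n\<close> \<open>c1 < n\<close> \<open>0 \<le> r\<close> x by blast+
          then have "d c c1 \<le> 2 * r"
            using triangle[of c u c1] commute[of u c1] \<open>c < n\<close> \<open>c1 < n\<close> uw by simp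
          then have "(c, c1) \<in> chain r X rk l" using c x by (auto simp: chain_def)
          then have "(c, c') \<in> (chain r X rk l)\<^sup>*" using x(8) by (rule converse_rtrancl_into_rtrancl)
          then show ?thesis unfolding new_def using c \<open>?G\<close> x by blast
        qed
        then show ?thesis using True by (simp add: L')
      next
        case False
        then show ?thesis using old[of v] v by (auto simp: L' A')
      qed
      then show "let q = nats ?t ''center'' (?L' v) 0 in
        d v q \<le> B \<or> (\<exists>c\<in>X. \<exists>c'\<in>X. \<exists>w<n. rk c = l \<and> rk c' = l \<and> v \<in> component r c \<and> w \<in> component r c' \<and>
        (c, c') \<in> (chain r X rk l)\<^sup>* \<and> d w q \<le> B)"
        unfolding new_def t'(1) Let_def .
    qed
    ultimately show ?thesis using A' by auto
  qed
  then show "rooted (ev flood_step t)" "linked (ev flood_step t)" "near r X rk l B (ev flood_step t)"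
    and "0 < nats t ''asg'' v 0 \<Longrightarrow> 0 < nats (ev flood_step t) ''asg'' v 0"
    and "0 < nats t ''asg'' u 0 \<Longrightarrow> u \<in> component r c \<Longrightarrow> w \<in> component r c \<Longrightarrow> (u, w) \<in> E \<Longrightarrow> 0 < nats (ev flood_step t) ''asg'' w 0"
    by auto
qed

lemma flood_sweep:
  assumes "input s" and T: "\<forall>v<n. \<forall>w<n. 0 < nats s ''T'' v w \<longleftrightarrow> w \<in> component r v"
    and X: "X \<subseteq> {..<n}" and "0 \<le> r"
    and inv: "rooted s" "linked s" "near r X rk l B s"
    and c: "c \<in> X" "rk c = l" "nats s ''c'' 0 0 = c"
  defines "s' \<equiv> ev (For ''u'' nN (For ''w'' nN flood_step)) s"
  shows "rooted s'" "linked s'" "near r X rk l B s'"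
    and "0 < nats s ''asg'' v 0 \<Longrightarrow> 0 < nats s' ''asg'' v 0"
    and "0 < nats s ''asg'' u 0 \<Longrightarrow> u \<in> component r c \<Longrightarrow> w \<in> component r c \<Longrightarrow> (u, w) \<in> E \<Longrightarrow> 0 < nats s' ''asg'' w 0"
proof -
  define P where "P t \<longleftrightarrow> rooted t \<and> linked t \<and> near r X rk l B t \<and>
     (\<forall>v. 0 < nats s ''asg'' v 0 \<longrightarrow> 0 < nats t ''asg'' v 0)" for t
  define Q where "Q u w t \<longleftrightarrow> (0 < nats s ''asg'' u 0 \<and> u \<in> component r c \<and> w \<in> component r c \<and> (u, w) \<in> E \<longrightarrow>
     0 < nats t ''asg'' w 0)" for u w and t :: store
  have "P s' \<and> (\<forall>u<n. \<forall>w<n. Q u w s')"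
    unfolding s'_def
  proof (rule For_pairs)
    fix t u w
    assume t: "P t" "nats t ''u'' 0 0 = u" "nats t ''w'' 0 0 = w" "u < n" "w < n"
      and fr: "frame (insert ''u'' (insert ''w'' (nw flood_step))) (rw flood_step) s t"
    have "input t" using input_frame[OF fr assms(1)] by simp
    moreover have "nats t ''T'' = nats s ''T''" "nats t ''c'' 0 0 = c"
      using frame_nats[OF fr] c by simp_all
    ultimately show "P (ev flood_step t) \<and> Q u w (ev flood_step t) \<and> (\<forall>u' w'. Q u' w' t \<longrightarrow> Q u' w' (ev flood_step t))"
      using flood_step_correct[of t r X rk l B c u w] t T X \<open>0 \<le> r\<close> c unfolding P_def Q_def by simp
  qed (use assms in \<open>auto simp: P_def Q_def input_def rooted_def linked_def near_def\<close>)
  then show "rooted s'" "linked s'" "near r X rk l B s'"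
    and "0 < nats s ''asg'' v 0 \<Longrightarrow> 0 < nats s' ''asg'' v 0"
    and "0 < nats s ''asg'' u 0 \<Longrightarrow> u \<in> component r c \<Longrightarrow> w \<in> component r c \<Longrightarrow> (u, w) \<in> E \<Longrightarrow> 0 < nats s' ''asg'' w 0"
    using E_sub unfolding P_def Q_def by auto
qed

text \<open>All members of \<open>X\<close> are roots, so \<open>c\<close> is assigned when its turn
  comes, and assignment spreads from \<open>c\<close> along the walks of its component. Vertices of
  foreign clusters on the way keep their label and pass it on.\<close>

lemma flood_center_correct:
  assumes "input s" and T: "\<forall>v<n. \<forall>w<n. 0 < nats s ''T'' v w \<longleftrightarrow> w \<in> component r v"
    and X: "X \<subseteq> {..<n}" and "0 \<le> r"
    and inv: "rooted s" "linked s" "near r X rk l B s"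
    and c: "c \<in> X" "rk c = l" "nats s ''c'' 0 0 = c" and asg: "0 < nats s ''asg'' c 0"
  shows "rooted (ev flood_center s)" "linked (ev flood_center s)" "near r X rk l B (ev flood_center s)"
    and "0 < nats s ''asg'' v 0 \<Longrightarrow> 0 < nats (ev flood_center s) ''asg'' v 0"
    and "v \<in> component r c \<Longrightarrow> 0 < nats (ev flood_center s) ''asg'' v 0"
proof -
  define R where "R = Restr E {x. x < n \<and> d c x \<le> r}"
  define Inv where "Inv m t \<longleftrightarrow> rooted t \<and> linked t \<and> near r X rk l B t \<and>
     (\<forall>v. 0 < nats s ''asg'' v 0 \<longrightarrow> 0 < nats t ''asg'' v 0) \<and>
     (\<forall>j\<le>m. \<forall>w. (c, w) \<in> R ^^ j \<longrightarrow> 0 < nats t ''asg'' w 0)" for m and t :: store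
  define p where "p = For ''u'' nN (For ''w'' nN flood_step)"
  have nw_p: "nw p = {''u'', ''w'', ''asg'', ''cluster''}" "rw p = {}" by (simp_all add: p_def)
  have "Inv (n * n) (ev flood_center s)"
    unfolding flood_center_def p_def[symmetric]
  proof (rule For2_inv)
    fix m t assume I: "Inv m t" and fr: "frame (insert ''i'' (insert ''j'' (nw p))) (rw p) s t"
    have t: "input t" "nats t ''T'' = nats s ''T''" "nats t ''c'' 0 0 = c"
      using input_frame[OF fr assms(1)] frame_nats[OF fr] c by (simp_all add: nw_p)
    have It: "rooted t" "linked t" "near r X rk l B t" using I by (simp_all add: Inv_def)
    note sw = flood_sweep[OF t(1) T[folded t(2)] X \<open>0 \<le> r\<close> It c(1,2) t(3), folded p_def]
    have "0 < nats (ev p t) ''asg'' w 0" if "j \<le> Suc m" "(c, w) \<in> R ^^ j" for j w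
    proof (cases "j \<le> m")
      case True
      then show ?thesis using sw(4) I that by (auto simp: Inv_def)
    next
      case False
      then have "(c, w) \<in> R ^^ m O R" using that by (auto simp: le_Suc_eq)
      then obtain u where u: "(c, u) \<in> R ^^ m" "(u, w) \<in> R" by auto
      have "(c, u) \<in> R\<^sup>*" using relpow_imp_rtrancl[OF u(1)] .
      then have "u \<in> component r c" "w \<in> component r c"
        using u(2) unfolding component_def R_def by (auto intro: rtrancl_into_rtrancl)
      moreover have "0 < nats t ''asg'' u 0" using I u(1) by (auto simp: Inv_def)
      ultimately show ?thesis using sw(5)[of u w] u(2) by (auto simp: R_def)
    qed
    then show "Inv (Suc m) (ev p t)"
      using sw(1-4) I unfolding Inv_def by auto
  qed (use assms in \<open>auto simp: Inv_def input_def nw_p rooted_def linked_def near_def\<close>)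
  moreover have "\<exists>m\<le>n * n. (c, w) \<in> R ^^ m" if "w \<in> component r c" for w
    using rtrancl_relpow_bound[of R n c w] that unfolding R_def component_def by auto
  ultimately show "rooted (ev flood_center s)" "linked (ev flood_center s)" "near r X rk l B (ev flood_center s)"
    and "0 < nats s ''asg'' v 0 \<Longrightarrow> 0 < nats (ev flood_center s) ''asg'' v 0"
    and "v \<in> component r c \<Longrightarrow> 0 < nats (ev flood_center s) ''asg'' v 0"
    unfolding Inv_def by blast+
qed

lemma flood_layer_correct:
  assumes "input s" and T: "\<forall>v<n. \<forall>w<n. 0 < nats s ''T'' v w \<longleftrightarrow> w \<in> component r v"
    and X: "X \<subseteq> {..<n}" and "0 \<le> r"
    and cen: "\<forall>v<n. 0 < nats s ''cen'' v 0 \<longleftrightarrow> v \<in> X"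
    and rk: "\<forall>v\<in>X. nats s ''rank'' v 0 = rk v"
    and inv: "rooted s" "linked s" "near r X rk l B s"
    and asg: "\<forall>v\<in>X. 0 < nats s ''asg'' v 0" and l: "nats s ''l'' 0 0 = l"
  shows "rooted (ev flood_layer s)" "linked (ev flood_layer s)" "near r X rk l B (ev flood_layer s)"
    and "0 < nats s ''asg'' v 0 \<Longrightarrow> 0 < nats (ev flood_layer s) ''asg'' v 0"
    and "c \<in> X \<Longrightarrow> rk c = l \<Longrightarrow> v \<in> component r c \<Longrightarrow> 0 < nats (ev flood_layer s) ''asg'' v 0"
proof -
  define Inv where "Inv a t \<longleftrightarrow> rooted t \<and> linked t \<and> near r X rk l B t \<and>
     (\<forall>v. 0 < nats s ''asg'' v 0 \<longrightarrow> 0 < nats t ''asg'' v 0) \<and>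
     (\<forall>c\<in>X. \<forall>v. c < a \<and> rk c = l \<and> v \<in> component r c \<longrightarrow> 0 < nats t ''asg'' v 0)" for a and t :: store
  define g where "g = And (pos (narr ''cen'' ''c'')) (neq (narr ''rank'' ''c'') (nvar ''l''))"
  have "Inv n (ev flood_layer s)"
    unfolding flood_layer_def g_def[symmetric]
  proof (rule For_inv)
    fix a t assume a: "a < n" "Inv a t" "nats t ''c'' 0 0 = a"
      and fr: "frame (insert ''c'' (nw (whn g flood_center))) (rw (whn g flood_center)) s t"
    have t: "input t" "nats t ''T'' = nats s ''T''" "nats t ''cen'' = nats s ''cen''"
       "nats t ''rank'' = nats s ''rank''" "nats t ''l'' = nats s ''l''"
      using input_frame[OF fr assms(1)] frame_nats[OF fr] by simp_all
    have g: "bval g t \<longleftrightarrow> a \<in> X \<and> rk a = l"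
      using t a cen rk l by (auto simp: g_def)
    show "Inv (Suc a) (ev (whn g flood_center) t)"
    proof (cases "a \<in> X \<and> rk a = l")
      case True
      have It: "rooted t" "linked t" "near r X rk l B t" and "0 < nats t ''asg'' a 0"
        using a(2) asg True by (simp_all add: Inv_def)
      note fc = flood_center_correct[OF t(1) T[folded t(2)] X \<open>0 \<le> r\<close> It True[THEN conjunct1] True[THEN conjunct2]
          a(3) \<open>0 < nats t ''asg'' a 0\<close>]
      have *: "ev (whn g flood_center) t = ev flood_center t" using g True by simp
      have "0 < nats (ev flood_center t) ''asg'' v 0" if "c \<in> X" "c < Suc a" "rk c = l" "v \<in> component r c" for c v
      proof (cases "c = a")
        case False
        then have "c < a" using that by simp
        then have "0 < nats t ''asg'' v 0" using a(2) that unfolding Inv_def by blast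
        then show ?thesis by (rule fc(4))
      qed (use fc(5) that in simp)
      moreover have "0 < nats (ev flood_center t) ''asg'' v 0" if "0 < nats s ''asg'' v 0" for v
        using a(2) fc(4) that unfolding Inv_def by blast
      ultimately show ?thesis using fc(1-3) unfolding Inv_def * by blast
    next
      case False
      then have "\<not> bval g t" using g by blast
      then have "ev (whn g flood_center) t = t" by simp
      then show ?thesis using False a(2) unfolding Inv_def less_Suc_eq by auto
    qed
  qed (use assms in \<open>auto simp: Inv_def input_def rooted_def linked_def near_def\<close>)
  then show "rooted (ev flood_layer s)" "linked (ev flood_layer s)" "near r X rk l B (ev flood_layer s)"
    and "0 < nats s ''asg'' v 0 \<Longrightarrow> 0 < nats (ev flood_layer s) ''asg'' v 0"
    and "c \<in> X \<Longrightarrow> rk c = l \<Longrightarrow> v \<in> component r c \<Longrightarrow> 0 < nats (ev flood_layer s) ''asg'' v 0"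
    using X unfolding Inv_def by auto
qed

text \<open>At the end of a layer a chain turns into a distance: \<open>v\<close> to
  \<open>c\<close>, \<open>c\<close> to \<open>c'\<close>, \<open>c'\<close> to \<open>w\<close> and
  \<open>w\<close> to the root cost at most \<open>r\<close>, \<open>h\<close>, \<open>r\<close> and
  the old bound. The minimum with \<open>L\<close> accounts for surplus layers: for
  \<open>l \<ge> L\<close> no centre has rank \<open>l\<close>, so there are no chains.\<close>

lemma near_next:
  assumes near: "near r X rk l (real (min l L) * (h + 2 * r)) t" and rank: "rank_ok r X rk L h"
    and X: "X \<subseteq> {..<n}" and "0 \<le> r" "0 \<le> h" and rooted: "rooted t" and linked: "linked t"
  shows "near r X rk (Suc l) (real (min (Suc l) L) * (h + 2 * r)) t"
  unfolding near_def Let_def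
proof (intro allI impI disjI1)
  fix v assume v: "v < n" "0 < nats t ''asg'' v 0"
  define q where "q = nats t ''center'' (nats t ''cluster'' v 0) 0"
  have "nats t ''cluster'' v 0 < k" using linked v by (simp add: linked_def)
  then have "q < n" using rooted by (simp add: rooted_def q_def)
  have "0 \<le> h + 2 * r" using assms by simp
  have "d v q \<le> real (min l L) * (h + 2 * r) \<or> (\<exists>c\<in>X. \<exists>c'\<in>X. \<exists>w<n. rk c = l \<and> rk c' = l \<and>
      v \<in> component r c \<and> w \<in> component r c' \<and> (c, c') \<in> (chain r X rk l)\<^sup>* \<and> d w q \<le> real (min l L) * (h + 2 * r))"
    using near v unfolding near_def Let_def q_def by blast
  then consider "d v q \<le> real (min l L) * (h + 2 * r)" | c c' w where "c \<in> X" "c' \<in> X" "w < n" "rk c = l"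
    "rk c' = l" "v \<in> component r c" "w \<in> component r c'" "(c, c') \<in> (chain r X rk l)\<^sup>*" "d w q \<le> real (min l L) * (h + 2 * r)"
    by blast
  then show "d v q \<le> real (min (Suc l) L) * (h + 2 * r)"
  proof cases
    case 1
    have "real (min l L) * (h + 2 * r) \<le> real (min (Suc l) L) * (h + 2 * r)"
      using \<open>0 \<le> h + 2 * r\<close> by (intro mult_right_mono) auto
    then show ?thesis using 1 by simp
  next
    case 2
    have "l < L" using rank 2(1,4) by (auto simp: rank_ok_def)
    have "d c c' \<le> h" using rank 2(1,2,4,8) by (auto simp: rank_ok_def chain_def)
    have "c < n" "c' < n" using 2 X by auto
    have "d c v \<le> r" "d c' w \<le> r" using componentD 2 \<open>c < n\<close> \<open>c' < n\<close> \<open>0 \<le> r\<close> by blast+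
    moreover have "d v q \<le> d v c + d c q" "d c q \<le> d c c' + d c' q" "d c' q \<le> d c' w + d w q"
      using triangle \<open>c < n\<close> \<open>c' < n\<close> \<open>q < n\<close> v 2(3) by auto
    ultimately have "d v q \<le> r + h + r + real l * (h + 2 * r)"
      using \<open>d c c' \<le> h\<close> 2(9) \<open>l < L\<close> commute[of v c] by (simp add: min_def)
    then show ?thesis using \<open>l < L\<close> by (simp add: min_def algebra_simps)
  qed
qed

lemma flood_correct:
  assumes "input s" and T: "\<forall>v<n. \<forall>w<n. 0 < nats s ''T'' v w \<longleftrightarrow> w \<in> component r v"
    and X: "X \<subseteq> {..<n}" and "0 \<le> r" "0 \<le> h"
    and cen: "\<forall>v<n. 0 < nats s ''cen'' v 0 \<longleftrightarrow> v \<in> X"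
    and cover: "\<forall>v<n. \<exists>c\<in>X. v \<in> component r c"
    and rk: "\<forall>v\<in>X. nats s ''rank'' v 0 = rk v"
    and rank: "rank_ok r X rk L h"
    and L: "\<forall>c\<in>X. rk c \<le> n + nats s ''dim'' 0 0"
    and inv: "rooted s" and asg: "\<forall>v\<in>X. 0 < nats s ''asg'' v 0"
    and roots: "\<forall>v<n. 0 < nats s ''asg'' v 0 \<longrightarrow> nats s ''cluster'' v 0 < k \<and>
       nats s ''center'' (nats s ''cluster'' v 0) 0 = v"
  shows "rooted (ev flood_prog s)"
    and "v < n \<Longrightarrow> 0 < nats (ev flood_prog s) ''asg'' v 0"
    and "linked (ev flood_prog s)"
    and "v < n \<Longrightarrow> d v (nats (ev flood_prog s) ''center'' (nats (ev flood_prog s) ''cluster'' v 0) 0) \<le> real L * (h + 2 * r)"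
proof -
  define M where "M = n + nats s ''dim'' 0 0 + 1"
  define Inv where "Inv l t \<longleftrightarrow> rooted t \<and> linked t \<and> near r X rk l (real (min l L) * (h + 2 * r)) t \<and>
     (\<forall>v\<in>X. 0 < nats t ''asg'' v 0) \<and>
     (\<forall>c\<in>X. \<forall>v. rk c < l \<and> v \<in> component r c \<longrightarrow> 0 < nats t ''asg'' v 0)" for l and t :: store
  have "linked s" using roots by (auto simp: linked_def)
  moreover have "near r X rk 0 0 s" using roots by (auto simp: near_def Let_def)
  ultimately have "Inv 0 s" using inv asg by (simp add: Inv_def)
  have I: "Inv M (ev flood_prog s)"
    unfolding flood_prog_def
  proof (rule For_inv)
    show "Inv 0 s" by fact
    show "nval nL s = M" using assms(1) by (simp add: M_def input_def)
    fix l t assume l: "l < M" "Inv l t" "nats t ''l'' 0 0 = l"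
      and fr: "frame (insert ''l'' (nw flood_layer)) (rw flood_layer) s t"
    have t: "input t" "nats t ''T'' = nats s ''T''" "nats t ''cen'' = nats s ''cen''" "nats t ''rank'' = nats s ''rank''"
      using input_frame[OF fr assms(1)] frame_nats[OF fr] by simp_all
    have It: "rooted t" "linked t" "near r X rk l (real (min l L) * (h + 2 * r)) t" "\<forall>v\<in>X. 0 < nats t ''asg'' v 0"
      using l(2) by (simp_all add: Inv_def)
    note fl = flood_layer_correct[OF t(1) T[folded t(2)] X \<open>0 \<le> r\<close> cen[folded t(3)] rk[folded t(4)] It l(3)]
    have "near r X rk (Suc l) (real (min (Suc l) L) * (h + 2 * r)) (ev flood_layer t)"
      by (rule near_next[OF _ rank X \<open>0 \<le> r\<close> \<open>0 \<le> h\<close>]) (use fl in auto)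
    then show "Inv (Suc l) (ev flood_layer t)"
      using fl l(2) unfolding Inv_def less_Suc_eq by blast
  qed (auto simp: Inv_def rooted_def linked_def near_def)
  show "rooted (ev flood_prog s)" "linked (ev flood_prog s)" using I by (simp_all add: Inv_def)
  have all: "0 < nats (ev flood_prog s) ''asg'' v 0" if v: "v < n" for v
  proof -
    obtain c where "c \<in> X" "v \<in> component r c" using cover v by blast
    moreover have "rk c < M" using bspec[OF L \<open>c \<in> X\<close>] by (simp add: M_def)
    ultimately show ?thesis using I unfolding Inv_def by blast
  qed
  then show "v < n \<Longrightarrow> 0 < nats (ev flood_prog s) ''asg'' v 0" .
  \<comment> \<open>The invariant after the last layer still admits chains of rank \<open>M\<close>;
    as no centre has this rank, the direct bound remains.\<close>
  have no: "\<not> rk c = M" if "c \<in> X" for c using bspec[OF L that] by (simp add: M_def)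
  show "d v (nats (ev flood_prog s) ''center'' (nats (ev flood_prog s) ''cluster'' v 0) 0) \<le> real L * (h + 2 * r)" if "v < n"
  proof -
    have "d v (nats (ev flood_prog s) ''center'' (nats (ev flood_prog s) ''cluster'' v 0) 0) \<le> real (min M L) * (h + 2 * r)"
      using I all[OF that] that no unfolding Inv_def near_def Let_def by blast
    also have "\<dots> \<le> real L * (h + 2 * r)" using assms by (intro mult_right_mono) auto
    finally show ?thesis .
  qed
qed

end

section \<open>The approximation algorithm\<close>

definition pipeline :: "prog \<Rightarrow> prog" where
  "pipeline rp = search_prog ;; root_prog ;; rp ;; flood_prog"

text \<open>The arrays listed belong to the input or carry the search and the roots over to the
  flooding; a rank computation has to leave them alone.\<close>

definition rank_prog :: "prog \<Rightarrow> bool" where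
  "rank_prog rp \<longleftrightarrow> wf_prog rp \<and>
     nw rp \<inter> {''n'', ''dim'', ''k'', ''edge'', ''T'', ''cen'', ''asg'', ''cluster'', ''center''} = {} \<and> ''dist'' \<notin> rw rp"

lemma wf_search: "wf_prog search_prog"
  unfolding search_prog_def reach_prog_def reach_sweep_def reach_step_def greedy_prog_def by simp

lemma wf_root: "wf_prog root_prog"
  unfolding root_prog_def root_step_def by simp

lemma wf_flood: "wf_prog flood_prog"
  unfolding flood_prog_def flood_layer_def flood_center_def flood_step_def by simp

lemma wf_pipeline: "rank_prog rp \<Longrightarrow> wf_prog (pipeline rp)"
  unfolding pipeline_def wf_prog.simps using wf_search wf_root wf_flood by (simp add: rank_prog_def)

text \<open>Composition with \<open>[:1, 1:]\<close> shifts the argument by one, since loop bounds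
  reach the input size plus 1.\<close>

lemma exec_encode:
  assumes "wf_prog p" "nats s ''n'' 0 0 + nats s ''dim'' 0 0 = m"
  shows "\<exists>t\<le>poly (pcompose (time_poly p) [:1, 1:]) m. exec (com_of p) s t (ev p s)"
  using exec_com_of[OF assms(1), of s "Suc m"] assms(2) by (simp add: poly_pcompose)

definition solved :: "('i, 's) min_problem \<Rightarrow> 'i \<Rightarrow> store \<Rightarrow> real \<Rightarrow> bool" where
  "solved P I s \<alpha> \<longleftrightarrow> (solutions P I \<noteq> {} \<longrightarrow> decode P I s \<in> solutions P I \<and> cost P I (decode P I s) \<le> \<alpha> * opt P I)"

lemma approx_algI:
  assumes wf: "wf_prog p" and sol: "\<And>I. valid_inst I \<Longrightarrow> solved P I (ev p (encode I)) (ratio I)"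
  shows "approx_alg P ratio (com_of p)"
  unfolding approx_alg_def poly_time_approx_def
proof (intro exI[of _ "pcompose (time_poly p) [:1, 1:]"] allI impI)
  fix I :: cluster_inst assume I: "valid_inst I"
  have "nats (encode I) ''n'' 0 0 + nats (encode I) ''dim'' 0 0 = num_points I" by (simp add: encode_def)
  from exec_encode[OF wf this] sol[OF I, unfolded solved_def]
  show "\<exists>t s. exec (com_of p) (encode I) t s \<and> t \<le> poly (pcompose (time_poly p) [:1, 1:]) (num_points I) \<and>
     (solutions P I \<noteq> {} \<longrightarrow> decode P I s \<in> solutions P I \<and> cost P I (decode P I s) \<le> ratio I * opt P I)"
    by blast
qed

lemma lp_approx_algI:
  assumes wf: "wf_prog q" and sol: "\<And>I. valid_lp_inst p I \<Longrightarrow> solved P I (ev q (encode_lp I)) (ratio I)"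
  shows "lp_approx_alg p P ratio (com_of q)"
  unfolding lp_approx_alg_def poly_time_approx_def
proof (intro exI[of _ "pcompose (time_poly q) [:1, 1:]"] allI impI)
  fix I :: lp_inst assume I: "valid_lp_inst p I"
  have "nats (encode_lp I) ''n'' 0 0 + nats (encode_lp I) ''dim'' 0 0 = num_points I + space_dim I"
    by (simp add: encode_lp_def encode_def)
  from exec_encode[OF wf this] sol[OF I, unfolded solved_def]
  show "\<exists>t s. exec (com_of q) (encode_lp I) t s \<and>
     t \<le> poly (pcompose (time_poly q) [:1, 1:]) (num_points I + space_dim I) \<and>
     (solutions P I \<noteq> {} \<longrightarrow> decode P I s \<in> solutions P I \<and> cost P I (decode P I s) \<le> ratio I * opt P I)"
    by blast
qed

text \<open>Flags such as \<open>found\<close>, \<open>asg\<close> and \<open>rkd\<close> are read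
  before they are written; this records that they start at 0.\<close>

definition blank :: "store \<Rightarrow> bool" where
  "blank s \<longleftrightarrow> (\<forall>y. y \<notin> {''n'', ''dim'', ''k'', ''edge''} \<longrightarrow> nats s y = (\<lambda>_ _. 0))"

context conn_inst
begin

definition rank_input :: "real \<Rightarrow> store \<Rightarrow> bool" where
  "rank_input r s \<longleftrightarrow> input s \<and> reals s ''R'' 0 0 = r \<and> 0 \<le> r \<and> card (greedy r n) \<le> k \<and>
     (\<forall>v<n. 0 < nats s ''cen'' v 0 \<longleftrightarrow> v \<in> greedy r n) \<and>
     (\<forall>y. y \<notin> {''n'', ''dim'', ''k'', ''edge''} \<union> nw search_prog \<union> nw root_prog \<longrightarrow> nats s y = (\<lambda>_ _. 0))"

text \<open>\<open>L\<close> and \<open>h\<close> are quantified here because they never appear in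
  the store. The last clause keeps all ranks within the layers that are flooded.\<close>

definition ranks :: "prog \<Rightarrow> real \<Rightarrow> real \<Rightarrow> store \<Rightarrow> bool" where
  "ranks rp r \<alpha> s \<longleftrightarrow> (\<exists>L h. rank_ok r (greedy r n) (\<lambda>v. nats (ev rp s) ''rank'' v 0) L h \<and> 0 \<le> h \<and>
     real L * (h + 2 * r) \<le> \<alpha> * r \<and> (\<forall>c\<in>greedy r n. nats (ev rp s) ''rank'' c 0 \<le> n + nats s ''dim'' 0 0))"

text \<open>The clustering \<open>C\<close> is arbitrary: its existence yields a distance at which
  the greedy choice succeeds and enough points for \<open>k\<close> roots. The comparison of
  \<open>r\<close> with an optimal clustering is left to \<open>best_radius\<close>.\<close>

lemma pipeline_correct:
  assumes "input s" "blank s" "rank_prog rp" and C: "connected_clustering {..<n} E k C"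
    and rp: "\<forall>r t. rank_input r t \<longrightarrow> nats t ''dim'' = nats s ''dim'' \<longrightarrow> reals t ''coord'' = reals s ''coord'' \<longrightarrow> ranks rp r \<alpha> t"
  defines "lab \<equiv> \<lambda>v. nats (ev (pipeline rp) s) ''cluster'' v 0"
    and "ctr \<equiv> \<lambda>i. nats (ev (pipeline rp) s) ''center'' i 0"
  shows "connected_clustering {..<n} E k (\<lambda>i. {x \<in> {..<n}. lab x = i})"
    and "i < k \<Longrightarrow> ctr i < n \<and> lab (ctr i) = i"
    and "\<exists>r. best_radius r \<and> center_cost d k (\<lambda>i. {x \<in> {..<n}. lab x = i}) ctr \<le> \<alpha> * r \<and>
      diameter_cost d k (\<lambda>i. {x \<in> {..<n}. lab x = i}) \<le> 2 * (\<alpha> * r)"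
proof -
  obtain a b where ab: "a < n" "b < n" "diameter_cost d k C = d a b"
    using diameter_cost_attained[OF C _ k1, of d] by auto
  have "card (greedy (d a b) n) \<le> k" using card_greedy_le[OF C] ab by auto
  then have ex: "\<exists>a<n. \<exists>b<n. card (greedy (d a b) n) \<le> k" using ab by blast
  have "k \<le> n" using clustering_card_le[OF C] by simp
  define s1 where "s1 = ev search_prog s"
  define r where "r = reals s1 ''R'' 0 0"
  define s2 where "s2 = ev root_prog s1"
  define s3 where "s3 = ev rp s2"
  define s4 where "s4 = ev flood_prog s3"
  have s4: "ev (pipeline rp) s = s4" by (simp add: pipeline_def s4_def s3_def s2_def s1_def)
  let ?X = "greedy r n"
  have "nats s ''found'' 0 0 = 0" using \<open>blank s\<close> by (simp add: blank_def)
  note S = search_correct[OF \<open>input s\<close> this ex, folded s1_def, folded r_def]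
  have "input s1" unfolding s1_def by (rule input_ev[OF \<open>input s\<close>]) auto
  have "0 \<le> r" "card ?X \<le> k" using S(1) by (simp_all add: best_radius_def)
  have X: "?X \<subseteq> {..<n}" by (rule greedy_sub)
  have asg0: "nats s1 ''asg'' v 0 = 0" for v using \<open>blank s\<close> by (simp add: s1_def nats_ev blank_def)
  note Rt = root_correct[OF \<open>input s1\<close> asg0 X S(3) S(4) \<open>card ?X \<le> k\<close> \<open>k \<le> n\<close>, folded s2_def]
  have "input s2" unfolding s2_def by (rule input_ev[OF \<open>input s1\<close>]) auto
  have ri: "rank_input r s2"
    unfolding rank_input_def
  proof (intro conjI allI impI)
    fix y assume "y \<notin> {''n'', ''dim'', ''k'', ''edge''} \<union> nw search_prog \<union> nw root_prog"
    then have "nats s2 y = nats s y" by (simp add: s2_def s1_def nats_ev)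
    then show "nats s2 y = (\<lambda>_ _. 0)"
      using \<open>blank s\<close> \<open>y \<notin> _\<close> by (simp add: blank_def)
  qed (use \<open>input s2\<close> \<open>0 \<le> r\<close> \<open>card ?X \<le> k\<close> S(3) in \<open>simp_all add: s2_def r_def reals_ev nats_ev\<close>)
  have dim: "nats s2 ''dim'' = nats s ''dim''" "reals s2 ''coord'' = reals s ''coord''"
    by (simp_all add: s2_def s1_def nats_ev reals_ev)
  from rp[rule_format, OF ri dim] obtain L h where L: "rank_ok r ?X (\<lambda>v. nats s3 ''rank'' v 0) L h" "0 \<le> h"
    "real L * (h + 2 * r) \<le> \<alpha> * r" "\<forall>c\<in>?X. nats s3 ''rank'' c 0 \<le> n + nats s2 ''dim'' 0 0"
    unfolding ranks_def s3_def by blast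
  define K where "K = {''n'', ''dim'', ''k'', ''edge'', ''T'', ''cen'', ''asg'', ''cluster'', ''center''}"
  have "nw rp \<inter> K = {}" using \<open>rank_prog rp\<close> unfolding rank_prog_def K_def by (elim conjE)
  then have nw: "y \<in> K \<Longrightarrow> y \<notin> nw rp" for y by blast
  have s3: "input s3" "nats s3 ''T'' = nats s2 ''T''" "nats s3 ''cen'' = nats s2 ''cen''" "nats s3 ''asg'' = nats s2 ''asg''"
    "nats s3 ''cluster'' = nats s2 ''cluster''" "nats s3 ''center'' = nats s2 ''center''" "nats s3 ''dim'' = nats s2 ''dim''"
    unfolding s3_def
    by (rule input_ev[OF \<open>input s2\<close>]; (rule nw | use \<open>rank_prog rp\<close> in \<open>simp add: rank_prog_def\<close>); simp add: K_def)
      (rule nats_ev, rule nw, simp add: K_def)+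
  have T: "\<forall>v<n. \<forall>w<n. 0 < nats s3 ''T'' v w \<longleftrightarrow> w \<in> component r v"
    unfolding s3 using S(2) by (simp add: s2_def nats_ev)
  have cen: "\<forall>v<n. 0 < nats s3 ''cen'' v 0 \<longleftrightarrow> v \<in> ?X"
    unfolding s3 using S(3) by (simp add: s2_def nats_ev)
  have cover: "\<forall>v<n. \<exists>c\<in>?X. v \<in> component r c" using greedy_covers by blast
  have rooted3: "rooted s3" using Rt(1) by (simp add: rooted_def s3)
  have asg3: "\<forall>v\<in>?X. 0 < nats s3 ''asg'' v 0" using Rt(3) by (simp add: s3)
  have roots3: "\<forall>v<n. 0 < nats s3 ''asg'' v 0 \<longrightarrow> nats s3 ''cluster'' v 0 < k \<and>
       nats s3 ''center'' (nats s3 ''cluster'' v 0) 0 = v" using Rt(2) by (simp add: s3)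
  have L4: "\<forall>c\<in>?X. nats s3 ''rank'' c 0 \<le> n + nats s3 ''dim'' 0 0" using L(4) by (simp add: s3)
  have rk: "\<forall>v\<in>?X. nats s3 ''rank'' v 0 = nats s3 ''rank'' v 0" by simp
  note F = flood_correct[OF s3(1) T X \<open>0 \<le> r\<close> L(2) cen cover rk L(1) L4 rooted3 asg3 roots3, folded s4_def]
  have lab: "lab v = nats s4 ''cluster'' v 0" for v by (simp add: lab_def s4)
  have ctr: "ctr v = nats s4 ''center'' v 0" for v by (simp add: ctr_def s4)
  show ci: "ctr i < n \<and> lab (ctr i) = i" if "i < k" for i
    using F(1) that by (simp add: rooted_def lab ctr)
  have lk: "lab v < k \<and> (ctr (lab v), v) \<in> (Restr E {x. x < n \<and> lab x = lab v})\<^sup>*" if "v < n" for v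
  proof -
    have "{x. x < n \<and> 0 < nats s4 ''asg'' x 0 \<and> lab x = lab v} = {x. x < n \<and> lab x = lab v}"
      using F(2) by auto
    then show ?thesis using F(3) F(2)[OF that] that unfolding linked_def lab ctr by auto
  qed
  show cl: "connected_clustering {..<n} E k (\<lambda>i. {x \<in> {..<n}. lab x = i})"
    by (rule clustering_of_labels[of lab ctr]) (use lk ci in auto)
  have "d v (ctr (lab v)) \<le> \<alpha> * r" if "v < n" for v
    using F(4)[OF that] L(3) by (simp add: lab ctr)
  from cost_of_labels[OF cl ci this] S(1)
  show "\<exists>r. best_radius r \<and> center_cost d k (\<lambda>i. {x \<in> {..<n}. lab x = i}) ctr \<le> \<alpha> * r \<and>
      diameter_cost d k (\<lambda>i. {x \<in> {..<n}. lab x = i}) \<le> 2 * (\<alpha> * r)" by auto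
qed

end

lemma opt_attained:
  assumes "solutions P I \<noteq> {}" "finite (cost P I ` solutions P I)"
  obtains S where "S \<in> solutions P I" "cost P I S = opt P I"
proof -
  have "opt P I \<in> cost P I ` solutions P I" using Min_in[OF assms(2)] assms(1) by (simp add: opt_def)
  then show ?thesis using that by auto
qed

text \<open>The factor 2 has different origins. For centres it comes from the lower bound, as
  \<open>r\<close> is at most twice the optimal radius; for diameters it comes from the output,
  whose diameter is at most twice the distance bound to the roots.\<close>

lemma pipeline_approx:
  fixes I :: "'z cluster_inst_scheme"
  assumes "valid_inst I"
  defines "n \<equiv> num_points I" and "d \<equiv> distance I" and "k \<equiv> num_clusters I" and "E \<equiv> edges I"
  assumes "conn_inst.input n d k E s" "blank s" "rank_prog rp" "0 \<le> \<alpha>"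
    and rp: "\<And>r t. conn_inst.rank_input n d k E r t \<Longrightarrow> nats t ''dim'' = nats s ''dim'' \<Longrightarrow>
      reals t ''coord'' = reals s ''coord'' \<Longrightarrow> conn_inst.ranks n d E rp r \<alpha> t"
  shows "solved connected_k_center I (ev (pipeline rp) s) (2 * \<alpha>)"
    and "solved connected_k_diameter I (ev (pipeline rp) s) (2 * \<alpha>)"
proof -
  interpret Metric_space "{..<n}" d using assms(1) by (simp add: valid_inst_def n_def d_def)
  interpret conn_inst n d k E
    by unfold_locales (use assms(1) in \<open>auto simp: valid_inst_def n_def k_def E_def\<close>)
  have *: "decode connected_k_center I t = (\<lambda>i. {x \<in> {..<n}. nats t ''cluster'' x 0 = i}, \<lambda>i. nats t ''center'' i 0)" for t
    by (simp add: connected_k_center_def output_clusters_def n_def fun_eq_iff)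
  have dec: "decode connected_k_diameter I t = (\<lambda>i. {x \<in> {..<n}. nats t ''cluster'' x 0 = i})" for t
    by (simp add: connected_k_diameter_def output_clusters_def n_def fun_eq_iff)
  have sol: "(C, c) \<in> solutions connected_k_center I \<longleftrightarrow> connected_clustering {..<n} E k C \<and> (\<forall>i<k. c i \<in> C i)" for C c
    by (simp add: connected_k_center_def n_def k_def E_def)
  have sol': "C \<in> solutions connected_k_diameter I \<longleftrightarrow> connected_clustering {..<n} E k C" for C
    by (simp add: connected_k_diameter_def n_def k_def E_def)
  have rp': "\<forall>r t. rank_input r t \<longrightarrow> nats t ''dim'' = nats s ''dim'' \<longrightarrow> reals t ''coord'' = reals s ''coord'' \<longrightarrow> ranks rp r \<alpha> t"
    using rp by blast
  have fin: "finite ((\<lambda>(a, b). d a b) ` ({..<n} \<times> {..<n}))" by simp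
  show "solved connected_k_center I (ev (pipeline rp) s) (2 * \<alpha>)"
    unfolding solved_def
  proof
    assume ne: "solutions connected_k_center I \<noteq> {}"
    have sub: "cost connected_k_center I ` solutions connected_k_center I \<subseteq> (\<lambda>(a, b). d a b) ` ({..<n} \<times> {..<n})"
      using center_cost_attained[of "{..<n}" E k _ _ d] k1
      by (force simp: connected_k_center_def n_def d_def k_def E_def)
    obtain S where S: "S \<in> solutions connected_k_center I" "cost connected_k_center I S = opt connected_k_center I"
      using opt_attained[OF ne finite_subset[OF sub fin]] by blast
    obtain C c where Cc: "S = (C, c)" by (cases S)
    then have C: "connected_clustering {..<n} E k C" "\<forall>i<k. c i \<in> C i" "center_cost d k C c = opt connected_k_center I"
      using S sol by (auto simp: connected_k_center_def d_def k_def)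
    note pc = pipeline_correct[OF assms(6-8) C(1) rp']
    from pc(3) obtain r where r: "best_radius r"
      "center_cost d k (\<lambda>i. {x \<in> {..<n}. nats (ev (pipeline rp) s) ''cluster'' x 0 = i}) (\<lambda>i. nats (ev (pipeline rp) s) ''center'' i 0) \<le> \<alpha> * r"
      by blast
    have "r \<le> 2 * opt connected_k_center I"
      using best_radius_le_diameter[OF r(1) C(1)] diameter_le_center[OF C(1,2)] C(3) by simp
    then have "\<alpha> * r \<le> 2 * \<alpha> * opt connected_k_center I"
      using mult_left_mono[OF _ \<open>0 \<le> \<alpha>\<close>, of r "2 * opt connected_k_center I"] by (simp add: mult_ac)
    then have "cost connected_k_center I (decode connected_k_center I (ev (pipeline rp) s)) \<le> 2 * \<alpha> * opt connected_k_center I"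
      using r(2) unfolding * by (simp add: connected_k_center_def d_def k_def)
    moreover have "decode connected_k_center I (ev (pipeline rp) s) \<in> solutions connected_k_center I"
      unfolding * sol
    proof (intro conjI allI impI pc(1))
      fix i assume "i < k"
      from pc(2)[OF this] show "nats (ev (pipeline rp) s) ''center'' i 0 \<in>
          {x \<in> {..<n}. nats (ev (pipeline rp) s) ''cluster'' x 0 = i}" by simp
    qed
    ultimately show "decode connected_k_center I (ev (pipeline rp) s) \<in> solutions connected_k_center I \<and>
        cost connected_k_center I (decode connected_k_center I (ev (pipeline rp) s)) \<le> 2 * \<alpha> * opt connected_k_center I" by blast
  qed
  show "solved connected_k_diameter I (ev (pipeline rp) s) (2 * \<alpha>)"
    unfolding solved_def
  proof
    assume ne: "solutions connected_k_diameter I \<noteq> {}"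
    have sub: "cost connected_k_diameter I ` solutions connected_k_diameter I \<subseteq> (\<lambda>(a, b). d a b) ` ({..<n} \<times> {..<n})"
      using diameter_cost_attained[of "{..<n}" E k _ d] k1
      by (force simp: connected_k_diameter_def n_def d_def k_def E_def)
    obtain C where S: "C \<in> solutions connected_k_diameter I" "cost connected_k_diameter I C = opt connected_k_diameter I"
      using opt_attained[OF ne finite_subset[OF sub fin]] by blast
    then have C: "connected_clustering {..<n} E k C" "diameter_cost d k C = opt connected_k_diameter I"
      by (auto simp: connected_k_diameter_def n_def d_def k_def E_def)
    note pc = pipeline_correct[OF assms(6-8) C(1) rp']
    from pc(3) obtain r where r: "best_radius r"
      "diameter_cost d k (\<lambda>i. {x \<in> {..<n}. nats (ev (pipeline rp) s) ''cluster'' x 0 = i}) \<le> 2 * (\<alpha> * r)"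
      by blast
    have "\<alpha> * r \<le> \<alpha> * opt connected_k_diameter I"
      using best_radius_le_diameter[OF r(1) C(1)] C(2) mult_left_mono[OF _ \<open>0 \<le> \<alpha>\<close>] by simp
    then have "cost connected_k_diameter I (decode connected_k_diameter I (ev (pipeline rp) s)) \<le> 2 * \<alpha> * opt connected_k_diameter I"
      using r(2) unfolding dec by (simp add: connected_k_diameter_def d_def k_def)
    moreover have "decode connected_k_diameter I (ev (pipeline rp) s) \<in> solutions connected_k_diameter I"
      unfolding dec sol' by (rule pc(1))
    ultimately show "decode connected_k_diameter I (ev (pipeline rp) s) \<in> solutions connected_k_diameter I \<and>
        cost connected_k_diameter I (decode connected_k_diameter I (ev (pipeline rp) s)) \<le> 2 * \<alpha> * opt connected_k_diameter I" by blast
  qed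
qed

lemma input_encode:
  assumes "valid_inst I"
  shows "conn_inst.input (num_points I) (distance I) (num_clusters I) (edges I) (encode I)"
    and "blank (encode I)"
proof -
  interpret Metric_space "{..<num_points I}" "distance I" using assms by (simp add: valid_inst_def)
  interpret conn_inst "num_points I" "distance I" "num_clusters I" "edges I"
    by unfold_locales (use assms in \<open>auto simp: valid_inst_def\<close>)
  show "input (encode I)" by (simp add: input_def encode_def)
  show "blank (encode I)" using assms by (auto simp: blank_def encode_def)
qed

lemma input_encode_lp:
  assumes "valid_inst I"
  shows "conn_inst.input (num_points I) (distance I) (num_clusters I) (edges I) (encode_lp I)"
    and "blank (encode_lp I)"
proof -
  interpret Metric_space "{..<num_points I}" "distance I" using assms by (simp add: valid_inst_def)
  interpret conn_inst "num_points I" "distance I" "num_clusters I" "edges I"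
    by unfold_locales (use assms in \<open>auto simp: valid_inst_def\<close>)
  show "input (encode_lp I)" by (simp add: input_def encode_def encode_lp_def)
  show "blank (encode_lp I)" using assms by (auto simp: blank_def encode_def encode_lp_def)
qed

section \<open>Ranks in doubling metrics\<close>

text \<open>The flag \<open>ownd\<close> accompanies \<open>own\<close> because 0 is a legitimate
  owner. A point keeps the first net point that reaches it.\<close>

definition net_mark :: prog where
  "net_mark = For ''y'' nN (whn (And (zer (narr ''ownd'' ''y'')) (rle (rmat ''dist'' ''x'' ''y'') (rvar ''R'')))
     (aset ''own'' ''y'' (nvar ''x'') ;; aset ''ownd'' ''y'' N1))"

definition net_prog :: prog where
  "net_prog = For ''x'' nN (whn (zer (narr ''ownd'' ''x'')) (aset ''net'' ''x'' N1 ;; net_mark))"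

definition color_flag :: prog where
  "color_flag = nset ''flag'' N0 ;;
     For ''z'' nN (whn (And (And (pos (narr ''rkd'' ''z'')) (neq (narr ''col'' ''z'') (nvar ''l'')))
       (rle (rmat ''dist'' ''y'' ''z'') (RAdd (RAdd (rvar ''R'') (rvar ''R'')) (RAdd (rvar ''R'') (rvar ''R'')))))
       (nset ''flag'' N1))"

definition color_step :: prog where
  "color_step = color_flag ;;
     whn (And (zer (nvar ''flag'')) (And (pos (narr ''net'' ''y'')) (zer (narr ''rkd'' ''y''))))
       (aset ''rkd'' ''y'' N1 ;; aset ''col'' ''y'' (nvar ''l''))"

text \<open>First-fit colouring, one colour class at a time. A point of colour \<open>c\<close> has,
  for each smaller colour, a point of that colour within \<open>4 * r\<close>, which is what limits
  the number of colours. The range is \<open>4 * r\<close> since owners of centres at distance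
  \<open>2 * r\<close> are within \<open>r + 2 * r + r\<close> of each other.\<close>

definition color_prog :: prog where
  "color_prog = For ''l'' nN (For ''y'' nN color_step)"

definition doubling_prog :: prog where
  "doubling_prog = net_prog ;; color_prog ;; For ''x'' nN (aset ''rank'' ''x'' (NRead ''col'' (narr ''own'' ''x'') N0))"

lemma nw_doubling [simp]:
  "nw net_mark = {''y'', ''own'', ''ownd''}" "rw net_mark = {}"
  "nw net_prog = {''x'', ''net'', ''y'', ''own'', ''ownd''}" "rw net_prog = {}"
  "nw color_flag = {''flag'', ''z''}" "rw color_flag = {}"
  "nw color_step = {''flag'', ''z'', ''rkd'', ''col''}" "rw color_step = {}"
  "nw color_prog = {''l'', ''y'', ''flag'', ''z'', ''rkd'', ''col''}" "rw color_prog = {}"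
  "rw doubling_prog = {}"
  by (auto simp: net_mark_def net_prog_def color_flag_def color_step_def color_prog_def doubling_prog_def)

lemma rank_doubling_prog: "rank_prog doubling_prog"
proof -
  have "wf_prog net_prog" unfolding net_prog_def net_mark_def by simp
  moreover have "wf_prog color_prog" unfolding color_prog_def color_step_def color_flag_def by simp
  ultimately have "wf_prog doubling_prog" unfolding doubling_prog_def by simp
  then show ?thesis unfolding rank_prog_def by (simp add: doubling_prog_def)
qed

context conn_inst
begin

text \<open>A new net point is owned by none of the earlier ones, hence more than \<open>r\<close>
  away from all of them. It owns itself at once, its distance to itself being
  \<open>0 \<le> r\<close>.\<close>

lemma net_correct:
  assumes "input s" "reals s ''R'' 0 0 = r" "0 \<le> r"
    and "\<forall>y. nats s ''net'' y 0 = 0" "\<forall>y. nats s ''ownd'' y 0 = 0"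
  defines "own \<equiv> \<lambda>y. nats (ev net_prog s) ''own'' y 0" and "net \<equiv> {x. 0 < nats (ev net_prog s) ''net'' x 0}"
  shows "\<And>y. y < n \<Longrightarrow> own y \<in> net \<and> d (own y) y \<le> r"
    and "\<And>x x'. x \<in> net \<Longrightarrow> x' \<in> net \<Longrightarrow> x \<noteq> x' \<Longrightarrow> r < d x x'" and "net \<subseteq> {..<n}"
proof -
  define Inv where "Inv a t \<longleftrightarrow>
    (\<forall>y<n. 0 < nats t ''ownd'' y 0 \<longrightarrow> 0 < nats t ''net'' (nats t ''own'' y 0) 0 \<and> d (nats t ''own'' y 0) y \<le> r) \<and>
    (\<forall>y<a. 0 < nats t ''ownd'' y 0) \<and>
    (\<forall>x. 0 < nats t ''net'' x 0 \<longrightarrow> x < a \<and> (\<forall>y<n. d x y \<le> r \<longrightarrow> 0 < nats t ''ownd'' y 0)) \<and>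
    (\<forall>x x'. 0 < nats t ''net'' x 0 \<longrightarrow> 0 < nats t ''net'' x' 0 \<longrightarrow> x < x' \<longrightarrow> r < d x x')" for a and t :: store
  define p where "p = whn (zer (narr ''ownd'' ''x'')) (aset ''net'' ''x'' N1 ;; net_mark)"
  have "Inv n (ev net_prog s)"
    unfolding net_prog_def p_def[symmetric]
  proof (rule For_inv)
    fix a t assume a: "a < n" "Inv a t" "nats t ''x'' 0 0 = a" and fr: "frame (insert ''x'' (nw p)) (rw p) s t"
    have t: "input t" "reals t ''R'' = reals s ''R''"
      using input_frame[OF fr assms(1)] frame_reals[OF fr] by (simp_all add: p_def)
    show "Inv (Suc a) (ev p t)"
    proof (cases "0 < nats t ''ownd'' a 0")
      case True
      then have "ev p t = t" using a(3) by (simp add: p_def)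
      then show ?thesis using a(2) True unfolding Inv_def less_Suc_eq by auto
    next
      case False
      define t1 where "t1 = ev (aset ''net'' ''x'' N1) t"
      have ev_p: "ev p t = ev net_mark t1" using False a(3) by (simp add: p_def t1_def)
      have t1: "input t1" "nats t1 ''x'' 0 0 = a" "reals t1 ''R'' 0 0 = r" "nats t1 ''own'' = nats t ''own''"
        "nats t1 ''ownd'' = nats t ''ownd''" "\<And>x. nats t1 ''net'' x 0 = (if x = a then 1 else nats t ''net'' x 0)"
        using t a(3) assms(2) by (auto simp: t1_def input_def)
      define J where "J j u \<longleftrightarrow> (\<forall>y<n. (0 < nats u ''ownd'' y 0 \<longleftrightarrow> 0 < nats t ''ownd'' y 0 \<or> y < j \<and> d a y \<le> r) \<and>
        nats u ''own'' y 0 = (if nats t ''ownd'' y 0 = 0 \<and> y < j \<and> d a y \<le> r then a else nats t ''own'' y 0))"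
        for j and u :: store
      have "J n (ev net_mark t1)"
        unfolding net_mark_def
      proof (rule For_inv)
        let ?q = "whn (And (zer (narr ''ownd'' ''y'')) (rle (rmat ''dist'' ''x'' ''y'') (rvar ''R'')))
          (aset ''own'' ''y'' (nvar ''x'') ;; aset ''ownd'' ''y'' N1)"
        fix j u assume j: "j < n" "J j u" "nats u ''y'' 0 0 = j" and fr: "frame (insert ''y'' (nw ?q)) (rw ?q) t1 u"
        have u: "input u" "nats u ''x'' 0 0 = a" "reals u ''R'' 0 0 = r"
          using input_frame[OF fr t1(1)] frame_nats[OF fr] frame_reals[OF fr] t1 by simp_all
        have dist: "reals u ''dist'' a j = d a j" using u(1) a(1) j(1) by (simp add: input_def)
        have Jj: "0 < nats u ''ownd'' j 0 \<longleftrightarrow> 0 < nats t ''ownd'' j 0" using j(1,2) unfolding J_def by simp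
        show "J (Suc j) (ev ?q u)"
        proof (cases "nats t ''ownd'' j 0 = 0 \<and> d a j \<le> r")
          case True
          then have "nats (ev ?q u) ''ownd'' y 0 = (if y = j then 1 else nats u ''ownd'' y 0)"
            "nats (ev ?q u) ''own'' y 0 = (if y = j then a else nats u ''own'' y 0)" for y
            using Jj dist u j(3) by auto
          then show ?thesis using j(2) True unfolding J_def by (auto simp: less_Suc_eq)
        next
          case False
          then have "ev ?q u = u" using Jj dist u j(3) by auto
          then show ?thesis using j(2) False unfolding J_def by (auto simp: less_Suc_eq)
        qed
      qed (use t1 in \<open>auto simp: J_def input_def\<close>)
      then have od: "0 < nats (ev p t) ''ownd'' y 0 \<longleftrightarrow> 0 < nats t ''ownd'' y 0 \<or> d a y \<le> r"
        and ow: "nats (ev p t) ''own'' y 0 = (if nats t ''ownd'' y 0 = 0 \<and> d a y \<le> r then a else nats t ''own'' y 0)"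
        if "y < n" for y using that unfolding J_def ev_p by auto
      have ne: "nats (ev p t) ''net'' x 0 = (if x = a then 1 else nats t ''net'' x 0)" for x
        by (simp add: ev_p nats_ev t1)
      have I: "\<And>y. y < n \<Longrightarrow> 0 < nats t ''ownd'' y 0 \<Longrightarrow> 0 < nats t ''net'' (nats t ''own'' y 0) 0 \<and> d (nats t ''own'' y 0) y \<le> r"
        "\<And>y. y < a \<Longrightarrow> 0 < nats t ''ownd'' y 0"
        "\<And>x. 0 < nats t ''net'' x 0 \<Longrightarrow> x < a" "\<And>x y. 0 < nats t ''net'' x 0 \<Longrightarrow> y < n \<Longrightarrow> d x y \<le> r \<Longrightarrow> 0 < nats t ''ownd'' y 0"
        "\<And>x x'. 0 < nats t ''net'' x 0 \<Longrightarrow> 0 < nats t ''net'' x' 0 \<Longrightarrow> x < x' \<Longrightarrow> r < d x x'"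
        using a(2) unfolding Inv_def by blast+
      show ?thesis
        unfolding Inv_def
      proof (intro conjI allI impI)
        fix y assume "y < n" "0 < nats (ev p t) ''ownd'' y 0"
        then show "0 < nats (ev p t) ''net'' (nats (ev p t) ''own'' y 0) 0" "d (nats (ev p t) ''own'' y 0) y \<le> r"
          using I(1)[of y] by (auto simp: od ow ne)
      next
        fix y assume "y < Suc a"
        then show "0 < nats (ev p t) ''ownd'' y 0"
          using I(2)[of y] a(1) od[of y] zero[of a a] assms(3) by (auto simp: less_Suc_eq)
      next
        fix x assume x: "0 < nats (ev p t) ''net'' x 0"
        then show "x < Suc a" using I(3)[of x] by (auto simp: ne split: if_split_asm)
        fix y assume "y < n" "d x y \<le> r"
        then show "0 < nats (ev p t) ''ownd'' y 0" using x I(4)[of x y] by (auto simp: od ne split: if_split_asm)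
      next
        fix x x' assume x: "0 < nats (ev p t) ''net'' x 0" "0 < nats (ev p t) ''net'' x' 0" "x < x'"
        show "r < d x x'"
        proof (cases "x' = a")
          case True
          then have "0 < nats t ''net'' x 0" using x by (simp add: ne)
          then show ?thesis using I(4)[of x a] False True a(1) by force
        next
          case F: False
          then have "0 < nats t ''net'' x' 0" using x(2) by (simp add: ne)
          moreover have "0 < nats t ''net'' x 0" using x I(3)[OF calculation] by (simp add: ne split: if_split_asm)
          ultimately show ?thesis using I(5) x(3) by blast
        qed
      qed
    qed
  qed (use assms in \<open>auto simp: Inv_def input_def\<close>)
  then have I: "Inv n (ev net_prog s)" .
  show "own y \<in> net \<and> d (own y) y \<le> r" if "y < n" for y
    using I that unfolding Inv_def own_def net_def by blast
  show "r < d x x'" if "x \<in> net" "x' \<in> net" "x \<noteq> x'" for x x'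
    using I that commute[of x x'] unfolding Inv_def net_def by (metis linorder_neqE_nat mem_Collect_eq)
  show "net \<subseteq> {..<n}" using I unfolding Inv_def net_def by blast
qed

text \<open>The state after \<open>l\<close> colour classes. The second clause is properness; the
  others say that every smaller colour is blocked by a nearby point, for coloured points and, up to
  \<open>l\<close>, for those still waiting.\<close>

definition coloring :: "real \<Rightarrow> nat set \<Rightarrow> nat \<Rightarrow> store \<Rightarrow> bool" where
  "coloring r N l t \<longleftrightarrow>
    (\<forall>y. 0 < nats t ''rkd'' y 0 \<longrightarrow> y \<in> N \<and>
       (\<forall>l'<nats t ''col'' y 0. \<exists>z. 0 < nats t ''rkd'' z 0 \<and> nats t ''col'' z 0 = l' \<and> d y z \<le> 4 * r)) \<and>
    (\<forall>y z. 0 < nats t ''rkd'' y 0 \<longrightarrow> 0 < nats t ''rkd'' z 0 \<longrightarrow> nats t ''col'' y 0 = nats t ''col'' z 0 \<longrightarrow>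
       y \<noteq> z \<longrightarrow> 4 * r < d y z) \<and>
    (\<forall>y\<in>N. nats t ''rkd'' y 0 = 0 \<longrightarrow>
       (\<forall>l'<l. \<exists>z. 0 < nats t ''rkd'' z 0 \<and> nats t ''col'' z 0 = l' \<and> d y z \<le> 4 * r))"

lemma color_flag_correct:
  assumes "input s" "reals s ''R'' 0 0 = r" "nats s ''y'' 0 0 = y" "y < n" "nats s ''l'' 0 0 = l"
  shows "0 < nats (ev color_flag s) ''flag'' 0 0 \<longleftrightarrow>
    (\<exists>z<n. 0 < nats s ''rkd'' z 0 \<and> nats s ''col'' z 0 = l \<and> d y z \<le> 4 * r)"
proof -
  define Inv where "Inv a t \<longleftrightarrow> (0 < nats t ''flag'' 0 0 \<longleftrightarrow>
    (\<exists>z<a. 0 < nats s ''rkd'' z 0 \<and> nats s ''col'' z 0 = l \<and> d y z \<le> 4 * r))" for a and t :: store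
  define g where "g = And (And (pos (narr ''rkd'' ''z'')) (neq (narr ''col'' ''z'') (nvar ''l'')))
       (rle (rmat ''dist'' ''y'' ''z'') (RAdd (RAdd (rvar ''R'') (rvar ''R'')) (RAdd (rvar ''R'') (rvar ''R''))))"
  define s1 where "s1 = ev (nset ''flag'' N0) s"
  have s1: "input s1" using assms(1) by (simp add: s1_def input_def)
  have "Inv n (ev color_flag s)"
    unfolding color_flag_def g_def[symmetric] ev.simps(4) s1_def[symmetric]
  proof (rule For_inv)
    let ?p = "whn g (nset ''flag'' N1)"
    fix a t assume a: "a < n" "Inv a t" "nats t ''z'' 0 0 = a" and fr: "frame (insert ''z'' (nw ?p)) (rw ?p) s1 t"
    have t: "input t" "reals t ''R'' 0 0 = r" "nats t ''y'' 0 0 = y" "nats t ''l'' 0 0 = l"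
      "nats t ''rkd'' = nats s ''rkd''" "nats t ''col'' = nats s ''col''"
      using input_frame[OF fr s1] frame_nats[OF fr] frame_reals[OF fr] assms by (simp_all add: s1_def)
    have "bval g t \<longleftrightarrow> 0 < nats s ''rkd'' a 0 \<and> nats s ''col'' a 0 = l \<and> d y a \<le> 4 * r"
      using t a assms(4) by (auto simp: g_def input_def)
    then show "Inv (Suc a) (ev ?p t)" using a(2) by (auto simp: Inv_def less_Suc_eq)
  qed (use s1 in \<open>auto simp: Inv_def input_def s1_def\<close>)
  then show ?thesis by (simp add: Inv_def)
qed

lemma color_correct:
  assumes "input s" "reals s ''R'' 0 0 = r" "0 \<le> r" and net: "\<forall>y<n. 0 < nats s ''net'' y 0 \<longleftrightarrow> y \<in> N" "N \<subseteq> {..<n}"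
    and "\<forall>y. nats s ''rkd'' y 0 = 0"
  shows "coloring r N n (ev color_prog s)"
proof (unfold color_prog_def, rule For_inv)
  let ?p = "For ''y'' nN color_step"
  fix l t assume l: "l < n" "coloring r N l t" "nats t ''l'' 0 0 = l" and fr: "frame (insert ''l'' (nw ?p)) (rw ?p) s t"
  have t: "input t" "reals t ''R'' 0 0 = r" "nats t ''net'' = nats s ''net''"
    using input_frame[OF fr assms(1)] frame_nats[OF fr] frame_reals[OF fr] assms by simp_all
  define Inv where "Inv b u \<longleftrightarrow> coloring r N l u \<and> (\<forall>y\<in>N. y < b \<longrightarrow> nats u ''rkd'' y 0 = 0 \<longrightarrow>
    (\<exists>z. 0 < nats u ''rkd'' z 0 \<and> nats u ''col'' z 0 = l \<and> d y z \<le> 4 * r))" for b and u :: store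
  have "Inv n (ev ?p t)"
  proof (rule For_inv)
    fix b u assume b: "b < n" "Inv b u" "nats u ''y'' 0 0 = b" and fr: "frame (insert ''y'' (nw color_step)) (rw color_step) t u"
    have u: "input u" "reals u ''R'' 0 0 = r" "nats u ''net'' = nats s ''net''" "nats u ''l'' 0 0 = l"
      using input_frame[OF fr t(1)] frame_nats[OF fr] frame_reals[OF fr] t l(3) by simp_all
    define u1 where "u1 = ev color_flag u"
    have u1: "nats u1 ''rkd'' = nats u ''rkd''" "nats u1 ''col'' = nats u ''col''" "nats u1 ''net'' = nats s ''net''"
      "nats u1 ''y'' 0 0 = b" "nats u1 ''l'' 0 0 = l"
      using b u by (simp_all add: u1_def nats_ev)
    have N: "z < n" if "0 < nats u ''rkd'' z 0" for z
      using b(2) that assms(5) unfolding Inv_def coloring_def by blast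
    have flag: "nats u1 ''flag'' 0 0 = 0 \<longleftrightarrow> \<not> (\<exists>z. 0 < nats u ''rkd'' z 0 \<and> nats u ''col'' z 0 = l \<and> d b z \<le> 4 * r)"
      using color_flag_correct[OF u(1,2) b(3,1) u(4)] N unfolding u1_def[symmetric] by auto
    let ?c = "nats u1 ''flag'' 0 0 = 0 \<and> b \<in> N \<and> nats u ''rkd'' b 0 = 0"
    have e: "ev color_step u = (if ?c then ev (aset ''rkd'' ''y'' N1 ;; aset ''col'' ''y'' (nvar ''l'')) u1 else u1)"
      using u1 net b(1) unfolding color_step_def ev.simps(4,5) u1_def[symmetric] by simp
    show "Inv (Suc b) (ev color_step u)"
    proof (cases ?c)
      case False
      then have e': "ev color_step u = u1" unfolding e by (rule if_not_P)
      have "coloring r N l u1" using b(2) by (simp add: Inv_def coloring_def u1)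
      moreover have "\<exists>z. 0 < nats u ''rkd'' z 0 \<and> nats u ''col'' z 0 = l \<and> d y z \<le> 4 * r"
        if "y \<in> N" "y < Suc b" "nats u ''rkd'' y 0 = 0" for y
      proof (cases "y = b")
        case True
        then show ?thesis using False flag that by blast
      next
        case False
        then have "y < b" using that by simp
        then show ?thesis using b(2) that unfolding Inv_def by blast
      qed
      ultimately show ?thesis unfolding Inv_def e' u1(1,2) by blast
    next
      case True
      then have e': "ev color_step u = ev (aset ''rkd'' ''y'' N1 ;; aset ''col'' ''y'' (nvar ''l'')) u1"
        unfolding e by (rule if_P)
      define rk where "rk y = nats u ''rkd'' y 0" for y
      define co where "co y = nats u ''col'' y 0" for y
      have rk': "nats (ev color_step u) ''rkd'' y 0 = (if y = b then 1 else rk y)" for y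
        unfolding e' rk_def using u1 by simp
      have co': "nats (ev color_step u) ''col'' y 0 = (if y = b then l else co y)" for y
        unfolding e' co_def using u1 by simp
      have I: "\<And>y. 0 < rk y \<Longrightarrow> y \<in> N" "\<And>y l'. 0 < rk y \<Longrightarrow> l' < co y \<Longrightarrow> \<exists>z. 0 < rk z \<and> co z = l' \<and> d y z \<le> 4 * r"
        "\<And>y z. 0 < rk y \<Longrightarrow> 0 < rk z \<Longrightarrow> co y = co z \<Longrightarrow> y \<noteq> z \<Longrightarrow> 4 * r < d y z"
        "\<And>y l'. y \<in> N \<Longrightarrow> rk y = 0 \<Longrightarrow> l' < l \<Longrightarrow> \<exists>z. 0 < rk z \<and> co z = l' \<and> d y z \<le> 4 * r"
        "\<And>y. y \<in> N \<Longrightarrow> y < b \<Longrightarrow> rk y = 0 \<Longrightarrow> \<exists>z. 0 < rk z \<and> co z = l \<and> d y z \<le> 4 * r"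
        using b(2) unfolding Inv_def coloring_def rk_def co_def by blast+
      have c: "b \<in> N" "rk b = 0" "\<And>z. 0 < rk z \<Longrightarrow> co z = l \<Longrightarrow> 4 * r < d b z"
        using True flag unfolding rk_def co_def by (auto simp: not_le)
      define rk2 where "rk2 y = (if y = b then 1 else rk y)" for y
      define co2 where "co2 y = (if y = b then l else co y)" for y
      have ex: "\<exists>z. 0 < rk2 z \<and> co2 z = l' \<and> d y z \<le> 4 * r" if "\<exists>z. 0 < rk z \<and> co z = l' \<and> d y z \<le> 4 * r" for y l'
        using that c(2) unfolding rk2_def co2_def by (metis less_irrefl)
      show ?thesis
        unfolding Inv_def coloring_def rk' co' rk2_def[symmetric] co2_def[symmetric]
      proof (intro conjI allI impI ballI)
        fix y assume y: "0 < rk2 y"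
        show "y \<in> N" using y I(1)[of y] c by (auto simp: rk2_def split: if_split_asm)
        fix l' assume "l' < co2 y"
        then have "\<exists>z. 0 < rk z \<and> co z = l' \<and> d y z \<le> 4 * r"
          using y I(2)[of y l'] I(4)[of b l'] c by (auto simp: rk2_def co2_def split: if_split_asm)
        then show "\<exists>z. 0 < rk2 z \<and> co2 z = l' \<and> d y z \<le> 4 * r" by (rule ex)
      next
        fix y z assume "0 < rk2 y" "0 < rk2 z" "co2 y = co2 z" "y \<noteq> z"
        then show "4 * r < d y z"
          using I(3)[of y z] c(3)[of y] c(3)[of z] commute[of y b] by (auto simp: rk2_def co2_def split: if_split_asm)
      next
        fix y l' assume "y \<in> N" "rk2 y = 0" "l' < l"
        then have "rk y = 0" by (simp add: rk2_def split: if_split_asm)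
        then show "\<exists>z. 0 < rk2 z \<and> co2 z = l' \<and> d y z \<le> 4 * r"
          using ex[OF I(4)] \<open>y \<in> N\<close> \<open>l' < l\<close> by blast
      next
        fix y assume "y \<in> N" "y < Suc b" "rk2 y = 0"
        then have "rk y = 0" "y < b" by (auto simp: rk2_def less_Suc_eq split: if_split_asm)
        then show "\<exists>z. 0 < rk2 z \<and> co2 z = l \<and> d y z \<le> 4 * r"
          using ex[OF I(5)] \<open>y \<in> N\<close> by blast
      qed
    qed
  qed (use t l(2) in \<open>auto simp: Inv_def input_def coloring_def\<close>)
  then show "coloring r N (Suc l) (ev ?p t)"
    using assms(5) unfolding Inv_def coloring_def less_Suc_eq by blast
qed (use assms in \<open>auto simp: coloring_def input_def\<close>)

section \<open>Covering and packing in doubling metrics\<close>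

lemma doubling_cover:
  assumes "x < n" "0 < \<rho>"
  shows "\<exists>S\<subseteq>{..<n}. finite S \<and> card S \<le> doubling_constant {..<n} d ^ m \<and> mcball x \<rho> \<subseteq> (\<Union>y\<in>S. mcball y (\<rho> / 2 ^ m))"
proof (induction m)
  case 0
  show ?case using assms by (intro exI[of _ "{x}"]) auto
next
  case (Suc m)
  let ?K = "doubling_constant {..<n} d"
  \<comment> \<open>In a finite space \<open>K = n\<close> qualifies, each point being covered by
    the ball around itself; so the \<open>LEAST\<close> in \<open>doubling_constant\<close> is
    attained.\<close>
  have "\<exists>K. \<forall>x\<in>{..<n}. \<forall>\<rho>>0. \<exists>S\<subseteq>{..<n}. finite S \<and> card S \<le> K \<and> mcball x \<rho> \<subseteq> (\<Union>y\<in>S. mcball y (\<rho> / 2))"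
  proof (intro exI[of _ n] ballI allI impI)
    fix x and \<rho> :: real assume "0 < \<rho>"
    then have W: "w \<in> mcball w (\<rho> / 2)" if "w < n" for w using that zero[of w w] by simp
    have "mcball x \<rho> \<subseteq> {..<n}" by auto
    then have "mcball x \<rho> \<subseteq> (\<Union>y\<in>{..<n}. mcball y (\<rho> / 2))" using W by blast
    then show "\<exists>S\<subseteq>{..<n}. finite S \<and> card S \<le> n \<and> mcball x \<rho> \<subseteq> (\<Union>y\<in>S. mcball y (\<rho> / 2))"
      by (intro exI[of _ "{..<n}"]) simp
  qed
  then have K: "\<forall>x\<in>{..<n}. \<forall>\<rho>>0. \<exists>S\<subseteq>{..<n}. finite S \<and> card S \<le> ?K \<and> mcball x \<rho> \<subseteq> (\<Union>y\<in>S. mcball y (\<rho> / 2))"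
    unfolding doubling_constant_def by (rule LeastI_ex)
  obtain S where S: "S \<subseteq> {..<n}" "finite S" "card S \<le> ?K ^ m" "mcball x \<rho> \<subseteq> (\<Union>y\<in>S. mcball y (\<rho> / 2 ^ m))"
    using Suc by blast
  have "\<forall>y\<in>S. \<exists>S'\<subseteq>{..<n}. finite S' \<and> card S' \<le> ?K \<and> mcball y (\<rho> / 2 ^ m) \<subseteq> (\<Union>y\<in>S'. mcball y (\<rho> / 2 ^ m / 2))"
    using K S(1) assms(2) by (metis subsetD zero_less_divide_iff zero_less_numeral zero_less_power)
  then obtain F where F: "\<And>y. y \<in> S \<Longrightarrow> F y \<subseteq> {..<n} \<and> finite (F y) \<and> card (F y) \<le> ?K \<and>
      mcball y (\<rho> / 2 ^ m) \<subseteq> (\<Union>z\<in>F y. mcball z (\<rho> / 2 ^ m / 2))" by metis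
  have "card (\<Union> (F ` S)) \<le> (\<Sum>y\<in>S. card (F y))" by (rule card_UN_le[OF S(2)])
  also have "\<dots> \<le> card S * ?K" using F sum_bounded_above[of S "\<lambda>y. card (F y)" ?K] by simp
  also have "\<dots> \<le> ?K ^ Suc m" using S(3) by (simp add: mult.commute)
  finally have "card (\<Union> (F ` S)) \<le> ?K ^ Suc m" .
  moreover have "mcball x \<rho> \<subseteq> (\<Union>z\<in>\<Union> (F ` S). mcball z (\<rho> / 2 ^ Suc m))"
  proof
    fix w assume "w \<in> mcball x \<rho>"
    then obtain y where "y \<in> S" "w \<in> mcball y (\<rho> / 2 ^ m)" using S(4) by blast
    then obtain z where "z \<in> F y" "w \<in> mcball z (\<rho> / 2 ^ m / 2)" using F by blast
    then show "w \<in> (\<Union>z\<in>\<Union> (F ` S). mcball z (\<rho> / 2 ^ Suc m))" using \<open>y \<in> S\<close> by (auto simp: field_simps)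
  qed
  ultimately show ?case using F S(2) by (intro exI[of _ "\<Union> (F ` S)"]) blast
qed

text \<open>Three halvings lead from radius \<open>4 * r\<close> to \<open>r / 2\<close>, hence the
  exponent 3; a ball of radius \<open>r / 2\<close> contains at most one point of a set whose points
  are more than \<open>r\<close> apart.\<close>

lemma doubling_packing:
  assumes "y < n" "0 < r" "N \<subseteq> {..<n}" and sep: "\<And>x x'. x \<in> N \<Longrightarrow> x' \<in> N \<Longrightarrow> x \<noteq> x' \<Longrightarrow> r < d x x'"
    and near: "\<And>z. z \<in> N \<Longrightarrow> d y z \<le> 4 * r"
  shows "card N \<le> doubling_constant {..<n} d ^ 3"
proof -
  obtain S where S: "S \<subseteq> {..<n}" "finite S" "card S \<le> doubling_constant {..<n} d ^ 3"
    "mcball y (4 * r) \<subseteq> (\<Union>z\<in>S. mcball z (r / 2))"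
    using doubling_cover[OF assms(1), of "4 * r" 3] assms(2) by auto
  have "\<forall>z\<in>N. \<exists>x\<in>S. z \<in> mcball x (r / 2)"
  proof
    fix z assume "z \<in> N"
    then have "z \<in> mcball y (4 * r)" using near[of z] assms(1,3) by auto
    then show "\<exists>x\<in>S. z \<in> mcball x (r / 2)" using S(4) by blast
  qed
  then obtain f where f: "\<And>z. z \<in> N \<Longrightarrow> f z \<in> S \<and> z \<in> mcball (f z) (r / 2)" by metis
  have "inj_on f N"
  proof (rule inj_onI, rule ccontr)
    fix z z' assume z: "z \<in> N" "z' \<in> N" "f z = f z'" "z \<noteq> z'"
    have "d z (f z) \<le> r / 2" "d (f z) z' \<le> r / 2" "z < n" "z' < n" "f z < n"
      using f[OF z(1)] f[OF z(2)] z(3) commute by auto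
    then have "d z z' \<le> r" using triangle[of z "f z" z'] by simp
    then show False using sep[OF z(1,2,4)] by simp
  qed
  then have "card N \<le> card S" using f S(2) by (intro card_inj_on_le[of f]) auto
  then show ?thesis using S(3) by simp
qed

text \<open>Consecutive centres of a chain have owners of equal colour within \<open>4 * r\<close>,
  hence the same owner. A whole chain stays within \<open>r\<close> of one net point, so
  \<open>h = 2 * r\<close>, and \<open>K ^ 3 * (h + 2 * r)\<close> gives the factor 4.\<close>

lemma doubling_ranks:
  assumes "rank_input r s"
  shows "ranks doubling_prog r (4 * 2 ^ (3 * doubling_dim {..<n} d)) s"
proof -
  let ?X = "greedy r n" and ?K = "doubling_constant {..<n} d"
  have s: "input s" "reals s ''R'' 0 0 = r" "0 \<le> r" using assms by (auto simp: rank_input_def)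
  have z: "\<forall>y. nats s ''net'' y 0 = 0" "\<forall>y. nats s ''ownd'' y 0 = 0" "\<forall>y. nats s ''rkd'' y 0 = 0"
    using assms by (simp_all add: rank_input_def)
  define s1 where "s1 = ev net_prog s"
  define s2 where "s2 = ev color_prog s1"
  define s3 where "s3 = ev doubling_prog s"
  define own where "own y = nats s1 ''own'' y 0" for y
  define N where "N = {x. 0 < nats s1 ''net'' x 0}"
  define rk where "rk y = nats s2 ''rkd'' y 0" for y
  define co where "co y = nats s2 ''col'' y 0" for y
  note nc = net_correct[OF s z(1,2), folded s1_def, folded own_def N_def]
  have s1: "input s1" "reals s1 ''R'' 0 0 = r" "\<forall>y. nats s1 ''rkd'' y 0 = 0"
    using s z by (simp_all add: s1_def input_ev reals_ev nats_ev)
  have "\<forall>y<n. 0 < nats s1 ''net'' y 0 \<longleftrightarrow> y \<in> N" by (simp add: N_def)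
  note cc = color_correct[OF s1(1,2) s(3) this nc(3) s1(3), folded s2_def]
  have C: "\<And>y. 0 < rk y \<Longrightarrow> y \<in> N" "\<And>y l'. 0 < rk y \<Longrightarrow> l' < co y \<Longrightarrow> \<exists>z. 0 < rk z \<and> co z = l' \<and> d y z \<le> 4 * r"
    "\<And>y z. 0 < rk y \<Longrightarrow> 0 < rk z \<Longrightarrow> co y = co z \<Longrightarrow> y \<noteq> z \<Longrightarrow> 4 * r < d y z"
    "\<And>y l'. y \<in> N \<Longrightarrow> rk y = 0 \<Longrightarrow> l' < n \<Longrightarrow> \<exists>z. 0 < rk z \<and> co z = l' \<and> d y z \<le> 4 * r"
    using cc unfolding coloring_def rk_def co_def by blast+
  \<comment> \<open>Points that realise \<open>m\<close> different colours and avoid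
    \<open>y\<close> are \<open>m\<close> points other than \<open>y\<close>, so
    \<open>m < n\<close>. This shows both that \<open>n\<close> colour classes leave no net point
    uncoloured and that colours are small enough to be flooded.\<close>
  have count: "m < n" if yN: "y \<in> N" and ex: "\<forall>l'<m. \<exists>z. z \<noteq> y \<and> 0 < rk z \<and> co z = l'" for y m
  proof -
    obtain f where f: "\<And>l'. l' < m \<Longrightarrow> f l' \<noteq> y \<and> 0 < rk (f l') \<and> co (f l') = l'" using ex by metis
    have "inj_on f {..<m}" using f by (intro inj_on_inverseI[of _ co]) auto
    moreover have "f ` {..<m} \<subseteq> {..<n} - {y}" using f C(1) nc(3) by blast
    ultimately have "m \<le> card ({..<n} - {y})" using card_inj_on_le[of f "{..<m}" "{..<n} - {y}"] by simp
    moreover have "y < n" using yN nc(3) by auto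
    ultimately show ?thesis by simp
  qed
  have ranked: "0 < rk y" if "y \<in> N" for y
  proof (rule ccontr)
    assume no: "\<not> 0 < rk y"
    have "\<exists>z. z \<noteq> y \<and> 0 < rk z \<and> co z = l'" if "l' < n" for l'
      using C(4)[OF \<open>y \<in> N\<close> _ that] no by (metis gr0I)
    then show False using count[OF that, of n] by blast
  qed
  have co_n: "co y < n" if "y \<in> N" for y
    using count[OF that, of "co y"] C(2)[OF ranked[OF that]] by (metis less_irrefl)
  have co_K: "co y < ?K ^ 3" if "y \<in> N" for y
  proof -
    have "y < n" using that nc(3) by auto
    have "\<forall>l'<co y. \<exists>z. 0 < rk z \<and> co z = l' \<and> d y z \<le> 4 * r" using C(2)[OF ranked[OF that]] by blast
    then obtain f where f: "\<And>l'. l' < co y \<Longrightarrow> 0 < rk (f l') \<and> co (f l') = l' \<and> d y (f l') \<le> 4 * r" by metis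
    \<comment> \<open>Adding \<open>y\<close> itself as the point of colour \<open>co y\<close>
      gives \<open>co y + 1\<close> net points near \<open>y\<close>, so that the packing bound
      becomes a strict bound on the colour.\<close>
    define g where "g l = (if l = co y then y else f l)" for l
    have g: "g l \<in> N \<and> co (g l) = l \<and> d y (g l) \<le> 4 * r" if "l \<le> co y" for l
      using that f[of l] C(1)[of "f l"] \<open>y \<in> N\<close> zero[of y y] \<open>y < n\<close> s(3) by (auto simp: g_def)
    have "inj_on g {..co y}" using g by (intro inj_on_inverseI[of _ co]) auto
    then have card: "card (g ` {..co y}) = Suc (co y)" by (simp add: card_image)
    have gN: "g ` {..co y} \<subseteq> N" using g by auto
    show ?thesis
    proof (cases "r = 0")
      case False
      have "card (g ` {..co y}) \<le> ?K ^ 3"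
        by (rule doubling_packing[of y r]) (use gN g nc(2,3) s(3) False \<open>y < n\<close> in \<open>auto 0 3\<close>)
      then show ?thesis using card by simp
    next
      \<comment> \<open>Packing speaks about positive radii only. For \<open>r = 0\<close> a
        neighbour coincides with \<open>y\<close>, so the colour of \<open>y\<close> is 0, and
        \<open>K ^ 3 \<ge> 1\<close> because a ball of radius 1 is nonempty.\<close>
      case True
      have "co y = 0"
      proof (rule ccontr)
        assume "co y \<noteq> 0"
        then have "f 0 < n" "d y (f 0) = 0" "co (f 0) = 0"
          using f[of 0] C(1)[of "f 0"] nc(3) nonneg[of y "f 0"] True by auto
        then show False using zero[of y "f 0"] \<open>y < n\<close> \<open>co y \<noteq> 0\<close> by auto
      qed
      obtain S where S: "card S \<le> ?K ^ 3" "finite S" "mcball y 1 \<subseteq> (\<Union>z\<in>S. mcball z (1 / 2 ^ 3))"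
        using doubling_cover[OF \<open>y < n\<close>, of 1 3] by auto
      have "y \<in> mcball y 1" using \<open>y < n\<close> by simp
      then have "S \<noteq> {}" using S(3) by blast
      then have "card S > 0" using S(2) by (simp add: card_gt_0_iff)
      then show ?thesis using \<open>card S \<le> ?K ^ 3\<close> \<open>co y = 0\<close> by linarith
    qed
  qed
  have s2: "input s2" "nats s2 ''own'' = nats s1 ''own''"
    using s1 by (simp_all add: s2_def input_ev nats_ev)
  have rank: "\<forall>x<n. nats s3 ''rank'' x 0 = co (own x)"
    unfolding s3_def doubling_prog_def ev.simps(4) s1_def[symmetric] s2_def[symmetric]
  proof (rule For_inv[where Inv = "\<lambda>a t. \<forall>x<a. nats t ''rank'' x 0 = co (own x)"])
    let ?p = "aset ''rank'' ''x'' (NRead ''col'' (narr ''own'' ''x'') N0)"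
    fix a t assume "\<forall>x<a. nats t ''rank'' x 0 = co (own x)" "nats t ''x'' 0 0 = a"
      and fr: "frame (insert ''x'' (nw ?p)) (rw ?p) s2 t"
    then show "\<forall>x<Suc a. nats (ev ?p t) ''rank'' x 0 = co (own x)"
      using frame_nats[OF fr, of "''own''"] frame_nats[OF fr, of "''col''"] s2(2)
      by (auto simp: less_Suc_eq co_def own_def)
  qed (use s2 in \<open>auto simp: input_def\<close>)
  have X: "?X \<subseteq> {..<n}" by (rule greedy_sub)
  have ok: "rank_ok r ?X (\<lambda>v. nats s3 ''rank'' v 0) (?K ^ 3) (2 * r)"
    unfolding rank_ok_def
  proof (intro conjI ballI impI)
    fix c assume "c \<in> ?X"
    then have "c < n" using X by auto
    then show "nats s3 ''rank'' c 0 < ?K ^ 3" using rank nc(1) co_K by simp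
  next
    fix c c' assume c: "c \<in> ?X" "c' \<in> ?X"
      and ch: "(c, c') \<in> (Restr {(x, y). d x y \<le> 2 * r} {x\<in>?X. nats s3 ''rank'' x 0 = nats s3 ''rank'' c 0})\<^sup>*"
    from ch have "own c' = own c"
    proof (induction rule: rtrancl_induct)
      case (step x y)
      then have "x < n" "y < n" "d x y \<le> 2 * r" "nats s3 ''rank'' x 0 = nats s3 ''rank'' y 0" using X by auto
      then have xy: "x < n" "y < n" "d x y \<le> 2 * r" "co (own x) = co (own y)" using rank by simp_all
      have o: "own x \<in> N" "own y \<in> N" "d (own x) x \<le> r" "d (own y) y \<le> r" using nc(1) xy by auto
      then have on: "own x < n" "own y < n" using nc(3) by auto
      have "d (own x) (own y) \<le> d (own x) x + d x y + d y (own y)"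
        using triangle[of "own x" x "own y"] triangle[of x y "own y"] on xy by simp
      then have "d (own x) (own y) \<le> 4 * r" using o xy commute[of y "own y"] by simp
      then show ?case using C(3)[OF ranked[OF o(1)] ranked[OF o(2)] xy(4)] step.IH by force
    qed simp
    moreover have "c < n" "c' < n" using c X by auto
    ultimately have "d c (own c) \<le> r" "d (own c) c' \<le> r" "own c < n"
      using nc(1)[of c] nc(1)[of c'] nc(3) commute[of c "own c"] by auto
    then show "d c c' \<le> 2 * r" using triangle[of c "own c" c'] \<open>c < n\<close> \<open>c' < n\<close> by simp
  qed
  have "real ?K \<le> 2 ^ doubling_dim {..<n} d"
  proof (cases "?K = 0")
    case False
    have "real ?K = 2 powr (log 2 (real ?K))" using False by simp
    also have "\<dots> \<le> 2 powr real (doubling_dim {..<n} d)"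
      unfolding doubling_dim_def by (intro powr_mono) (auto intro: order_trans[OF le_of_int_ceiling] simp: of_nat_nat_take_bit_eq)
    finally show ?thesis by (simp add: powr_realpow)
  qed simp
  then have "real ?K ^ 3 \<le> (2 ^ doubling_dim {..<n} d) ^ 3" by (intro power_mono) auto
  then have "real (?K ^ 3) \<le> 2 ^ (3 * doubling_dim {..<n} d)" by (simp add: power_mult[symmetric] mult.commute)
  then have "real (?K ^ 3) * (2 * r + 2 * r) \<le> 4 * 2 ^ (3 * doubling_dim {..<n} d) * r"
    using mult_right_mono[of "real (?K ^ 3)" "2 ^ (3 * doubling_dim {..<n} d)" "4 * r"] s(3) by (simp add: algebra_simps)
  moreover have "\<forall>c\<in>?X. nats s3 ''rank'' c 0 \<le> n + nats s ''dim'' 0 0"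
  proof
    fix c assume "c \<in> ?X"
    then have "c < n" using X by auto
    then show "nats s3 ''rank'' c 0 \<le> n + nats s ''dim'' 0 0" using rank nc(1) co_n[of "own c"] by simp
  qed
  ultimately show ?thesis
    using ok s(3) unfolding ranks_def s3_def[symmetric] by (intro exI[of _ "?K ^ 3"] exI[of _ "2 * r"]) auto
qed

end

section \<open>Ranks in general metrics\<close>

definition nbhd_flag :: prog where
  "nbhd_flag = For ''z'' nN (whn (And (pos (narr ''B'' ''z'')) (rle (rmat ''dist'' ''z'' ''y'') (RAdd (rvar ''R'') (rvar ''R''))))
     (aset ''nb'' ''y'' N1))"

definition nbhd_step :: prog where
  "nbhd_step = aset ''nb'' ''y'' N0 ;; whn (pos (narr ''A'' ''y'')) nbhd_flag ;;
     whn (pos (narr ''nb'' ''y'')) (incr ''cn'') ;; whn (pos (narr ''B'' ''y'')) (incr ''cb'')"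

definition nbhd_prog :: prog where
  "nbhd_prog = nset ''cn'' N0 ;; nset ''cb'' N0 ;; For ''y'' nN nbhd_step"

text \<open>The neighbourhood is first collected in \<open>nb\<close> and then copied: adding points
  to \<open>B\<close> during the scan would let one round grow by several hops.\<close>

definition grow_prog :: prog where
  "grow_prog = nbhd_prog ;; whn (NLess (NAdd (nvar ''cb'') (nvar ''cb'')) (nvar ''cn''))
     (For ''y'' nN (aset ''B'' ''y'' (narr ''nb'' ''y'')))"

definition block_step :: prog where
  "block_step = whn (pos (narr ''B'' ''y'')) (aset ''rank'' ''y'' (nvar ''l'') ;; aset ''rkd'' ''y'' N1 ;; aset ''blk'' ''y'' (nvar ''x'')) ;;
     whn (pos (narr ''nb'' ''y'')) (aset ''A'' ''y'' N0)"

text \<open>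
  A ball grows as long as the next hop more than doubles it, hence at most \<open>log 2 k\<close> times.
  It gets the current rank; its remaining neighbourhood, which is no larger than the ball itself, is
  postponed.  So a layer ranks at least half of the unranked centres.
\<close>

definition carve_prog :: prog where
  "carve_prog = For ''y'' nN (aset ''B'' ''y'' N0) ;; aset ''B'' ''x'' N1 ;; For ''t'' nN grow_prog ;; nbhd_prog ;;
     For ''y'' nN block_step"

definition layer_prog :: prog where
  "layer_prog = For ''x'' nN (Cnd (And (pos (narr ''cen'' ''x'')) (zer (narr ''rkd'' ''x''))) (aset ''A'' ''x'' N1) (aset ''A'' ''x'' N0)) ;;
     For ''x'' nN (whn (pos (narr ''A'' ''x'')) carve_prog)"

definition carving_prog :: prog where
  "carving_prog = For ''l'' nN layer_prog"

lemma nw_carving [simp]: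
  "nw nbhd_flag = {''z'', ''nb''}" "rw nbhd_flag = {}"
  "nw nbhd_step = {''z'', ''nb'', ''cn'', ''cb''}" "rw nbhd_step = {}"
  "nw nbhd_prog = {''y'', ''z'', ''nb'', ''cn'', ''cb''}" "rw nbhd_prog = {}"
  "nw grow_prog = {''y'', ''z'', ''nb'', ''cn'', ''cb'', ''B''}" "rw grow_prog = {}"
  "nw block_step = {''rank'', ''rkd'', ''blk'', ''A''}" "rw block_step = {}"
  "nw carve_prog = {''y'', ''z'', ''nb'', ''cn'', ''cb'', ''B'', ''t'', ''rank'', ''rkd'', ''blk'', ''A''}" "rw carve_prog = {}"
  "nw layer_prog = {''x'', ''y'', ''z'', ''nb'', ''cn'', ''cb'', ''B'', ''t'', ''rank'', ''rkd'', ''blk'', ''A''}" "rw layer_prog = {}"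
  by (auto simp: nbhd_flag_def nbhd_step_def nbhd_prog_def grow_prog_def block_step_def carve_prog_def layer_prog_def)

lemma rank_carving_prog: "rank_prog carving_prog"
proof -
  have "wf_prog nbhd_prog" unfolding nbhd_prog_def nbhd_step_def nbhd_flag_def by simp
  then have "wf_prog grow_prog" unfolding grow_prog_def by simp
  moreover have "wf_prog block_step" unfolding block_step_def by simp
  ultimately have "wf_prog carve_prog" using \<open>wf_prog nbhd_prog\<close> unfolding carve_prog_def by simp
  then have "wf_prog layer_prog" unfolding layer_prog_def by simp
  then have "wf_prog carving_prog" unfolding carving_prog_def by simp
  then show ?thesis unfolding rank_prog_def by (simp add: carving_prog_def)
qed

context conn_inst
begin

section \<open>Carving balls out of the active centres\<close>

definition members :: "name \<Rightarrow> store \<Rightarrow> nat set" where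
  "members a t = {y. y < n \<and> 0 < nats t a y 0}"

definition nbhd :: "real \<Rightarrow> nat set \<Rightarrow> nat set \<Rightarrow> nat set" where
  "nbhd r A B = {y\<in>A. \<exists>z\<in>B. d z y \<le> 2 * r}"

definition grow :: "real \<Rightarrow> nat set \<Rightarrow> nat set \<Rightarrow> nat set" where
  "grow r A B = (if 2 * card B < card (nbhd r A B) then nbhd r A B else B)"

lemma nbhd_flag_correct:
  assumes "input s" "reals s ''R'' 0 0 = r" "nats s ''y'' 0 0 = y" "y < n" "nats s ''nb'' y 0 = 0"
  shows "0 < nats (ev nbhd_flag s) ''nb'' y 0 \<longleftrightarrow> (\<exists>z\<in>members ''B'' s. d z y \<le> 2 * r)"
    and "y' \<noteq> y \<Longrightarrow> nats (ev nbhd_flag s) ''nb'' y' 0 = nats s ''nb'' y' 0"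
proof -
  define Inv where "Inv a t \<longleftrightarrow> (0 < nats t ''nb'' y 0 \<longleftrightarrow> (\<exists>z\<in>members ''B'' s. z < a \<and> d z y \<le> 2 * r)) \<and>
    (\<forall>y'. y' \<noteq> y \<longrightarrow> nats t ''nb'' y' 0 = nats s ''nb'' y' 0)" for a and t :: store
  have "Inv n (ev nbhd_flag s)"
    unfolding nbhd_flag_def
  proof (rule For_inv)
    let ?p = "whn (And (pos (narr ''B'' ''z'')) (rle (rmat ''dist'' ''z'' ''y'') (RAdd (rvar ''R'') (rvar ''R''))))
     (aset ''nb'' ''y'' N1)"
    fix a t assume a: "a < n" "Inv a t" "nats t ''z'' 0 0 = a" and fr: "frame (insert ''z'' (nw ?p)) (rw ?p) s t"
    have t: "input t" "nats t ''y'' 0 0 = y" "reals t ''R'' 0 0 = r" "nats t ''B'' = nats s ''B''"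
      using input_frame[OF fr assms(1)] frame_nats[OF fr] frame_reals[OF fr] assms by simp_all
    have "reals t ''dist'' a y = d a y" using t(1) a(1) assms(4) by (simp add: input_def)
    then show "Inv (Suc a) (ev ?p t)"
      using a t unfolding Inv_def members_def by (auto simp: less_Suc_eq)
  qed (use assms in \<open>auto simp: Inv_def input_def\<close>)
  then show "0 < nats (ev nbhd_flag s) ''nb'' y 0 \<longleftrightarrow> (\<exists>z\<in>members ''B'' s. d z y \<le> 2 * r)"
    and "y' \<noteq> y \<Longrightarrow> nats (ev nbhd_flag s) ''nb'' y' 0 = nats s ''nb'' y' 0"
    by (auto simp: Inv_def members_def)
qed

lemma nbhd_prog_correct:
  assumes "input s" "reals s ''R'' 0 0 = r"
  defines "N \<equiv> nbhd r (members ''A'' s) (members ''B'' s)"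
  shows "members ''nb'' (ev nbhd_prog s) = N"
    and "nats (ev nbhd_prog s) ''cn'' 0 0 = card N" "nats (ev nbhd_prog s) ''cb'' 0 0 = card (members ''B'' s)"
proof -
  define B where "B = members ''B'' s"
  define Inv where "Inv b t \<longleftrightarrow> (\<forall>y<b. 0 < nats t ''nb'' y 0 \<longleftrightarrow> y \<in> N) \<and>
    nats t ''cn'' 0 0 = card {y\<in>N. y < b} \<and> nats t ''cb'' 0 0 = card {y\<in>B. y < b}" for b and t :: store
  define s1 where "s1 = ev (nset ''cn'' N0 ;; nset ''cb'' N0) s"
  have s1: "input s1" using assms(1) by (simp add: s1_def input_def)
  have e: "ev nbhd_prog s = ev (For ''y'' nN nbhd_step) s1" unfolding nbhd_prog_def s1_def ev.simps(4) ..
  have "Inv n (ev nbhd_prog s)"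
    unfolding e
  proof (rule For_inv)
    fix b t assume b: "b < n" "Inv b t" "nats t ''y'' 0 0 = b" and fr: "frame (insert ''y'' (nw nbhd_step)) (rw nbhd_step) s1 t"
    have t: "input t" "reals t ''R'' 0 0 = r" "nats t ''A'' = nats s ''A''" "nats t ''B'' = nats s ''B''"
      using input_frame[OF fr s1] frame_nats[OF fr] frame_reals[OF fr] assms by (simp_all add: s1_def)
    define t1 where "t1 = ev (aset ''nb'' ''y'' N0) t"
    define t2 where "t2 = ev (whn (pos (narr ''A'' ''y'')) nbhd_flag) t1"
    have t1: "input t1" "reals t1 ''R'' 0 0 = r" "nats t1 ''y'' 0 0 = b" "nats t1 ''nb'' b 0 = 0"
      "nats t1 ''A'' = nats s ''A''" "nats t1 ''B'' = nats s ''B''" "\<forall>y. y \<noteq> b \<longrightarrow> nats t1 ''nb'' y 0 = nats t ''nb'' y 0"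
      "nats t1 ''cn'' = nats t ''cn''" "nats t1 ''cb'' = nats t ''cb''"
      using t b by (auto simp: t1_def input_def)
    have mB: "members ''B'' t1 = B" by (simp add: members_def B_def t1)
    have t2: "0 < nats t2 ''nb'' b 0 \<longleftrightarrow> b \<in> N" "\<forall>y. y \<noteq> b \<longrightarrow> nats t2 ''nb'' y 0 = nats t ''nb'' y 0"
      using nbhd_flag_correct[OF t1(1,2,3) b(1) t1(4)] t1 b(1)
      unfolding t2_def N_def nbhd_def mB B_def[symmetric] by (auto simp: members_def)
    have t2': "nats t2 ''y'' 0 0 = b" "nats t2 ''B'' = nats s ''B''" "nats t2 ''cn'' = nats t ''cn''" "nats t2 ''cb'' = nats t ''cb''"
      using t1 by (simp_all add: t2_def nats_ev)
    have e: "ev nbhd_step t = ev (whn (pos (narr ''nb'' ''y'')) (incr ''cn'') ;; whn (pos (narr ''B'' ''y'')) (incr ''cb'')) t2"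
      unfolding nbhd_step_def t2_def t1_def ev.simps(4) ..
    have bB: "0 < nats s ''B'' b 0 \<longleftrightarrow> b \<in> B" using b(1) by (simp add: B_def members_def)
    have "nats (ev nbhd_step t) ''nb'' = nats t2 ''nb''"
      "nats (ev nbhd_step t) ''cn'' 0 0 = (if b \<in> N then Suc (nats t ''cn'' 0 0) else nats t ''cn'' 0 0)"
      "nats (ev nbhd_step t) ''cb'' 0 0 = (if b \<in> B then Suc (nats t ''cb'' 0 0) else nats t ''cb'' 0 0)"
      unfolding e using t2 t2' bB by auto
    then show "Inv (Suc b) (ev nbhd_step t)"
      using b(2) t2 card_less_Suc[of N b] card_less_Suc[of B b] unfolding Inv_def by (auto simp: less_Suc_eq)
  qed (use s1 in \<open>auto simp: Inv_def input_def s1_def\<close>)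
  moreover have "{y\<in>N. y < n} = N" "{y\<in>B. y < n} = B" by (auto simp: N_def nbhd_def B_def members_def)
  ultimately show "members ''nb'' (ev nbhd_prog s) = N"
    and "nats (ev nbhd_prog s) ''cn'' 0 0 = card N" "nats (ev nbhd_prog s) ''cb'' 0 0 = card (members ''B'' s)"
    by (auto simp: Inv_def members_def B_def N_def nbhd_def)
qed

lemma grow_prog_correct:
  assumes "input s" "reals s ''R'' 0 0 = r"
  shows "members ''B'' (ev grow_prog s) = grow r (members ''A'' s) (members ''B'' s)"
proof -
  note nb = nbhd_prog_correct[OF assms]
  define s1 where "s1 = ev nbhd_prog s"
  have s1: "input s1" "nats s1 ''B'' = nats s ''B''" using assms by (simp_all add: s1_def input_ev nats_ev)
  let ?p = "aset ''B'' ''y'' (narr ''nb'' ''y'')"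
  have copy: "members ''B'' (ev (For ''y'' nN ?p) s1) = members ''nb'' s1"
  proof -
    have "\<forall>y<n. nats (ev (For ''y'' nN ?p) s1) ''B'' y 0 = nats s1 ''nb'' y 0"
    proof (rule For_inv[where Inv = "\<lambda>b t. \<forall>y<b. nats t ''B'' y 0 = nats s1 ''nb'' y 0"])
      fix b t assume "\<forall>y<b. nats t ''B'' y 0 = nats s1 ''nb'' y 0" "nats t ''y'' 0 0 = b"
        and fr: "frame (insert ''y'' (nw ?p)) (rw ?p) s1 t"
      then show "\<forall>y<Suc b. nats (ev ?p t) ''B'' y 0 = nats s1 ''nb'' y 0"
        using frame_nats[OF fr, of "''nb''"] by (auto simp: less_Suc_eq)
    qed (use s1 in \<open>auto simp: input_def\<close>)
    then show ?thesis by (auto simp: members_def)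
  qed
  have "members ''B'' s1 = members ''B'' s" by (simp add: members_def s1)
  then show ?thesis
    using nb copy unfolding grow_prog_def grow_def ev.simps(4,5) s1_def[symmetric] by simp
qed

lemma nbhd_sub: "nbhd r A B \<subseteq> A"
  by (auto simp: nbhd_def)

lemma sub_nbhd: "B \<subseteq> A \<Longrightarrow> A \<subseteq> {..<n} \<Longrightarrow> 0 \<le> r \<Longrightarrow> B \<subseteq> nbhd r A B"
  using zero unfolding nbhd_def by force

text \<open>A round either more than doubles the set or leaves it fixed for good. The number
  \<open>j\<close> counts the doublings; each of them adds one hop, of length at most
  \<open>2 * r\<close>, to the distance from \<open>x\<close>.\<close>

lemma grow_iterate:
  assumes "x \<in> A" "A \<subseteq> {..<n}" "0 \<le> r"
  defines "B \<equiv> \<lambda>m. (grow r A ^^ m) {x}"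
  shows "B m \<subseteq> A" "x \<in> B m" "2 ^ m \<le> card (B m) \<or> card (nbhd r A (B m)) \<le> 2 * card (B m)"
    and "\<exists>j. 2 ^ j \<le> card (B m) \<and> (\<forall>y\<in>B m. d x y \<le> 2 * r * real j)"
proof -
  have fin: "finite A" using assms(2) finite_subset by blast
  have "B m \<subseteq> A \<and> x \<in> B m \<and> (2 ^ m \<le> card (B m) \<or> card (nbhd r A (B m)) \<le> 2 * card (B m)) \<and>
    (\<exists>j. 2 ^ j \<le> card (B m) \<and> (\<forall>y\<in>B m. d x y \<le> 2 * r * real j))"
  proof (induction m)
    case 0
    have "d x x = 0" using assms zero[of x x] by auto
    then show ?case using assms by (auto simp: B_def intro!: exI[of _ 0])
  next
    case (Suc m)
    have S: "B (Suc m) = grow r A (B m)" by (simp add: B_def)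
    show ?case
    proof (cases "2 * card (B m) < card (nbhd r A (B m))")
      case False
      then have "B (Suc m) = B m" by (simp add: S grow_def)
      then show ?thesis using Suc False by auto
    next
      case True
      then have e: "B (Suc m) = nbhd r A (B m)" by (simp add: S grow_def)
      obtain j where j: "2 ^ j \<le> card (B m)" "\<And>y. y \<in> B m \<Longrightarrow> d x y \<le> 2 * r * real j" using Suc by blast
      have "d x y \<le> 2 * r * real (Suc j)" if y: "y \<in> nbhd r A (B m)" for y
      proof -
        obtain z where z: "z \<in> B m" "d z y \<le> 2 * r" "y \<in> A" using y by (auto simp: nbhd_def)
        have "x < n" "y < n" "z < n" using z Suc assms by auto
        then have "d x y \<le> d x z + d z y" using triangle by simp
        then show ?thesis using j(2)[OF z(1)] z(2) by (simp add: algebra_simps)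
      qed
      moreover have "2 ^ Suc j \<le> card (B (Suc m))" using True j(1) e by simp
      moreover have "2 ^ Suc m \<le> card (B (Suc m))" using True Suc e by auto
      moreover have "x \<in> B (Suc m)" "B (Suc m) \<subseteq> A"
        using Suc sub_nbhd[of "B m" A r] nbhd_sub[of r A "B m"] assms e by auto
      ultimately show ?thesis unfolding e by blast
    qed
  qed
  then show "B m \<subseteq> A" "x \<in> B m" "2 ^ m \<le> card (B m) \<or> card (nbhd r A (B m)) \<le> 2 * card (B m)"
    and "\<exists>j. 2 ^ j \<le> card (B m) \<and> (\<forall>y\<in>B m. d x y \<le> 2 * r * real j)" by auto
qed

lemma carve_prog_correct:
  assumes "input s" "reals s ''R'' 0 0 = r" "0 \<le> r" "nats s ''x'' 0 0 = x" "nats s ''l'' 0 0 = l" and A: "A = members ''A'' s" "x \<in> A"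
  shows "\<exists>B. x \<in> B \<and> B \<subseteq> A \<and> card (nbhd r A B) \<le> 2 * card B \<and>
    (\<exists>j. 2 ^ j \<le> card B \<and> (\<forall>y\<in>B. d x y \<le> 2 * r * real j)) \<and>
    members ''A'' (ev carve_prog s) = A - nbhd r A B \<and>
    (\<forall>y<n. nats (ev carve_prog s) ''rkd'' y 0 = (if y \<in> B then 1 else nats s ''rkd'' y 0) \<and>
      nats (ev carve_prog s) ''rank'' y 0 = (if y \<in> B then l else nats s ''rank'' y 0) \<and>
      nats (ev carve_prog s) ''blk'' y 0 = (if y \<in> B then x else nats s ''blk'' y 0))"
proof -
  have "A \<subseteq> {..<n}" by (auto simp: A members_def)
  then have "x < n" using A by auto
  define s1 where "s1 = ev (For ''y'' nN (aset ''B'' ''y'' N0)) s"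
  define s2 where "s2 = ev (aset ''B'' ''x'' N1) s1"
  define s3 where "s3 = ev (For ''t'' nN grow_prog) s2"
  define s4 where "s4 = ev nbhd_prog s3"
  have e: "ev carve_prog s = ev (For ''y'' nN block_step) s4"
    unfolding carve_prog_def s4_def s3_def s2_def s1_def ev.simps(4) ..
  have s1: "input s1" "nats s1 ''x'' 0 0 = x" using assms by (simp_all add: s1_def input_ev nats_ev)
  have "\<forall>y<n. nats s1 ''B'' y 0 = 0"
    unfolding s1_def by (rule For_inv[where Inv = "\<lambda>j u. (\<forall>w<j. nats u ''B'' w 0 = 0)"])
      (use assms(1) in \<open>auto simp: input_def less_Suc_eq\<close>)
  then have B2: "members ''B'' s2 = {x}" using s1 \<open>x < n\<close> by (auto simp: members_def s2_def)
  have s2: "input s2" using s1 by (simp add: s2_def input_def)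
  have same: "nats s3 y = nats s y" if "y \<notin> {''y'', ''z'', ''nb'', ''cn'', ''cb'', ''B'', ''t''}" for y
    using that by (simp add: s3_def s2_def s1_def nats_ev)
  have B3: "members ''B'' s3 = (grow r A ^^ n) {x}"
    unfolding s3_def
  proof (rule For_inv[where Inv = "\<lambda>m t. members ''B'' t = (grow r A ^^ m) {x}"])
    fix m t assume m: "members ''B'' t = (grow r A ^^ m) {x}" and fr: "frame (insert ''t'' (nw grow_prog)) (rw grow_prog) s2 t"
    have t: "input t" "reals t ''R'' 0 0 = r" "nats t ''A'' = nats s ''A''"
      using input_frame[OF fr s2] frame_nats[OF fr] frame_reals[OF fr] assms
      by (simp_all add: s2_def s1_def nats_ev reals_ev)
    then have "members ''A'' t = A" by (simp add: members_def A)
    then show "members ''B'' (ev grow_prog t) = (grow r A ^^ Suc m) {x}" using grow_prog_correct[OF t(1,2)] m by simp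
  qed (use s2 B2 in \<open>auto simp: input_def members_def\<close>)
  have s3: "input s3" "reals s3 ''R'' 0 0 = r" "members ''A'' s3 = A"
    using s2 assms same by (simp_all add: s3_def input_ev reals_ev s2_def s1_def A members_def)
  define B where "B = (grow r A ^^ n) {x}"
  note gi = grow_iterate[OF A(2) \<open>A \<subseteq> {..<n}\<close> \<open>0 \<le> r\<close>, of n, folded B_def]
  have "B \<subseteq> {..<n}" using gi(1) \<open>A \<subseteq> {..<n}\<close> by (rule subset_trans)
  then have "card B \<le> n" using card_mono[of "{..<n}" B] by simp
  \<comment> \<open>Doubling in all \<open>n\<close> rounds would exceed the number of points, so
    growth has stopped and the neighbourhood is at most twice the ball.\<close>
  then have "\<not> 2 ^ n \<le> card B" using less_exp[of n] by linarith
  then have half: "card (nbhd r A B) \<le> 2 * card B" using gi(3) by simp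
  have nb4: "members ''nb'' s4 = nbhd r A B" using nbhd_prog_correct(1)[OF s3(1,2)] s3(3) B3 by (simp add: s4_def B_def)
  have B4: "members ''B'' s4 = B" using B3 by (simp add: s4_def B_def nats_ev members_def)
  have s4: "input s4" using s3 by (simp add: s4_def input_ev)
  have same4: "nats s4 y = nats s y" if "y \<notin> {''y'', ''z'', ''nb'', ''cn'', ''cb'', ''B'', ''t''}" for y
    using that same[OF that] by (simp add: s4_def nats_ev)
  define Inv where "Inv a t \<longleftrightarrow> (\<forall>y<n. (0 < nats t ''A'' y 0 \<longleftrightarrow> 0 < nats s ''A'' y 0 \<and> \<not> (y < a \<and> y \<in> nbhd r A B)) \<and>
      nats t ''rkd'' y 0 = (if y < a \<and> y \<in> B then 1 else nats s ''rkd'' y 0) \<and>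
      nats t ''rank'' y 0 = (if y < a \<and> y \<in> B then l else nats s ''rank'' y 0) \<and>
      nats t ''blk'' y 0 = (if y < a \<and> y \<in> B then x else nats s ''blk'' y 0))" for a and t :: store
  have "Inv n (ev carve_prog s)"
    unfolding e
  proof (rule For_inv)
    fix a t assume a: "a < n" "Inv a t" "nats t ''y'' 0 0 = a" and fr: "frame (insert ''y'' (nw block_step)) (rw block_step) s4 t"
    have t: "nats t ''l'' 0 0 = l" "nats t ''x'' 0 0 = x" "nats t ''B'' = nats s4 ''B''" "nats t ''nb'' = nats s4 ''nb''"
      using frame_nats[OF fr] assms same4 by simp_all
    have c: "0 < nats t ''B'' a 0 \<longleftrightarrow> a \<in> B" "0 < nats t ''nb'' a 0 \<longleftrightarrow> a \<in> nbhd r A B"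
    proof -
      have "0 < nats t ''B'' a 0 \<longleftrightarrow> a \<in> members ''B'' s4" "0 < nats t ''nb'' a 0 \<longleftrightarrow> a \<in> members ''nb'' s4"
        using a(1) t by (simp_all add: members_def)
      then show "0 < nats t ''B'' a 0 \<longleftrightarrow> a \<in> B" "0 < nats t ''nb'' a 0 \<longleftrightarrow> a \<in> nbhd r A B"
        unfolding B4 nb4 .
    qed
    let ?t = "ev block_step t"
    have u: "nats ?t ''A'' y 0 = (if y = a \<and> a \<in> nbhd r A B then 0 else nats t ''A'' y 0)"
      "nats ?t ''rkd'' y 0 = (if y = a \<and> a \<in> B then 1 else nats t ''rkd'' y 0)"
      "nats ?t ''rank'' y 0 = (if y = a \<and> a \<in> B then l else nats t ''rank'' y 0)"
      "nats ?t ''blk'' y 0 = (if y = a \<and> a \<in> B then x else nats t ''blk'' y 0)" for y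
      using a(3) t(1,2) c by (auto simp: block_step_def)
    show "Inv (Suc a) ?t" using a(2) unfolding Inv_def u less_Suc_eq by auto
  qed (use s4 same4 in \<open>auto simp: Inv_def input_def\<close>)
  then have I: "\<forall>y<n. (0 < nats (ev carve_prog s) ''A'' y 0 \<longleftrightarrow> 0 < nats s ''A'' y 0 \<and> y \<notin> nbhd r A B) \<and>
      nats (ev carve_prog s) ''rkd'' y 0 = (if y \<in> B then 1 else nats s ''rkd'' y 0) \<and>
      nats (ev carve_prog s) ''rank'' y 0 = (if y \<in> B then l else nats s ''rank'' y 0) \<and>
      nats (ev carve_prog s) ''blk'' y 0 = (if y \<in> B then x else nats s ''blk'' y 0)"
    unfolding Inv_def by simp
  then have "members ''A'' (ev carve_prog s) = A - nbhd r A B" unfolding A(1) by (auto simp: members_def)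
  then show ?thesis using gi half I by blast
qed

text \<open>\<open>W\<close> collects the carved balls. The active set loses at most twice what
  \<open>W\<close> gains and is empty at the end, which gives the cardinality bound. A ball takes
  its whole neighbourhood out of the active set, so different balls of a layer are more than
  \<open>2 * r\<close> apart and a chain cannot leave its ball, whose name is
  \<open>blk\<close>.\<close>

lemma layer_prog_correct:
  assumes "input s" "reals s ''R'' 0 0 = r" "0 \<le> r" "nats s ''l'' 0 0 = l" and X: "X \<subseteq> {..<n}"
    and cen: "\<forall>v<n. 0 < nats s ''cen'' v 0 \<longleftrightarrow> v \<in> X"
  defines "U \<equiv> {y\<in>X. nats s ''rkd'' y 0 = 0}" and "s' \<equiv> ev layer_prog s"
  shows "\<exists>W\<subseteq>U. card U \<le> 2 * card W \<and>
    (\<forall>y<n. nats s' ''rkd'' y 0 = (if y \<in> W then 1 else nats s ''rkd'' y 0) \<and>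
      nats s' ''rank'' y 0 = (if y \<in> W then l else nats s ''rank'' y 0) \<and>
      (y \<notin> W \<longrightarrow> nats s' ''blk'' y 0 = nats s ''blk'' y 0)) \<and>
    (\<forall>y\<in>W. nats s' ''blk'' y 0 < n \<and> (\<exists>j. 2 ^ j \<le> card X \<and> d (nats s' ''blk'' y 0) y \<le> 2 * r * real j)) \<and>
    (\<forall>y\<in>W. \<forall>z\<in>W. d y z \<le> 2 * r \<longrightarrow> nats s' ''blk'' y 0 = nats s' ''blk'' z 0)"
proof -
  have fX: "finite X" using X finite_subset by blast
  have U: "U \<subseteq> X" "finite U" using fX by (auto simp: U_def)
  let ?i = "Cnd (And (pos (narr ''cen'' ''x'')) (zer (narr ''rkd'' ''x''))) (aset ''A'' ''x'' N1) (aset ''A'' ''x'' N0)"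
  define s1 where "s1 = ev (For ''x'' nN ?i) s"
  have e: "s' = ev (For ''x'' nN (whn (pos (narr ''A'' ''x'')) carve_prog)) s1"
    unfolding s'_def layer_prog_def s1_def ev.simps(4) ..
  have "\<forall>y<n. 0 < nats s1 ''A'' y 0 \<longleftrightarrow> y \<in> U"
    unfolding s1_def
  proof (rule For_inv[where Inv = "\<lambda>a t. \<forall>y<a. 0 < nats t ''A'' y 0 \<longleftrightarrow> y \<in> U"])
    fix a t assume a: "a < n" "\<forall>y<a. 0 < nats t ''A'' y 0 \<longleftrightarrow> y \<in> U" "nats t ''x'' 0 0 = a"
      and fr: "frame (insert ''x'' (nw ?i)) (rw ?i) s t"
    have "nats t ''cen'' = nats s ''cen''" "nats t ''rkd'' = nats s ''rkd''" using frame_nats[OF fr] by simp_all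
    then show "\<forall>y<Suc a. 0 < nats (ev ?i t) ''A'' y 0 \<longleftrightarrow> y \<in> U"
      using a cen unfolding U_def by (auto simp: less_Suc_eq)
  qed (use assms(1) in \<open>auto simp: input_def\<close>)
  then have A1: "members ''A'' s1 = U" using U(1) X by (auto simp: members_def)
  have s1: "input s1" "reals s1 ''R'' 0 0 = r" "nats s1 ''l'' 0 0 = l" "nats s1 ''rkd'' = nats s ''rkd''"
    "nats s1 ''rank'' = nats s ''rank''" "nats s1 ''blk'' = nats s ''blk''"
    using assms by (simp_all add: s1_def input_ev nats_ev reals_ev)
  let ?p = "whn (pos (narr ''A'' ''x'')) carve_prog"
  define P where "P t W \<longleftrightarrow> W \<subseteq> U \<and> members ''A'' t \<subseteq> U - W \<and> card (U - members ''A'' t) \<le> 2 * card W \<and>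
    (\<forall>y<n. nats t ''rkd'' y 0 = (if y \<in> W then 1 else nats s ''rkd'' y 0) \<and>
      nats t ''rank'' y 0 = (if y \<in> W then l else nats s ''rank'' y 0) \<and>
      (y \<notin> W \<longrightarrow> nats t ''blk'' y 0 = nats s ''blk'' y 0)) \<and>
    (\<forall>y\<in>W. nats t ''blk'' y 0 < n \<and> (\<exists>j. 2 ^ j \<le> card X \<and> d (nats t ''blk'' y 0) y \<le> 2 * r * real j)) \<and>
    (\<forall>y\<in>W. \<forall>z\<in>W. d y z \<le> 2 * r \<longrightarrow> nats t ''blk'' y 0 = nats t ''blk'' z 0) \<and>
    (\<forall>y\<in>W. \<forall>z\<in>members ''A'' t. 2 * r < d y z)" for t W
  define Inv where "Inv a t \<longleftrightarrow> (\<exists>W. P t W) \<and> (\<forall>y<a. y \<notin> members ''A'' t)" for a t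
  have "Inv n s'"
    unfolding e
  proof (rule For_inv)
    have "P s1 {}" using s1 A1 by (auto simp: P_def)
    then show "Inv 0 s1" by (auto simp: Inv_def)
    fix a t assume a: "a < n" "Inv a t" "nats t ''x'' 0 0 = a" and fr: "frame (insert ''x'' (nw ?p)) (rw ?p) s1 t"
    show "Inv (Suc a) (ev ?p t)"
    proof (cases "a \<in> members ''A'' t")
      case False
      then have "ev ?p t = t" using a(1,3) by (simp add: members_def)
      then show ?thesis using a(2) False by (auto simp: Inv_def less_Suc_eq)
    next
      case True
      have t: "input t" "reals t ''R'' 0 0 = r" "nats t ''l'' 0 0 = l"
        using input_frame[OF fr s1(1)] frame_nats[OF fr] frame_reals[OF fr] s1 by simp_all
      define A where "A = members ''A'' t"
      obtain W where W: "P t W" using a(2) by (auto simp: Inv_def)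
      have ep: "ev ?p t = ev carve_prog t" using True a(3) by (simp add: members_def)
      define t' where "t' = ev carve_prog t"
      obtain B where B: "a \<in> B" "B \<subseteq> A" "card (nbhd r A B) \<le> 2 * card B"
        "\<exists>j. 2 ^ j \<le> card B \<and> (\<forall>y\<in>B. d a y \<le> 2 * r * real j)" and A': "members ''A'' t' = A - nbhd r A B"
        and B': "\<And>y. y < n \<Longrightarrow> nats t' ''rkd'' y 0 = (if y \<in> B then 1 else nats t ''rkd'' y 0)"
          "\<And>y. y < n \<Longrightarrow> nats t' ''rank'' y 0 = (if y \<in> B then l else nats t ''rank'' y 0)"
          "\<And>y. y < n \<Longrightarrow> nats t' ''blk'' y 0 = (if y \<in> B then a else nats t ''blk'' y 0)"
        using carve_prog_correct[OF t(1,2) \<open>0 \<le> r\<close> a(3) t(3) A_def True[folded A_def]] unfolding t'_def by blast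
      have W1: "W \<subseteq> U" "A \<subseteq> U - W" "card (U - A) \<le> 2 * card W"
        using W unfolding P_def A_def by blast+
      have W2: "\<And>y. y < n \<Longrightarrow> nats t ''rkd'' y 0 = (if y \<in> W then 1 else nats s ''rkd'' y 0)"
          "\<And>y. y < n \<Longrightarrow> nats t ''rank'' y 0 = (if y \<in> W then l else nats s ''rank'' y 0)"
          "\<And>y. y < n \<Longrightarrow> y \<notin> W \<Longrightarrow> nats t ''blk'' y 0 = nats s ''blk'' y 0"
        using W unfolding P_def by blast+
      have W3: "\<And>y. y \<in> W \<Longrightarrow> nats t ''blk'' y 0 < n \<and> (\<exists>j. 2 ^ j \<le> card X \<and> d (nats t ''blk'' y 0) y \<le> 2 * r * real j)"
        "\<And>y z. y \<in> W \<Longrightarrow> z \<in> W \<Longrightarrow> d y z \<le> 2 * r \<Longrightarrow> nats t ''blk'' y 0 = nats t ''blk'' z 0"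
        "\<And>y z. y \<in> W \<Longrightarrow> z \<in> A \<Longrightarrow> 2 * r < d y z"
        using W unfolding P_def A_def by blast+
      have disj: "W \<inter> B = {}" using W1(2) B(2) by blast
      have lt: "y < n" if "y \<in> U" for y using that U(1) X by auto
      have BU: "B \<subseteq> U" using B(2) W1(2) by blast
      have fin: "finite W" "finite B" using U(2) W1(1) BU finite_subset by blast+
      have "card B \<le> card X" using fX BU U(1) by (intro card_mono) auto
      have Bn: "B \<subseteq> nbhd r A B" using W1(2) lt \<open>0 \<le> r\<close> B(2) by (intro sub_nbhd) auto
      have "P t' (W \<union> B)"
        unfolding P_def A'
      proof (intro conjI allI impI ballI)
        show "W \<union> B \<subseteq> U" using W1(1) BU by blast
        show "A - nbhd r A B \<subseteq> U - (W \<union> B)" using W1(2) Bn by blast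
        have "U - (A - nbhd r A B) = (U - A) \<union> nbhd r A B" using nbhd_sub[of r A B] W1(2) by blast
        then have "card (U - (A - nbhd r A B)) \<le> card (U - A) + card (nbhd r A B)" by (simp add: card_Un_le)
        also have "\<dots> \<le> 2 * card W + 2 * card B" using W1(3) B(3) by simp
        also have "\<dots> = 2 * card (W \<union> B)" using card_Un_disjoint[OF fin disj] by simp
        finally show "card (U - (A - nbhd r A B)) \<le> 2 * card (W \<union> B)" .
      next
        fix y assume "y < n"
        then show "nats t' ''rkd'' y 0 = (if y \<in> W \<union> B then 1 else nats s ''rkd'' y 0)"
          "nats t' ''rank'' y 0 = (if y \<in> W \<union> B then l else nats s ''rank'' y 0)"
          "y \<notin> W \<union> B \<Longrightarrow> nats t' ''blk'' y 0 = nats s ''blk'' y 0"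
          using B' W2 by simp_all
      next
        fix y assume y: "y \<in> W \<union> B"
        then have "y < n" using W1(1) BU lt by blast
        show "nats t' ''blk'' y 0 < n" using y W3(1)[of y] B'(3)[OF \<open>y < n\<close>] a(1) by auto
        show "\<exists>j. 2 ^ j \<le> card X \<and> d (nats t' ''blk'' y 0) y \<le> 2 * r * real j"
        proof (cases "y \<in> B")
          case True
          then show ?thesis using B(4) B'(3)[OF \<open>y < n\<close>] \<open>card B \<le> card X\<close> by (auto intro: order_trans)
        next
          case False
          then show ?thesis using y W3(1)[of y] B'(3)[OF \<open>y < n\<close>] by simp
        qed
      next
        fix y z assume y: "y \<in> W \<union> B" "z \<in> W \<union> B" "d y z \<le> 2 * r"
        then have "y < n" "z < n" using W1(1) BU lt by blast+
        have "\<not> (y \<in> W \<and> z \<in> B)" "\<not> (y \<in> B \<and> z \<in> W)"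
          using W3(3)[of y z] W3(3)[of z y] y(3) commute[of y z] B(2) by force+
        then consider "y \<in> B" "z \<in> B" | "y \<in> W" "z \<in> W" "y \<notin> B" "z \<notin> B" using y disj by blast
        then show "nats t' ''blk'' y 0 = nats t' ''blk'' z 0"
          by cases (use B'(3)[OF \<open>y < n\<close>] B'(3)[OF \<open>z < n\<close>] W3(2)[of y z] y(3) in simp_all)
      next
        fix y z assume "y \<in> W \<union> B" "z \<in> A - nbhd r A B"
        then show "2 * r < d y z" using W3(3)[of y z] by (auto simp: nbhd_def not_le)
      qed
      moreover have "a \<notin> members ''A'' t'" using A' Bn B(1) by blast
      moreover have "members ''A'' t' \<subseteq> A" using A' by blast
      ultimately show ?thesis using a(2) unfolding ep t'_def[symmetric] Inv_def A_def less_Suc_eq by blast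
    qed
  qed (use s1 in \<open>auto simp: Inv_def P_def input_def members_def\<close>)
  then obtain W where W: "P s' W" and no: "\<forall>y<n. y \<notin> members ''A'' s'" by (auto simp: Inv_def)
  have "members ''A'' s' = {}" using no by (auto simp: members_def)
  then show ?thesis using W unfolding P_def by (intro exI[of _ W]) simp
qed

text \<open>After \<open>l\<close> layers at most \<open>card X / 2 ^ l\<close> centres are
  unranked, so a centre of rank \<open>l\<close> proves \<open>2 ^ l \<le> card X \<le> k\<close>.
  Ball radii are at most \<open>2 * r * lg\<close>, which gives \<open>h = 4 * r * lg\<close>. The
  summand 1 in the ratio also covers \<open>k = 1\<close>, where the logarithm vanishes.\<close>

lemma carving_ranks:
  assumes "rank_input r s"
  shows "ranks carving_prog r (4 * (log 2 (real k) + 1)\<^sup>2) s"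
proof -
  define X where "X = greedy r n"
  have s: "input s" "reals s ''R'' 0 0 = r" "0 \<le> r" "\<forall>v<n. 0 < nats s ''cen'' v 0 \<longleftrightarrow> v \<in> X" "card X \<le> k"
    "\<forall>y. nats s ''rkd'' y 0 = 0"
    using assms by (simp_all add: rank_input_def X_def)
  have X: "X \<subseteq> {..<n}" "finite X" using greedy_sub by (simp_all add: X_def)
  define Inv where "Inv l t \<longleftrightarrow> card {y\<in>X. nats t ''rkd'' y 0 = 0} * 2 ^ l \<le> card X \<and>
    (\<forall>y\<in>X. 0 < nats t ''rkd'' y 0 \<longrightarrow> nats t ''rank'' y 0 < l \<and> 2 ^ nats t ''rank'' y 0 \<le> card X \<and>
       nats t ''blk'' y 0 < n \<and> (\<exists>j. 2 ^ j \<le> card X \<and> d (nats t ''blk'' y 0) y \<le> 2 * r * real j)) \<and>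
    (\<forall>y\<in>X. \<forall>z\<in>X. 0 < nats t ''rkd'' y 0 \<longrightarrow> 0 < nats t ''rkd'' z 0 \<longrightarrow>
       nats t ''rank'' y 0 = nats t ''rank'' z 0 \<longrightarrow> d y z \<le> 2 * r \<longrightarrow> nats t ''blk'' y 0 = nats t ''blk'' z 0)"
    for l and t :: store
  define s' where "s' = ev carving_prog s"
  have "Inv n s'"
    unfolding s'_def carving_prog_def
  proof (rule For_inv)
    fix l t assume l: "l < n" "Inv l t" "nats t ''l'' 0 0 = l" and fr: "frame (insert ''l'' (nw layer_prog)) (rw layer_prog) s t"
    have t: "input t" "reals t ''R'' 0 0 = r" "\<forall>v<n. 0 < nats t ''cen'' v 0 \<longleftrightarrow> v \<in> X"
      using input_frame[OF fr s(1)] frame_nats[OF fr] frame_reals[OF fr] s by simp_all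
    define U where "U = {y\<in>X. nats t ''rkd'' y 0 = 0}"
    define t' where "t' = ev layer_prog t"
    obtain W where W: "W \<subseteq> U" "card U \<le> 2 * card W"
      and W1: "\<And>y. y < n \<Longrightarrow> nats t' ''rkd'' y 0 = (if y \<in> W then 1 else nats t ''rkd'' y 0)"
        "\<And>y. y < n \<Longrightarrow> nats t' ''rank'' y 0 = (if y \<in> W then l else nats t ''rank'' y 0)"
        "\<And>y. y < n \<Longrightarrow> y \<notin> W \<Longrightarrow> nats t' ''blk'' y 0 = nats t ''blk'' y 0"
      and W2: "\<And>y. y \<in> W \<Longrightarrow> nats t' ''blk'' y 0 < n \<and> (\<exists>j. 2 ^ j \<le> card X \<and> d (nats t' ''blk'' y 0) y \<le> 2 * r * real j)"
        "\<And>y z. y \<in> W \<Longrightarrow> z \<in> W \<Longrightarrow> d y z \<le> 2 * r \<Longrightarrow> nats t' ''blk'' y 0 = nats t' ''blk'' z 0"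
      using layer_prog_correct[OF t(1,2) s(3) l(3) X(1) t(3), folded U_def t'_def] by blast
    have I: "card U * 2 ^ l \<le> card X"
      "\<And>y. y \<in> X \<Longrightarrow> 0 < nats t ''rkd'' y 0 \<Longrightarrow> nats t ''rank'' y 0 < l \<and> 2 ^ nats t ''rank'' y 0 \<le> card X \<and>
       nats t ''blk'' y 0 < n \<and> (\<exists>j. 2 ^ j \<le> card X \<and> d (nats t ''blk'' y 0) y \<le> 2 * r * real j)"
      "\<And>y z. y \<in> X \<Longrightarrow> z \<in> X \<Longrightarrow> 0 < nats t ''rkd'' y 0 \<Longrightarrow> 0 < nats t ''rkd'' z 0 \<Longrightarrow>
       nats t ''rank'' y 0 = nats t ''rank'' z 0 \<Longrightarrow> d y z \<le> 2 * r \<Longrightarrow> nats t ''blk'' y 0 = nats t ''blk'' z 0"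
      using l(2) unfolding Inv_def U_def by blast+
    have ltn: "y < n" if "y \<in> X" for y using that X by auto
    have fU: "finite U" using X(2) by (simp add: U_def)
    have rkd': "0 < nats t' ''rkd'' y 0 \<longleftrightarrow> y \<in> W \<or> 0 < nats t ''rkd'' y 0" if "y \<in> X" for y
      using W1(1)[OF ltn[OF that]] by simp
    have old: "y \<notin> W" if "0 < nats t ''rkd'' y 0" for y using that W(1) by (auto simp: U_def)
    have "nats t' ''rkd'' y 0 = 0 \<longleftrightarrow> y \<notin> W \<and> nats t ''rkd'' y 0 = 0" if "y \<in> X" for y
      using rkd'[OF that] by auto
    then have c1: "{y\<in>X. nats t' ''rkd'' y 0 = 0} = U - W" unfolding U_def by blast
    have c2: "card (U - W) = card U - card W" using W(1) fU by (simp add: card_Diff_subset finite_subset)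
    have c3: "(card U - card W) * 2 ^ Suc l \<le> card U * 2 ^ l"
    proof -
      have "(card U - card W) * 2 \<le> card U" using W(2) by simp
      then have "(card U - card W) * 2 * 2 ^ l \<le> card U * 2 ^ l" by (rule mult_le_mono1)
      then show ?thesis by (simp add: mult.assoc)
    qed
    have c: "card {y\<in>X. nats t' ''rkd'' y 0 = 0} * 2 ^ Suc l \<le> card X"
      unfolding c1 c2 using c3 I(1) by (rule order_trans)
    \<comment> \<open>Layer \<open>l\<close> ranks something only if an unranked centre was left at
      its start.\<close>
    have pow: "2 ^ l \<le> card X" if "y \<in> W" for y
    proof -
      have "card U > 0" using that W(1) fU by (auto simp: card_gt_0_iff)
      then have "1 * 2 ^ l \<le> card U * 2 ^ l" by (intro mult_le_mono1) simp
      then show ?thesis using I(1) unfolding mult_1 by (rule order_trans)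
    qed
    show "Inv (Suc l) (ev layer_prog t)"
      unfolding Inv_def t'_def[symmetric]
    proof (intro conjI ballI impI c)
      fix y assume y: "y \<in> X" "0 < nats t' ''rkd'' y 0"
      note yn = ltn[OF y(1)]
      have "nats t' ''rank'' y 0 < Suc l \<and> 2 ^ nats t' ''rank'' y 0 \<le> card X \<and> nats t' ''blk'' y 0 < n \<and>
        (\<exists>j. 2 ^ j \<le> card X \<and> d (nats t' ''blk'' y 0) y \<le> 2 * r * real j)"
      proof (cases "y \<in> W")
        case True
        then show ?thesis using W2(1)[OF True] W1(2)[OF yn] pow[OF True] by simp
      next
        case False
        then have "0 < nats t ''rkd'' y 0" using y rkd' by blast
        then show ?thesis using I(2)[OF y(1)] W1(2,3)[OF yn] False by simp
      qed
      then show "nats t' ''rank'' y 0 < Suc l" "2 ^ nats t' ''rank'' y 0 \<le> card X" "nats t' ''blk'' y 0 < n"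
        "\<exists>j. 2 ^ j \<le> card X \<and> d (nats t' ''blk'' y 0) y \<le> 2 * r * real j" by blast+
    next
      fix y z assume y: "y \<in> X" "z \<in> X" "0 < nats t' ''rkd'' y 0" "0 < nats t' ''rkd'' z 0"
        "nats t' ''rank'' y 0 = nats t' ''rank'' z 0" "d y z \<le> 2 * r"
      note n = ltn[OF y(1)] ltn[OF y(2)]
      have rk: "x \<in> W \<longleftrightarrow> nats t' ''rank'' x 0 = l" if "x \<in> X" "0 < nats t' ''rkd'' x 0" for x
        using that I(2)[of x] rkd'[of x] W1(2)[OF ltn[OF that(1)]] by auto
      then have "y \<in> W \<longleftrightarrow> z \<in> W" using y by simp
      then consider "y \<in> W" "z \<in> W" | "y \<notin> W" "z \<notin> W" by blast
      then show "nats t' ''blk'' y 0 = nats t' ''blk'' z 0"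
      proof cases
        case 1
        then show ?thesis using W2(2) y(6) by blast
      next
        case 2
        then have "0 < nats t ''rkd'' y 0" "0 < nats t ''rkd'' z 0" using y rkd' by blast+
        then show ?thesis using I(3)[OF y(1,2)] y(5,6) 2 W1(2,3)[OF n(1)] W1(2,3)[OF n(2)] by simp
      qed
    qed
  qed (use s X in \<open>auto simp: Inv_def input_def\<close>)
  then have I: "card {y\<in>X. nats s' ''rkd'' y 0 = 0} * 2 ^ n \<le> card X"
    and I2: "\<And>y. y \<in> X \<Longrightarrow> 0 < nats s' ''rkd'' y 0 \<Longrightarrow> nats s' ''rank'' y 0 < n \<and> 2 ^ nats s' ''rank'' y 0 \<le> card X \<and>
       nats s' ''blk'' y 0 < n \<and> (\<exists>j. 2 ^ j \<le> card X \<and> d (nats s' ''blk'' y 0) y \<le> 2 * r * real j)"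
    and I3: "\<And>y z. y \<in> X \<Longrightarrow> z \<in> X \<Longrightarrow> 0 < nats s' ''rkd'' y 0 \<Longrightarrow> 0 < nats s' ''rkd'' z 0 \<Longrightarrow>
       nats s' ''rank'' y 0 = nats s' ''rank'' z 0 \<Longrightarrow> d y z \<le> 2 * r \<Longrightarrow> nats s' ''blk'' y 0 = nats s' ''blk'' z 0"
    unfolding Inv_def by blast+
  have "card X \<le> n" using card_mono[OF _ X(1)] by simp
  \<comment> \<open>After \<open>n\<close> halvings fewer than one centre remains.\<close>
  have "card {y\<in>X. nats s' ''rkd'' y 0 = 0} = 0"
  proof (rule ccontr)
    assume "card {y\<in>X. nats s' ''rkd'' y 0 = 0} \<noteq> 0"
    then have "1 * 2 ^ n \<le> card {y\<in>X. nats s' ''rkd'' y 0 = 0} * 2 ^ n" by (intro mult_le_mono1) simp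
    then show False using I \<open>card X \<le> n\<close> less_exp[of n] by linarith
  qed
  then have rkd: "0 < nats s' ''rkd'' y 0" if "y \<in> X" for y using that X(2) by auto
  define lg where "lg = log 2 (real k)"
  have lg: "0 \<le> lg" using k1 by (simp add: lg_def)
  have pow: "real j \<le> lg" if "2 ^ j \<le> card X" for j
  proof -
    have "2 ^ j \<le> k" using that s(5) by simp
    then have "2 ^ j \<le> real k" by (metis of_nat_le_iff of_nat_numeral of_nat_power)
    then show ?thesis using k1 by (simp add: lg_def le_log_iff powr_realpow)
  qed
  define L where "L = Suc (nat \<lfloor>lg\<rfloor>)"
  have rL: "nats s' ''rank'' y 0 < L" if "y \<in> X" for y
  proof -
    have "real (nats s' ''rank'' y 0) \<le> lg" using pow I2[OF that rkd[OF that]] by blast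
    then show ?thesis by (simp add: L_def le_nat_floor less_Suc_eq_le)
  qed
  have bl: "nats s' ''blk'' y 0 < n \<and> d (nats s' ''blk'' y 0) y \<le> 2 * r * lg" if yX: "y \<in> X" for y
  proof -
    obtain j where j: "2 ^ j \<le> card X" "d (nats s' ''blk'' y 0) y \<le> 2 * r * real j"
      using I2[OF yX rkd[OF yX]] by blast
    have "2 * r * real j \<le> 2 * r * lg" using pow[OF j(1)] s(3) by (intro mult_left_mono) auto
    then show ?thesis using j(2) I2[OF that rkd[OF that]] by simp
  qed
  have "rank_ok r X (\<lambda>v. nats s' ''rank'' v 0) L (4 * r * lg)"
    unfolding rank_ok_def
  proof (intro conjI ballI impI rL)
    fix c c' assume c: "c \<in> X" "c' \<in> X"
      and ch: "(c, c') \<in> (Restr {(x, y). d x y \<le> 2 * r} {x\<in>X. nats s' ''rank'' x 0 = nats s' ''rank'' c 0})\<^sup>*"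
    from ch have "nats s' ''blk'' c' 0 = nats s' ''blk'' c 0"
    proof (induction rule: rtrancl_induct)
      case (step x y)
      then have "x \<in> X" "y \<in> X" "d x y \<le> 2 * r" "nats s' ''rank'' x 0 = nats s' ''rank'' y 0" by auto
      then show ?case using I3[of x y] rkd step.IH by simp
    qed simp
    then have b: "nats s' ''blk'' c 0 < n" "d (nats s' ''blk'' c 0) c \<le> 2 * r * lg" "d (nats s' ''blk'' c 0) c' \<le> 2 * r * lg"
      using bl[OF c(1)] bl[OF c(2)] by simp_all
    have "c < n" "c' < n" using c X by auto
    then show "d c c' \<le> 4 * r * lg"
      using triangle[of c "nats s' ''blk'' c 0" c'] b commute[of c "nats s' ''blk'' c 0"] by simp
  qed
  moreover have "real L * (4 * r * lg + 2 * r) \<le> 4 * (lg + 1)\<^sup>2 * r"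
  proof -
    have "real L \<le> lg + 1" using lg by (simp add: L_def)
    then have "real L * (4 * r * lg + 2 * r) \<le> (lg + 1) * (4 * r * lg + 2 * r)"
      using s(3) lg by (intro mult_right_mono) auto
    also have "\<dots> \<le> (lg + 1) * (4 * (lg + 1) * r)"
      using s(3) lg by (intro mult_left_mono) (auto simp: algebra_simps)
    finally show ?thesis by (simp add: power2_eq_square algebra_simps)
  qed
  moreover have "nats s' ''rank'' c 0 \<le> n + nats s ''dim'' 0 0" if "c \<in> X" for c
    using I2[OF that rkd[OF that]] by simp
  ultimately show ?thesis
    using s(3) lg unfolding ranks_def s'_def[symmetric] X_def[symmetric] lg_def[symmetric]
    by (intro exI[of _ L] exI[of _ "4 * r * lg"]) simp
qed

end

section \<open>Ranks in Lp spaces\<close>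

definition two_r :: rexp where
  "two_r = RAdd (rvar ''R'') (rvar ''R'')"

text \<open>\<open>has\<close> replaces an infinite starting value of the minimum
  \<open>mu\<close>.\<close>

definition min_step :: prog where
  "min_step = whn (And (zer (narr ''as'' ''x'')) (orb (zer (nvar ''has'')) (RLess (rmat ''coord'' ''x'' ''j'') (rvar ''mu''))))
     (rset ''mu'' (rmat ''coord'' ''x'' ''j'') ;; nset ''has'' N1)"

definition min_prog :: prog where
  "min_prog = nset ''has'' N0 ;; For ''x'' nN min_step"

text \<open>
  A zone starts at the smallest unassigned coordinate and has length \<open>2 * r\<close>.  The zone number after a
  long gap increases by \<open>D + 1\<close>, so that the residue \<open>cm\<close> of \<open>cz\<close> modulo \<open>D + 1\<close> is kept
  and points on different sides of the gap have zone numbers differing by more than \<open>D\<close>.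
\<close>

definition next_zone :: prog where
  "next_zone = Cnd (rle (rvar ''mu'') (RAdd (rvar ''base'') (RAdd two_r two_r)))
       (incr ''cz'' ;; Cnd (NLess (nvar ''cm'') nD) (incr ''cm'') (nset ''cm'' N0))
       (nset ''cz'' (NAdd (nvar ''cz'') (NAdd nD N1))) ;;
     rset ''base'' (rvar ''mu'')"

definition assign_step :: prog where
  "assign_step = whn (And (zer (narr ''as'' ''x'')) (rle (rmat ''coord'' ''x'' ''j'') (RAdd (rvar ''base'') two_r)))
     (aset ''as'' ''x'' N1 ;; mset ''z'' ''x'' ''j'' (nvar ''cz'') ;; mset ''bad'' ''x'' ''cm'' N1)"

definition zone_step :: prog where
  "zone_step = min_prog ;; whn (pos (nvar ''has'')) (next_zone ;; For ''x'' nN assign_step)"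

text \<open>\<open>base\<close> keeps the value left by the previous coordinate. This only decides
  whether the first zone is number 1 or \<open>D + 1\<close>; before it no point is assigned, so no
  comparison refers to \<open>base\<close>.\<close>

definition zone_prog :: prog where
  "zone_prog = For ''x'' nN (aset ''as'' ''x'' N0) ;; nset ''cz'' N0 ;; nset ''cm'' N0 ;; For ''m'' nN zone_step"

definition free_step :: prog where
  "free_step = whn (And (zer (nmat ''bad'' ''x'' ''i'')) (zer (narr ''rkd'' ''x'')))
     (aset ''rank'' ''x'' (nvar ''i'') ;; aset ''rkd'' ''x'' N1)"

definition lp_prog :: prog where
  "lp_prog = For ''j'' nD zone_prog ;; For ''x'' nN (For ''i'' nL free_step)"

lemma nw_lp [simp]:
  "nw min_step = {''has''}" "rw min_step = {''mu''}"
  "nw min_prog = {''x'', ''has''}" "rw min_prog = {''mu''}"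
  "nw next_zone = {''cz'', ''cm''}" "rw next_zone = {''base''}"
  "nw assign_step = {''as'', ''z'', ''bad''}" "rw assign_step = {}"
  "nw zone_step = {''x'', ''has'', ''cz'', ''cm'', ''as'', ''z'', ''bad''}" "rw zone_step = {''mu'', ''base''}"
  "nw zone_prog = {''x'', ''has'', ''cz'', ''cm'', ''as'', ''z'', ''bad'', ''m''}" "rw zone_prog = {''mu'', ''base''}"
  "nw free_step = {''rank'', ''rkd''}" "rw free_step = {}"
  by (auto simp: min_step_def min_prog_def next_zone_def assign_step_def zone_step_def zone_prog_def free_step_def)

lemma rank_lp_prog: "rank_prog lp_prog"
proof -
  have "wf_prog zone_step"
    unfolding zone_step_def min_prog_def min_step_def next_zone_def assign_step_def by simp
  then have "wf_prog zone_prog" unfolding zone_prog_def by simp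
  moreover have "wf_prog free_step" unfolding free_step_def by simp
  ultimately have "wf_prog lp_prog" unfolding lp_prog_def by simp
  then show ?thesis unfolding rank_prog_def by (simp add: lp_prog_def)
qed

text \<open>Starts of consecutive zones differ by at most \<open>4 * r\<close> unless a long gap
  lies between, and a zone has length \<open>2 * r\<close>; this is the source of the second bound.
  The premise \<open>z y \<le> z x + D\<close> excludes pairs separated by a long gap.\<close>

definition zone_bounds :: "('a \<Rightarrow> real) \<Rightarrow> real \<Rightarrow> nat \<Rightarrow> 'a set \<Rightarrow> ('a \<Rightarrow> nat) \<Rightarrow> bool" where
  "zone_bounds f r D A z \<longleftrightarrow> (\<forall>x\<in>A. \<forall>y\<in>A. (\<bar>f x - f y\<bar> \<le> 2 * r \<longrightarrow> z x \<le> z y + 1) \<and>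
     (z x \<le> z y \<longrightarrow> z y \<le> z x + D \<longrightarrow> \<bar>f x - f y\<bar> \<le> 4 * r * (real (z y) - real (z x)) + 2 * r))"

text \<open>The state with \<open>A\<close> assigned and zone \<open>cz\<close> starting at
  \<open>base\<close>. The clause on \<open>V - A\<close> stands under the quantifier over
  \<open>A\<close>, so nothing is said about \<open>base\<close> before the first zone.\<close>

definition zones :: "('a \<Rightarrow> real) \<Rightarrow> real \<Rightarrow> nat \<Rightarrow> 'a set \<Rightarrow> 'a set \<Rightarrow> ('a \<Rightarrow> nat) \<Rightarrow> real \<Rightarrow> nat \<Rightarrow> bool" where
  "zones f r D V A z base cz \<longleftrightarrow> zone_bounds f r D A z \<and>
     (\<forall>x\<in>A. z x \<le> cz \<and> f x \<le> base + 2 * r \<and> (z x < cz \<longrightarrow> f x < base) \<and>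
        (cz \<le> z x + D \<longrightarrow> base \<le> f x + 4 * r * (real cz - real (z x))) \<and> (\<forall>y\<in>V - A. base + 2 * r < f y))"

text \<open>Without a jump the start moves by at most \<open>4 * r\<close> while the number grows by
  one. After a jump all old points are more than \<open>2 * r\<close> below \<open>mu\<close> and
  their numbers are more than \<open>D\<close> smaller, so neither part of
  \<open>zone_bounds\<close> relates the two sides.\<close>

lemma zones_step:
  assumes Z: "zones f r D V A z base cz" and "0 \<le> r" and mu: "\<And>y. y \<in> V \<Longrightarrow> y \<notin> A \<Longrightarrow> mu \<le> f y" "x0 \<in> V" "x0 \<notin> A" "f x0 = mu"
    and cz': "cz' = (if mu \<le> base + 4 * r then cz + 1 else cz + (D + 1))"
    and A': "A' = A \<union> {y\<in>V - A. f y \<le> mu + 2 * r}"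
    and z': "\<And>x. x \<in> A \<Longrightarrow> z' x = z x" "\<And>x. x \<in> A' \<Longrightarrow> x \<notin> A \<Longrightarrow> z' x = cz'"
  shows "zones f r D V A' z' mu cz'"
proof -
  have Z1: "z x \<le> cz" "f x \<le> base + 2 * r" "z x < cz \<Longrightarrow> f x < base"
    "cz \<le> z x + D \<Longrightarrow> base \<le> f x + 4 * r * (real cz - real (z x))" "base + 2 * r < mu" if "x \<in> A" for x
    using Z that mu(2-4) unfolding zones_def by auto
  have new: "mu \<le> f y \<and> f y \<le> mu + 2 * r \<and> z' y = cz'" if "y \<in> A'" "y \<notin> A" for y
    using that mu(1) z'(2) A' by auto
  have old: "z x < cz' \<and> f x < mu \<and> (cz' \<le> z x + D \<longrightarrow> mu \<le> f x + 4 * r * (real cz' - real (z x)))" if "x \<in> A" for x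
    using Z1[OF that] \<open>0 \<le> r\<close> cz' by (auto simp: algebra_simps)
  \<comment> \<open>A point within \<open>2 * r\<close> of the new start can only belong to the
    current zone: those of lower number lie below \<open>base\<close>, and
    \<open>base + 2 * r < mu\<close>. A jump would need a larger distance.\<close>
  have near: "cz' \<le> z x + 1" if x: "x \<in> A" and y: "mu \<le> f y" "\<bar>f x - f y\<bar> \<le> 2 * r" for x y
  proof -
    have "z x = cz" using Z1[OF x] y by (cases "z x < cz") auto
    moreover have "mu \<le> base + 4 * r" using Z1(2)[OF x] y by auto
    ultimately show ?thesis using cz' by simp
  qed
  have "zone_bounds f r D A' z'"
    unfolding zone_bounds_def
  proof (intro ballI conjI impI)
    fix x y assume xy: "x \<in> A'" "y \<in> A'" "\<bar>f x - f y\<bar> \<le> 2 * r"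
    show "z' x \<le> z' y + 1"
    proof (cases "y \<in> A")
      case True
      show ?thesis
      proof (cases "x \<in> A")
        case True
        then show ?thesis using Z \<open>y \<in> A\<close> xy(3) z'(1) unfolding zones_def zone_bounds_def by auto
      next
        case False
        then show ?thesis using near[OF \<open>y \<in> A\<close>, of x] new[OF xy(1)] xy(3) z'(1)[OF \<open>y \<in> A\<close>] by (simp add: abs_minus_commute)
      qed
    next
      case False
      then have "z' y = cz'" using new xy by blast
      moreover have "z' x \<le> cz'" using new[OF xy(1)] old[of x] z'(1)[of x] by (cases "x \<in> A") auto
      ultimately show ?thesis by simp
    qed
  next
    fix x y assume xy: "x \<in> A'" "y \<in> A'" "z' x \<le> z' y" "z' y \<le> z' x + D"
    show "\<bar>f x - f y\<bar> \<le> 4 * r * (real (z' y) - real (z' x)) + 2 * r"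
    proof (cases "x \<in> A"; cases "y \<in> A")
      assume "x \<in> A" "y \<in> A"
      then show ?thesis using Z xy(3,4) z'(1) unfolding zones_def zone_bounds_def by auto
    next
      assume x: "x \<in> A" and y: "y \<notin> A"
      then show ?thesis using old[OF x] new[OF xy(2) y] xy(4) z'(1)[OF x] by auto
    next
      assume "x \<notin> A" "y \<in> A"
      then show ?thesis using old[of y] new[OF xy(1)] z'(1)[of y] xy(3) by auto
    next
      assume "x \<notin> A" "y \<notin> A"
      then show ?thesis using new[OF xy(1)] new[OF xy(2)] by auto
    qed
  qed
  moreover have "mu + 2 * r < f y" if "y \<in> V - A'" for y using that A' by auto
  moreover have "z' x \<le> cz' \<and> f x \<le> mu + 2 * r \<and> (z' x < cz' \<longrightarrow> f x < mu) \<and>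
        (cz' \<le> z' x + D \<longrightarrow> mu \<le> f x + 4 * r * (real cz' - real (z' x)))" if "x \<in> A'" for x
  proof (cases "x \<in> A")
    case True
    then show ?thesis using old[OF True] z'(1)[OF True] \<open>0 \<le> r\<close> by auto
  next
    case False
    then show ?thesis using new[OF that False] by auto
  qed
  ultimately show ?thesis unfolding zones_def by blast
qed

text \<open>Along a chain of points that avoid the residue \<open>i\<close>, no coordinate can pass a zone with residue \<open>i\<close>.\<close>

lemma same_block:
  fixes z z' i D :: nat
  assumes "z \<le> z' + 1" "z' \<le> z + 1" "z mod (D + 1) \<noteq> i" "z' mod (D + 1) \<noteq> i" "i \<le> D"
  shows "(z + D - i) div (D + 1) = (z' + D - i) div (D + 1)"
proof -
  \<comment> \<open>The shift by \<open>D - i\<close> makes the quotient change exactly behind the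
    numbers of residue \<open>i\<close>. Writing it as \<open>z + D - i\<close> with
    \<open>i \<le> D\<close> avoids truncated subtraction.\<close>
  have step: "(Suc z + D - i) div (D + 1) = (z + D - i) div (D + 1)" if z: "z mod (D + 1) \<noteq> i" for z
  proof -
    have e: "Suc z + D - i = Suc (z + D - i)" using \<open>i \<le> D\<close> by simp
    have "Suc (z + D - i) mod (D + 1) \<noteq> 0"
    proof
      assume "Suc (z + D - i) mod (D + 1) = 0"
      then obtain q where "Suc (z + D - i) = (D + 1) * q" by (auto elim: dvdE)
      then have "(Suc (z + D - i) + i) mod (D + 1) = i" using \<open>i \<le> D\<close> mod_mult_self4[of "D + 1" q i] by simp
      moreover have "Suc (z + D - i) + i = z + (D + 1)" using \<open>i \<le> D\<close> by simp
      ultimately have "(z + (D + 1)) mod (D + 1) = i" by (simp only:)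
      then show False using z by (simp only: mod_add_self2)
    qed
    then show ?thesis unfolding e by (simp add: div_Suc)
  qed
  consider "z = z'" | "z = Suc z'" | "z' = Suc z" using assms(1,2) by linarith
  then show ?thesis by cases (use step[of z] step[of z'] assms(3,4) in auto)
qed

text \<open>Equal quotients by \<open>D + 1\<close> leave a difference of at most \<open>D\<close>
  between the dividends. This brings the ends of a chain into the range of the distance bound in
  \<open>zone_bounds\<close>.\<close>

lemma block_diff:
  fixes z z' i D :: nat
  assumes "(z + D - i) div (D + 1) = (z' + D - i) div (D + 1)" "i \<le> D"
  shows "z' \<le> z + D"
proof -
  define w w' where "w = z + D - i" and "w' = z' + D - i"
  define P where "P = w div (D + 1) * (D + 1)"
  have "w div (D + 1) = w' div (D + 1)" using assms(1) by (simp add: w_def w'_def)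
  moreover have "w = w div (D + 1) * (D + 1) + w mod (D + 1)" "w' = w' div (D + 1) * (D + 1) + w' mod (D + 1)"
    by (rule div_mult_mod_eq[symmetric])+
  ultimately have "w = P + w mod (D + 1)" "w' = P + w' mod (D + 1)" by (simp_all only: P_def)
  moreover have "w' mod (D + 1) < D + 1" by simp
  ultimately have "w' \<le> w + D" by linarith
  then show ?thesis using assms(2) by (simp add: w_def w'_def)
qed

context conn_inst
begin

section \<open>Correctness of the zone program\<close>

lemma min_prog_correct:
  assumes "input s" "nats s ''j'' 0 0 = j"
  shows "0 < nats (ev min_prog s) ''has'' 0 0 \<longleftrightarrow> (\<exists>x<n. nats s ''as'' x 0 = 0)"
    and "0 < nats (ev min_prog s) ''has'' 0 0 \<Longrightarrow>
      (\<exists>x<n. nats s ''as'' x 0 = 0 \<and> reals s ''coord'' x j = reals (ev min_prog s) ''mu'' 0 0)"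
    and "\<And>x. x < n \<Longrightarrow> nats s ''as'' x 0 = 0 \<Longrightarrow> reals (ev min_prog s) ''mu'' 0 0 \<le> reals s ''coord'' x j"
proof -
  define U where "U a = {x. x < a \<and> nats s ''as'' x 0 = 0}" for a
  define Inv where "Inv a t \<longleftrightarrow> (0 < nats t ''has'' 0 0 \<longleftrightarrow> U a \<noteq> {}) \<and>
    (U a \<noteq> {} \<longrightarrow> (\<exists>x\<in>U a. reals s ''coord'' x j = reals t ''mu'' 0 0)) \<and>
    (\<forall>x\<in>U a. reals t ''mu'' 0 0 \<le> reals s ''coord'' x j)" for a and t :: store
  have U: "U (Suc a) = (if nats s ''as'' a 0 = 0 then insert a (U a) else U a)" for a
    by (auto simp: U_def less_Suc_eq)
  define s1 where "s1 = ev (nset ''has'' N0) s"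
  have "Inv n (ev min_prog s)"
    unfolding min_prog_def ev.simps(4) s1_def[symmetric]
  proof (rule For_inv)
    show "Inv 0 s1" by (simp add: Inv_def U_def s1_def)
    fix a t assume a: "a < n" "Inv a t" "nats t ''x'' 0 0 = a" and fr: "frame (insert ''x'' (nw min_step)) (rw min_step) s1 t"
    have t: "nats t ''as'' = nats s ''as''" "reals t ''coord'' = reals s ''coord''" "nats t ''j'' 0 0 = j"
      using frame_nats[OF fr] frame_reals[OF fr] assms by (simp_all add: s1_def)
    show "Inv (Suc a) (ev min_step t)"
    proof (cases "nats s ''as'' a 0 = 0 \<and> (nats t ''has'' 0 0 = 0 \<or> reals s ''coord'' a j < reals t ''mu'' 0 0)")
      case True
      then have e: "nats (ev min_step t) ''has'' 0 0 = 1" "reals (ev min_step t) ''mu'' 0 0 = reals s ''coord'' a j"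
        using a(3) t by (auto simp: min_step_def)
      have "reals s ''coord'' a j \<le> reals s ''coord'' x j" if "x \<in> U a" for x
        using a(2) True that unfolding Inv_def by force
      then show ?thesis using True by (auto simp: Inv_def e U)
    next
      case False
      then have "ev min_step t = t" using a(3) t by (auto simp: min_step_def)
      then show ?thesis using a(2) False unfolding Inv_def U by auto
    qed
  qed (use assms in \<open>auto simp: Inv_def U_def input_def s1_def\<close>)
  then show "0 < nats (ev min_prog s) ''has'' 0 0 \<longleftrightarrow> (\<exists>x<n. nats s ''as'' x 0 = 0)"
    and "0 < nats (ev min_prog s) ''has'' 0 0 \<Longrightarrow>
      (\<exists>x<n. nats s ''as'' x 0 = 0 \<and> reals s ''coord'' x j = reals (ev min_prog s) ''mu'' 0 0)"
    and "\<And>x. x < n \<Longrightarrow> nats s ''as'' x 0 = 0 \<Longrightarrow> reals (ev min_prog s) ''mu'' 0 0 \<le> reals s ''coord'' x j"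
    by (auto simp: Inv_def U_def)
qed

lemma assign_loop:
  assumes "input s" "nats s ''j'' 0 0 = j" "reals s ''R'' 0 0 = r" "nats s ''cz'' 0 0 = cz" "nats s ''cm'' 0 0 = cm"
    "reals s ''base'' 0 0 = base"
  defines "s' \<equiv> ev (For ''x'' nN assign_step) s"
    and "G \<equiv> {x. x < n \<and> nats s ''as'' x 0 = 0 \<and> reals s ''coord'' x j \<le> base + 2 * r}"
  shows "\<forall>x<n. nats s' ''as'' x 0 = (if x \<in> G then 1 else nats s ''as'' x 0)"
    and "\<forall>x j'. nats s' ''z'' x j' = (if x \<in> G \<and> j' = j then cz else nats s ''z'' x j')"
    and "\<forall>x i. nats s' ''bad'' x i = (if x \<in> G \<and> i = cm then 1 else nats s ''bad'' x i)"
proof -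
  define Inv where "Inv a t \<longleftrightarrow> (\<forall>x<n. nats t ''as'' x 0 = (if x < a \<and> x \<in> G then 1 else nats s ''as'' x 0)) \<and>
    (\<forall>x j'. nats t ''z'' x j' = (if (x < a \<and> x \<in> G) \<and> j' = j then cz else nats s ''z'' x j')) \<and>
    (\<forall>x i. nats t ''bad'' x i = (if (x < a \<and> x \<in> G) \<and> i = cm then 1 else nats s ''bad'' x i))" for a and t :: store
  have "Inv n s'"
    unfolding s'_def
  proof (rule For_inv)
    fix a t assume a: "a < n" "Inv a t" "nats t ''x'' 0 0 = a" and fr: "frame (insert ''x'' (nw assign_step)) (rw assign_step) s t"
    have t: "nats t ''j'' 0 0 = j" "reals t ''R'' 0 0 = r" "nats t ''cz'' 0 0 = cz" "nats t ''cm'' 0 0 = cm"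
      "reals t ''base'' 0 0 = base" "reals t ''coord'' = reals s ''coord''"
      using frame_nats[OF fr] frame_reals[OF fr] assms by simp_all
    have "nats t ''as'' a 0 = nats s ''as'' a 0" using a(1,2) by (simp add: Inv_def)
    then have g: "bval (And (zer (narr ''as'' ''x'')) (rle (rmat ''coord'' ''x'' ''j'') (RAdd (rvar ''base'') two_r))) t \<longleftrightarrow> a \<in> G"
      using a t by (auto simp: G_def two_r_def)
    show "Inv (Suc a) (ev assign_step t)"
    proof (cases "a \<in> G")
      case True
      then have e: "ev assign_step t = ev (aset ''as'' ''x'' N1 ;; mset ''z'' ''x'' ''j'' (nvar ''cz'') ;; mset ''bad'' ''x'' ''cm'' N1) t"
        using g unfolding assign_step_def ev.simps(5) by (intro if_P) blast
      have "nats (ev assign_step t) ''as'' x 0 = (if x = a then 1 else nats t ''as'' x 0)"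
        "nats (ev assign_step t) ''z'' x i = (if x = a \<and> i = j then cz else nats t ''z'' x i)"
        "nats (ev assign_step t) ''bad'' x i = (if x = a \<and> i = cm then 1 else nats t ''bad'' x i)" for x i
        unfolding e using a(3) t by auto
      then show ?thesis using a(2) True unfolding Inv_def less_Suc_eq by auto
    next
      case False
      then have "ev assign_step t = t" using g unfolding assign_step_def ev.simps(1,5) by (intro if_not_P) blast
      then show ?thesis using a(2) False unfolding Inv_def less_Suc_eq by auto
    qed
  qed (use assms(1) in \<open>auto simp: Inv_def input_def\<close>)
  moreover have "x \<in> G \<Longrightarrow> x < n" for x by (simp add: G_def)
  ultimately show "\<forall>x<n. nats s' ''as'' x 0 = (if x \<in> G then 1 else nats s ''as'' x 0)"
    and "\<forall>x j'. nats s' ''z'' x j' = (if x \<in> G \<and> j' = j then cz else nats s ''z'' x j')"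
    and "\<forall>x i. nats s' ''bad'' x i = (if x \<in> G \<and> i = cm then 1 else nats s ''bad'' x i)"
    unfolding Inv_def by auto
qed

text \<open>Each effective round assigns at least the point where the minimum \<open>mu\<close> is
  attained, so \<open>n\<close> rounds assign all points.\<close>

lemma zone_prog_correct:
  assumes "input s" "nats s ''j'' 0 0 = j" "reals s ''R'' 0 0 = r" "0 \<le> r" "nats s ''dim'' 0 0 = D"
  defines "s' \<equiv> ev zone_prog s" and "V \<equiv> {..<n}"
  shows "zone_bounds (\<lambda>x. reals s ''coord'' x j) r D V (\<lambda>x. nats s' ''z'' x j)"
    and "\<forall>x j'. j' \<noteq> j \<longrightarrow> nats s' ''z'' x j' = nats s ''z'' x j'"
    and "\<forall>x<n. \<forall>i. 0 < nats s' ''bad'' x i \<longleftrightarrow> 0 < nats s ''bad'' x i \<or> i = nats s' ''z'' x j mod (D + 1)"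
proof -
  define f where "f x = reals s ''coord'' x j" for x
  define A where "A t = {x. x < n \<and> 0 < nats t ''as'' x 0}" for t :: store
  define Inv where "Inv m t \<longleftrightarrow> (m \<le> card (A t) \<or> A t = V) \<and>
    zones f r D V (A t) (\<lambda>x. nats t ''z'' x j) (reals t ''base'' 0 0) (nats t ''cz'' 0 0) \<and>
    nats t ''cm'' 0 0 = nats t ''cz'' 0 0 mod (D + 1) \<and>
    (\<forall>x j'. j' \<noteq> j \<longrightarrow> nats t ''z'' x j' = nats s ''z'' x j') \<and>
    (\<forall>x<n. \<forall>i. 0 < nats t ''bad'' x i \<longleftrightarrow> 0 < nats s ''bad'' x i \<or> x \<in> A t \<and> i = nats t ''z'' x j mod (D + 1))" for m and t :: store
  define s0 where "s0 = ev (For ''x'' nN (aset ''as'' ''x'' N0)) s"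
  define s1 where "s1 = ev (nset ''cz'' N0 ;; nset ''cm'' N0) s0"
  have e: "s' = ev (For ''m'' nN zone_step) s1" unfolding s'_def zone_prog_def s1_def s0_def ev.simps(4) ..
  have "\<forall>x<n. nats s0 ''as'' x 0 = 0"
    unfolding s0_def by (rule For_inv[where Inv = "\<lambda>j u. (\<forall>w<j. nats u ''as'' w 0 = 0)"])
      (use assms(1) in \<open>auto simp: input_def less_Suc_eq\<close>)
  then have A1: "A s1 = {}" by (auto simp: A_def s1_def)
  have s1: "input s1" "nats s1 ''j'' 0 0 = j" "reals s1 ''R'' 0 0 = r" "nats s1 ''dim'' 0 0 = D" "reals s1 ''coord'' = reals s ''coord''"
    "nats s1 ''z'' = nats s ''z''" "nats s1 ''bad'' = nats s ''bad''" "nats s1 ''cz'' 0 0 = 0" "nats s1 ''cm'' 0 0 = 0"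
  proof -
    have "input s0" using assms(1) unfolding s0_def by (intro input_ev) simp_all
    then show "input s1" by (simp add: s1_def input_def)
  qed (use assms in \<open>simp_all add: s1_def s0_def nats_ev reals_ev\<close>)
  have "Inv n s'"
    unfolding e
  proof (rule For_inv)
    show "Inv 0 s1" using s1 by (simp add: Inv_def A1 zones_def zone_bounds_def)
    fix m t assume m: "m < n" "Inv m t" and fr: "frame (insert ''m'' (nw zone_step)) (rw zone_step) s1 t"
    have t: "input t" "nats t ''j'' 0 0 = j" "reals t ''R'' 0 0 = r" "nats t ''dim'' 0 0 = D" "reals t ''coord'' = reals s ''coord''"
      using input_frame[OF fr s1(1)] frame_nats[OF fr] frame_reals[OF fr] s1 by simp_all
    define t1 where "t1 = ev min_prog t"
    have t1: "input t1" "nats t1 ''j'' 0 0 = j" "reals t1 ''R'' 0 0 = r" "nats t1 ''dim'' 0 0 = D" "reals t1 ''coord'' = reals s ''coord''"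
      "nats t1 ''as'' = nats t ''as''" "nats t1 ''z'' = nats t ''z''" "nats t1 ''bad'' = nats t ''bad''"
      "nats t1 ''cz'' = nats t ''cz''" "nats t1 ''cm'' = nats t ''cm''" "reals t1 ''base'' = reals t ''base''"
      using t by (simp_all add: t1_def input_ev nats_ev reals_ev)
    note mp = min_prog_correct[OF t(1,2), folded t1_def, unfolded t(5)]
    have es: "ev zone_step t = (if 0 < nats t1 ''has'' 0 0 then ev (next_zone ;; For ''x'' nN assign_step) t1 else t1)"
      unfolding zone_step_def ev.simps(1,4,5) t1_def[symmetric] by simp
    show "Inv (Suc m) (ev zone_step t)"
    proof (cases "0 < nats t1 ''has'' 0 0")
      case False
      then have "A t = V" using mp(1) by (auto simp: A_def V_def)
      moreover have "A t1 = A t" by (simp add: A_def t1)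
      moreover have "ev zone_step t = t1" unfolding es using False by (rule if_not_P)
      ultimately show ?thesis using m(2) unfolding Inv_def by (simp add: t1)
    next
      case True
      define mu where "mu = reals t1 ''mu'' 0 0"
      define base where "base = reals t ''base'' 0 0"
      define cz where "cz = nats t ''cz'' 0 0"
      define cz' where "cz' = (if mu \<le> base + 4 * r then cz + 1 else cz + (D + 1))"
      define t2 where "t2 = ev next_zone t1"
      define t3 where "t3 = ev (For ''x'' nN assign_step) t2"
      have e3: "ev zone_step t = t3" unfolding es t3_def t2_def using True by simp
      have I: "m \<le> card (A t) \<or> A t = V" "zones f r D V (A t) (\<lambda>x. nats t ''z'' x j) base cz"
        "nats t ''cm'' 0 0 = cz mod (D + 1)" "\<And>x j'. j' \<noteq> j \<Longrightarrow> nats t ''z'' x j' = nats s ''z'' x j'"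
        "\<And>x i. x < n \<Longrightarrow> 0 < nats t ''bad'' x i \<longleftrightarrow> 0 < nats s ''bad'' x i \<or> x \<in> A t \<and> i = nats t ''z'' x j mod (D + 1)"
        using m(2) unfolding Inv_def base_def cz_def by blast+
      have t2: "nats t2 ''cz'' 0 0 = cz'" "nats t2 ''cm'' 0 0 = cz' mod (D + 1)" "reals t2 ''base'' 0 0 = mu"
      proof -
        \<comment> \<open>The counter \<open>cm\<close> is at most \<open>D\<close>; if it is not
          smaller than \<open>D\<close>, it equals \<open>D\<close> and wraps around.\<close>
        have md: "\<not> cz mod (D + 1) < D \<Longrightarrow> cz mod (D + 1) = D" using mod_less_divisor[of "D + 1" cz] by linarith
        show "nats t2 ''cz'' 0 0 = cz'" "reals t2 ''base'' 0 0 = mu"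
          using t1 by (auto simp: t2_def next_zone_def two_r_def cz'_def mu_def base_def cz_def)
        show "nats t2 ''cm'' 0 0 = cz' mod (D + 1)"
        proof (cases "mu \<le> base + 4 * r")
          case True
          then show ?thesis
            using t1 I(3) md
            by (auto simp: t2_def next_zone_def two_r_def cz'_def mu_def[symmetric] base_def[symmetric] cz_def[symmetric] mod_Suc)
        next
          case False
          \<comment> \<open>A jump by \<open>D + 1\<close> keeps the residue, which is why the
            program does not touch \<open>cm\<close> in this case.\<close>
          then have "cz' mod (D + 1) = cz mod (D + 1)" unfolding cz'_def by (simp only: if_False mod_add_self2)
          then show ?thesis
            using t1 I(3) False
            by (auto simp: t2_def next_zone_def two_r_def mu_def[symmetric] base_def[symmetric])
        qed
      qed
      have t2': "input t2" "nats t2 ''j'' 0 0 = j" "reals t2 ''R'' 0 0 = r" "reals t2 ''coord'' = reals s ''coord''"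
        "nats t2 ''as'' = nats t ''as''" "nats t2 ''z'' = nats t ''z''" "nats t2 ''bad'' = nats t ''bad''"
        using t1 by (simp_all add: t2_def input_ev nats_ev reals_ev)
      define G where "G = {x. x < n \<and> nats t ''as'' x 0 = 0 \<and> f x \<le> mu + 2 * r}"
      note al = assign_loop[OF t2'(1-3) t2, folded t3_def, unfolded t2'(4-7), folded f_def, folded G_def]
      have A3: "A t3 = A t \<union> G" using al(1) by (auto simp: A_def G_def split: if_split_asm)
      have G: "G = {y\<in>V - A t. f y \<le> mu + 2 * r}" by (auto simp: G_def V_def A_def)
      obtain x0 where x0: "x0 < n" "nats t ''as'' x0 0 = 0" "f x0 = mu" using mp(2)[OF True] by (auto simp: f_def mu_def)
      have mu: "mu \<le> f y" if "y \<in> V" "y \<notin> A t" for y using mp(3)[of y] that by (simp add: f_def mu_def V_def A_def)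
      have zs: "zones f r D V (A t3) (\<lambda>x. nats t3 ''z'' x j) mu cz'"
        by (rule zones_step[OF I(2) \<open>0 \<le> r\<close> mu _ _ x0(3) cz'_def])
          (use x0 al(2) in \<open>auto simp: V_def A_def A3[unfolded A_def] G_def\<close>)
      have "x0 \<in> G" "x0 \<notin> A t" using x0 \<open>0 \<le> r\<close> by (auto simp: G_def A_def)
      then have "A t \<subset> A t3" using A3 by blast
      moreover have "finite (A t3)" by (simp add: A_def)
      ultimately have "card (A t) < card (A t3)" by (rule psubset_card_mono[rotated])
      moreover have "x0 \<in> V" using x0 by (simp add: V_def)
      then have "A t \<noteq> V" using \<open>x0 \<notin> A t\<close> by blast
      ultimately have c: "Suc m \<le> card (A t3)" using I(1) by simp
      have base3: "reals t3 ''base'' 0 0 = mu" "nats t3 ''cz'' 0 0 = cz'" "nats t3 ''cm'' 0 0 = cz' mod (D + 1)"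
        using t2 by (simp_all add: t3_def nats_ev reals_ev)
      have bad: "0 < nats t3 ''bad'' x i \<longleftrightarrow> 0 < nats s ''bad'' x i \<or> x \<in> A t3 \<and> i = nats t3 ''z'' x j mod (D + 1)" if "x < n" for x i
      proof (cases "x \<in> G")
        case True
        then have "x \<notin> A t" by (simp add: G_def A_def)
        then show ?thesis using True al(2,3) I(5)[OF that] by (simp add: A3)
      next
        case False
        then show ?thesis using al(2,3) I(5)[OF that] by (simp add: A3)
      qed
      show ?thesis
        unfolding Inv_def e3 base3
        using c zs bad al(2) I(4) by simp
    qed
  qed (use s1 in \<open>auto simp: Inv_def input_def A_def\<close>)
  moreover have "A s' = V" if "n \<le> card (A s') \<or> A s' = V"
  proof -
    have "A s' \<subseteq> V" "finite V" by (auto simp: V_def A_def)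
    moreover have "card V = n" by (simp add: V_def)
    ultimately show ?thesis using that card_seteq[of V "A s'"] by auto
  qed
  ultimately show "zone_bounds (\<lambda>x. reals s ''coord'' x j) r D V (\<lambda>x. nats s' ''z'' x j)"
    and "\<forall>x j'. j' \<noteq> j \<longrightarrow> nats s' ''z'' x j' = nats s ''z'' x j'"
    and "\<forall>x<n. \<forall>i. 0 < nats s' ''bad'' x i \<longleftrightarrow> 0 < nats s ''bad'' x i \<or> i = nats s' ''z'' x j mod (D + 1)"
    unfolding Inv_def zones_def f_def by (auto simp: V_def)
qed

lemma free_loop:
  assumes "input s" "nats s ''dim'' 0 0 = D" "nats s ''x'' 0 0 = x" "nats s ''rkd'' x 0 = 0" and ex: "\<exists>i\<le>D. nats s ''bad'' x i = 0"
  defines "s' \<equiv> ev (For ''i'' nL free_step) s"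
  shows "nats s' ''rank'' x 0 \<le> D \<and> nats s ''bad'' x (nats s' ''rank'' x 0) = 0"
    and "y \<noteq> x \<Longrightarrow> nats s' ''rank'' y 0 = nats s ''rank'' y 0" "y \<noteq> x \<Longrightarrow> nats s' ''rkd'' y 0 = nats s ''rkd'' y 0"
proof -
  define Inv where "Inv a t \<longleftrightarrow> (if 0 < nats t ''rkd'' x 0 then nats t ''rank'' x 0 \<le> D \<and> nats s ''bad'' x (nats t ''rank'' x 0) = 0
      else \<forall>i<a. 0 < nats s ''bad'' x i) \<and>
    (\<forall>y. y \<noteq> x \<longrightarrow> nats t ''rank'' y 0 = nats s ''rank'' y 0 \<and> nats t ''rkd'' y 0 = nats s ''rkd'' y 0)" for a and t :: store
  have "Inv (n + D + 1) s'"
    unfolding s'_def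
  proof (rule For_inv)
    fix a t assume a: "Inv a t" "nats t ''i'' 0 0 = a" and fr: "frame (insert ''i'' (nw free_step)) (rw free_step) s t"
    have t: "nats t ''bad'' = nats s ''bad''" "nats t ''x'' 0 0 = x" using frame_nats[OF fr] assms by simp_all
    show "Inv (Suc a) (ev free_step t)"
    proof (cases "nats s ''bad'' x a = 0 \<and> nats t ''rkd'' x 0 = 0")
      case True
      then have e: "nats (ev free_step t) ''rank'' y 0 = (if y = x then a else nats t ''rank'' y 0)"
        "nats (ev free_step t) ''rkd'' y 0 = (if y = x then 1 else nats t ''rkd'' y 0)" for y
        using t a(2) by (auto simp: free_step_def)
      have "\<forall>i<a. 0 < nats s ''bad'' x i" using a(1) True by (simp add: Inv_def)
      then have "a \<le> D" using ex by (metis le_trans less_irrefl not_le)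
      then show ?thesis using a(1) True by (simp add: Inv_def e)
    next
      case False
      then have "ev free_step t = t" using t a(2) by (auto simp: free_step_def)
      then show ?thesis using a(1) False by (auto simp: Inv_def less_Suc_eq split: if_splits)
    qed
  qed (use assms in \<open>auto simp: Inv_def input_def\<close>)
  then have I: "Inv (n + D + 1) s'" .
  have "0 < nats s' ''rkd'' x 0"
  proof (rule ccontr)
    assume "\<not> 0 < nats s' ''rkd'' x 0"
    then have all: "\<forall>i<n + D + 1. 0 < nats s ''bad'' x i" using I unfolding Inv_def by simp
    obtain i where "i \<le> D" "nats s ''bad'' x i = 0" using ex by blast
    then show False using all[rule_format, of i] by simp
  qed
  then show "nats s' ''rank'' x 0 \<le> D \<and> nats s ''bad'' x (nats s' ''rank'' x 0) = 0"
    and "y \<noteq> x \<Longrightarrow> nats s' ''rank'' y 0 = nats s ''rank'' y 0" "y \<noteq> x \<Longrightarrow> nats s' ''rkd'' y 0 = nats s ''rkd'' y 0"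
    using I unfolding Inv_def by simp_all
qed

lemma lp_prog_correct:
  assumes "input s" "reals s ''R'' 0 0 = r" "0 \<le> r" "nats s ''dim'' 0 0 = D" "\<forall>x i. nats s ''bad'' x i = 0" "\<forall>x. nats s ''rkd'' x 0 = 0"
  defines "rk \<equiv> \<lambda>x. nats (ev lp_prog s) ''rank'' x 0"
  shows "\<exists>z. (\<forall>j<D. zone_bounds (\<lambda>x. reals s ''coord'' x j) r D {..<n} (\<lambda>x. z x j)) \<and>
    (\<forall>x<n. rk x \<le> D \<and> (\<forall>j<D. z x j mod (D + 1) \<noteq> rk x))"
proof -
  define Inv where "Inv a t \<longleftrightarrow> (\<forall>j<a. zone_bounds (\<lambda>x. reals s ''coord'' x j) r D {..<n} (\<lambda>x. nats t ''z'' x j)) \<and>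
    (\<forall>x<n. \<forall>i. 0 < nats t ''bad'' x i \<longleftrightarrow> (\<exists>j<a. i = nats t ''z'' x j mod (D + 1)))" for a and t :: store
  define s1 where "s1 = ev (For ''j'' nD zone_prog) s"
  have I: "Inv D s1"
    unfolding s1_def
  proof (rule For_inv)
    fix a t assume a: "a < D" "Inv a t" "nats t ''j'' 0 0 = a" and fr: "frame (insert ''j'' (nw zone_prog)) (rw zone_prog) s t"
    have t: "input t" "reals t ''R'' 0 0 = r" "nats t ''dim'' 0 0 = D" "reals t ''coord'' = reals s ''coord''"
      using input_frame[OF fr assms(1)] frame_nats[OF fr] frame_reals[OF fr] assms by simp_all
    note zp = zone_prog_correct[OF t(1) a(3) t(2) assms(3) t(3), unfolded t(4)]
    have z: "nats (ev zone_prog t) ''z'' x j = nats t ''z'' x j" if "j < a" for x j using zp(2) that by simp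
    show "Inv (Suc a) (ev zone_prog t)"
      unfolding Inv_def
    proof (intro conjI allI impI)
      fix j assume "j < Suc a"
      then show "zone_bounds (\<lambda>x. reals s ''coord'' x j) r D {..<n} (\<lambda>x. nats (ev zone_prog t) ''z'' x j)"
        using zp(1) a(2) z unfolding Inv_def less_Suc_eq by auto
    next
      fix x i assume "x < n"
      then have "0 < nats (ev zone_prog t) ''bad'' x i \<longleftrightarrow> (\<exists>j<a. i = nats t ''z'' x j mod (D + 1)) \<or> i = nats (ev zone_prog t) ''z'' x a mod (D + 1)"
        using zp(3) a(2) unfolding Inv_def by blast
      also have "\<dots> \<longleftrightarrow> (\<exists>j<Suc a. i = nats (ev zone_prog t) ''z'' x j mod (D + 1))"
        using z unfolding less_Suc_eq by auto
      finally show "0 < nats (ev zone_prog t) ''bad'' x i \<longleftrightarrow> (\<exists>j<Suc a. i = nats (ev zone_prog t) ''z'' x j mod (D + 1))" .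
    qed
  qed (use assms in \<open>auto simp: Inv_def\<close>)
  have s1: "input s1" "nats s1 ''dim'' 0 0 = D" "\<forall>x. nats s1 ''rkd'' x 0 = 0"
    using assms by (simp_all add: s1_def input_ev nats_ev)
  \<comment> \<open>Pigeonhole: \<open>D\<close> coordinates occupy at most \<open>D\<close> of the
    \<open>D + 1\<close> residues.\<close>
  have ex: "\<exists>i\<le>D. nats s1 ''bad'' x i = 0" if "x < n" for x
  proof (rule ccontr)
    assume "\<not> ?thesis"
    then have "{..D} \<subseteq> (\<lambda>j. nats s1 ''z'' x j mod (D + 1)) ` {..<D}" using I that unfolding Inv_def by auto
    then have "card {..D} \<le> card {..<D}" by (rule surj_card_le[rotated]) simp
    then show False by simp
  qed
  define Q where "Q a t \<longleftrightarrow> (\<forall>x<a. nats t ''rank'' x 0 \<le> D \<and> nats s1 ''bad'' x (nats t ''rank'' x 0) = 0) \<and>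
    (\<forall>x. a \<le> x \<longrightarrow> nats t ''rkd'' x 0 = 0)" for a and t :: store
  have "Q n (ev (For ''x'' nN (For ''i'' nL free_step)) s1)"
  proof (rule For_inv)
    let ?p = "For ''i'' nL free_step"
    fix a t assume a: "a < n" "Q a t" "nats t ''x'' 0 0 = a" and fr: "frame (insert ''x'' (nw ?p)) (rw ?p) s1 t"
    have t: "input t" "nats t ''dim'' 0 0 = D" "nats t ''bad'' = nats s1 ''bad''"
      using input_frame[OF fr s1(1)] frame_nats[OF fr] s1 by simp_all
    have "nats t ''rkd'' a 0 = 0" using a(2) by (simp add: Q_def)
    note fl = free_loop[OF t(1,2) a(3) this, unfolded t(3), OF ex[OF a(1)]]
    show "Q (Suc a) (ev ?p t)" using fl a(2) unfolding Q_def less_Suc_eq by auto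
  qed (use s1 in \<open>auto simp: Q_def input_def\<close>)
  then have Q: "rk x \<le> D \<and> nats s1 ''bad'' x (rk x) = 0" if "x < n" for x
    using that unfolding Q_def rk_def lp_prog_def ev.simps(4) s1_def[symmetric] by blast
  have "\<forall>j<D. nats s1 ''z'' x j mod (D + 1) \<noteq> rk x" if "x < n" for x
    using Q[OF that] I that unfolding Inv_def by (metis less_irrefl)
  then show ?thesis using I Q unfolding Inv_def by (intro exI[of _ "nats s1 ''z''"]) blast
qed

text \<open>The shape of the metric enters only through \<open>co\<close> and \<open>dc\<close>. In
  a chain each coordinate changes by at most \<open>2 * r\<close> per step, so zone numbers move by
  at most one and never pass the residue \<open>rk x\<close>. The ends thus differ by at most
  \<open>D\<close> zones and \<open>4 * r * D + 2 * r \<le> 6 * r * D\<close> in each coordinate,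
  which yields \<open>h = c * (6 * r * D)\<close>.\<close>

lemma lp_ranks:
  assumes ri: "rank_input r s" and D: "nats s ''dim'' 0 0 = D" "1 \<le> D" and "1 \<le> c"
    and co: "\<forall>x<n. \<forall>y<n. \<forall>j<D. \<bar>reals s ''coord'' x j - reals s ''coord'' y j\<bar> \<le> d x y"
    and dc: "\<forall>x<n. \<forall>y<n. \<forall>M\<ge>0. (\<forall>j<D. \<bar>reals s ''coord'' x j - reals s ''coord'' y j\<bar> \<le> M) \<longrightarrow> d x y \<le> c * M"
  shows "ranks lp_prog r (16 * (real D * real D * c)) s"
proof -
  define X where "X = greedy r n"
  have X: "X \<subseteq> {..<n}" using greedy_sub by (simp add: X_def)
  have s: "input s" "reals s ''R'' 0 0 = r" "0 \<le> r" "\<forall>x i. nats s ''bad'' x i = 0" "\<forall>x. nats s ''rkd'' x 0 = 0"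
    using ri by (simp_all add: rank_input_def)
  define rk where "rk x = nats (ev lp_prog s) ''rank'' x 0" for x
  obtain z where z: "\<And>j. j < D \<Longrightarrow> zone_bounds (\<lambda>x. reals s ''coord'' x j) r D {..<n} (\<lambda>x. z x j)"
    and rk: "\<And>x. x < n \<Longrightarrow> rk x \<le> D \<and> (\<forall>j<D. z x j mod (D + 1) \<noteq> rk x)"
    using lp_prog_correct[OF s(1-3) D(1) s(4,5), folded rk_def] by blast
  define h where "h = c * (6 * r * real D)"
  have "rank_ok r X rk (D + 1) h"
    unfolding rank_ok_def
  proof (intro conjI ballI impI)
    fix x assume "x \<in> X"
    then have "x < n" using X by auto
    then show "rk x < D + 1" using rk[of x] by simp
  next
    fix x y assume x: "x \<in> X" and y: "y \<in> X" and ch: "(x, y) \<in> (Restr {(u, v). d u v \<le> 2 * r} {v\<in>X. rk v = rk x})\<^sup>*"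
    have n: "x < n" "y < n" using x y X by auto
    have i: "rk x \<le> D" using rk n by blast
    define b where "b v j = (z v j + D - rk x) div (D + 1)" for v j
    have "\<forall>j<D. b y j = b x j"
      using ch
    proof (induction rule: rtrancl_induct)
      case (step u v)
      then have uv: "u < n" "v < n" "d u v \<le> 2 * r" "rk u = rk x" "rk v = rk x" using X by auto
      have "b u j = b v j" if "j < D" for j
      proof -
        have a: "\<bar>reals s ''coord'' u j - reals s ''coord'' v j\<bar> \<le> 2 * r"
          using co uv(1-3) that by (meson order_trans)
        then have "z u j \<le> z v j + 1" "z v j \<le> z u j + 1"
          using z[OF that] uv(1,2) unfolding zone_bounds_def by (auto simp: abs_minus_commute)
        then show ?thesis
          unfolding b_def using rk[OF uv(1)] rk[OF uv(2)] uv(4,5) that i by (intro same_block) auto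
      qed
      then show ?case using step.IH by simp
    qed simp
    then have b: "b x j = b y j" if "j < D" for j using that by simp
    have "\<bar>reals s ''coord'' x j - reals s ''coord'' y j\<bar> \<le> 6 * r * real D" if "j < D" for j
    proof -
      have le: "z y j \<le> z x j + D" "z x j \<le> z y j + D"
        using block_diff[of "z x j" D "rk x" "z y j"] block_diff[of "z y j" D "rk x" "z x j"] b[OF that] i
        unfolding b_def by auto
      have "r \<le> r * real D" using mult_left_mono[of 1 "real D" r] s(3) D(2) by simp
      have bound: "4 * r * e + 2 * r \<le> 6 * r * real D" if "e \<le> real D" for e
        using mult_left_mono[OF that, of "4 * r"] s(3) \<open>r \<le> r * real D\<close> by simp
      show ?thesis
      proof (cases "z x j \<le> z y j")
        case True
        then have "\<bar>reals s ''coord'' x j - reals s ''coord'' y j\<bar> \<le> 4 * r * (real (z y j) - real (z x j)) + 2 * r"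
          using z[OF that] n le unfolding zone_bounds_def by blast
        also have "\<dots> \<le> 6 * r * real D" using le by (intro bound) linarith
        finally show ?thesis .
      next
        case False
        then have "\<bar>reals s ''coord'' y j - reals s ''coord'' x j\<bar> \<le> 4 * r * (real (z x j) - real (z y j)) + 2 * r"
          using z[OF that] n le unfolding zone_bounds_def by (meson lessThan_iff nat_le_linear)
        also have "\<dots> \<le> 6 * r * real D" using le by (intro bound) linarith
        finally show ?thesis by (simp add: abs_minus_commute)
      qed
    qed
    then show "d x y \<le> h" using dc n s(3) unfolding h_def by simp
  qed
  moreover have "0 \<le> h" using \<open>1 \<le> c\<close> s(3) by (simp add: h_def)
  moreover have "real (D + 1) * (h + 2 * r) \<le> 16 * (real D * real D * c) * r"
  proof -
    \<comment> \<open>\<open>D + 1 \<le> 2 * D\<close> and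
      \<open>h + 2 * r \<le> 8 * r * D * c\<close> multiply to the constant 16.\<close>
    have "1 \<le> c * real D" using mult_mono[of 1 c 1 "real D"] \<open>1 \<le> c\<close> D(2) by simp
    then have "2 * r \<le> c * (2 * r * real D)" using mult_right_mono[of 1 "c * real D" "2 * r"] s(3) by (simp add: mult_ac)
    then have "h + 2 * r \<le> c * (8 * r * real D)" by (simp add: h_def algebra_simps)
    moreover have "real (D + 1) \<le> 2 * real D" using D(2) by simp
    ultimately have "real (D + 1) * (h + 2 * r) \<le> 2 * real D * (c * (8 * r * real D))"
      using \<open>0 \<le> h\<close> s(3) by (intro mult_mono) auto
    then show ?thesis by (simp add: mult_ac)
  qed
  moreover have "rk x \<le> n + nats s ''dim'' 0 0" if "x \<in> X" for x
  proof -
    have "x < n" using that X by auto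
    then show ?thesis using rk[of x] D(1) by simp
  qed
  ultimately show ?thesis
    unfolding ranks_def X_def[symmetric] rk_def[symmetric] by (intro exI[of _ "D + 1"] exI[of _ h]) blast
qed

end

section \<open>Conclusion\<close>

lemma lp_dist_coordinate:
  assumes "1 \<le> p" "j < D"
  shows "\<bar>x j - y j\<bar> \<le> lp_dist p D x y"
proof (cases "p = \<infinity>")
  case True
  have "\<bar>x j - y j\<bar> \<le> (MAX j\<in>{..<D}. \<bar>x j - y j\<bar>)" using assms(2) by (intro Max_ge) auto
  then show ?thesis using True by (simp add: lp_dist_def)
next
  case False
  then obtain q where q: "p = ereal q" "1 \<le> q" using assms(1) by (cases p) auto
  have "\<bar>x j - y j\<bar> powr q \<le> (\<Sum>j<D. \<bar>x j - y j\<bar> powr q)"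
    using assms(2) by (intro member_le_sum) auto
  then have "(\<bar>x j - y j\<bar> powr q) powr (1 / q) \<le> (\<Sum>j<D. \<bar>x j - y j\<bar> powr q) powr (1 / q)"
    using q by (intro powr_mono2) auto
  then show ?thesis using q by (simp add: lp_dist_def powr_powr)
qed

text \<open>For \<open>p = \<infinity>\<close> the exponent \<open>1 / p\<close> is 0 and the factor
  becomes 1, so that both cases fit one formula.\<close>

lemma lp_dist_le:
  assumes "1 \<le> p" "1 \<le> D" "0 \<le> M" "\<forall>j<D. \<bar>x j - y j\<bar> \<le> M"
  shows "lp_dist p D x y \<le> real D powr real_of_ereal (1 / p) * M"
proof (cases "p = \<infinity>")
  case True
  have "{..<D} \<noteq> {}" using assms(2) by (auto simp: lessThan_empty_iff)
  then have "(MAX j\<in>{..<D}. \<bar>x j - y j\<bar>) \<le> M" using assms(4) by (intro Max.boundedI) auto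
  then show ?thesis using True assms(2) by (simp add: lp_dist_def)
next
  case False
  then obtain q where q: "p = ereal q" "1 \<le> q" using assms(1) by (cases p) auto
  have "(\<Sum>j<D. \<bar>x j - y j\<bar> powr q) \<le> (\<Sum>j<D. M powr q)"
    using assms(4) q by (intro sum_mono powr_mono2) auto
  then have "(\<Sum>j<D. \<bar>x j - y j\<bar> powr q) powr (1 / q) \<le> (real D * M powr q) powr (1 / q)"
    using q by (intro powr_mono2) (auto intro: sum_nonneg)
  also have "\<dots> = real D powr (1 / q) * M"
    using q assms(3) by (simp add: powr_mult powr_powr)
  finally show ?thesis using q by (simp add: lp_dist_def one_ereal_def)
qed

lemma conn_inst_valid:
  assumes "valid_inst I"
  shows "conn_inst (num_points I) (distance I) (num_clusters I) (edges I)"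
  using assms unfolding valid_inst_def conn_inst_def conn_inst_axioms_def by blast

text \<open>For \<open>k \<ge> 2\<close> the logarithm is at least 1 and absorbs the summand at the
  price of a factor \<open>2 ^ 2\<close>, which turns 8 into 32.\<close>

lemma log_sq_bigo: "(\<lambda>k. 8 * (log 2 (real k) + 1)\<^sup>2) \<in> O(\<lambda>k. (log 2 (real k))\<^sup>2)"
proof (rule bigoI[of _ 32])
  show "\<forall>\<^sub>F k in sequentially. norm (8 * (log 2 (real k) + 1)\<^sup>2) \<le> 32 * norm ((log 2 (real k))\<^sup>2)"
    using eventually_ge_at_top[of 2]
  proof eventually_elim
    case (elim k)
    then have "1 \<le> log 2 (real k)" by (simp add: le_log_iff)
    then have "(log 2 (real k) + 1)\<^sup>2 \<le> (2 * log 2 (real k))\<^sup>2" by (intro power_mono) auto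
    then show ?case by (simp add: power_mult_distrib)
  qed
qed

lemma general_approx:
  "approx_alg connected_k_center (\<lambda>I. 8 * (log 2 (real (num_clusters I)) + 1)\<^sup>2) (com_of (pipeline carving_prog))"
  "approx_alg connected_k_diameter (\<lambda>I. 8 * (log 2 (real (num_clusters I)) + 1)\<^sup>2) (com_of (pipeline carving_prog))"
proof -
  have *: "solved connected_k_center I (ev (pipeline carving_prog) (encode I)) (8 * (log 2 (real (num_clusters I)) + 1)\<^sup>2) \<and>
      solved connected_k_diameter I (ev (pipeline carving_prog) (encode I)) (8 * (log 2 (real (num_clusters I)) + 1)\<^sup>2)"
    if "valid_inst I" for I :: cluster_inst
    using pipeline_approx[OF that input_encode[OF that] rank_carving_prog _ conn_inst.carving_ranks[OF conn_inst_valid[OF that]]]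
    by simp
  show "approx_alg connected_k_center (\<lambda>I. 8 * (log 2 (real (num_clusters I)) + 1)\<^sup>2) (com_of (pipeline carving_prog))"
    "approx_alg connected_k_diameter (\<lambda>I. 8 * (log 2 (real (num_clusters I)) + 1)\<^sup>2) (com_of (pipeline carving_prog))"
    by (rule approx_algI[OF wf_pipeline[OF rank_carving_prog]]; use * in simp)+
qed

lemma doubling_approx:
  "approx_alg connected_k_center (\<lambda>I. 8 * 2 ^ (3 * doubling_dim (points I) (distance I))) (com_of (pipeline doubling_prog))"
  "approx_alg connected_k_diameter (\<lambda>I. 8 * 2 ^ (3 * doubling_dim (points I) (distance I))) (com_of (pipeline doubling_prog))"
proof -
  have *: "solved connected_k_center I (ev (pipeline doubling_prog) (encode I)) (8 * 2 ^ (3 * doubling_dim (points I) (distance I))) \<and>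
      solved connected_k_diameter I (ev (pipeline doubling_prog) (encode I)) (8 * 2 ^ (3 * doubling_dim (points I) (distance I)))"
    if "valid_inst I" for I :: cluster_inst
    using pipeline_approx[OF that input_encode[OF that] rank_doubling_prog _ conn_inst.doubling_ranks[OF conn_inst_valid[OF that]]]
    by simp
  show "approx_alg connected_k_center (\<lambda>I. 8 * 2 ^ (3 * doubling_dim (points I) (distance I))) (com_of (pipeline doubling_prog))"
    "approx_alg connected_k_diameter (\<lambda>I. 8 * 2 ^ (3 * doubling_dim (points I) (distance I))) (com_of (pipeline doubling_prog))"
    by (rule approx_algI[OF wf_pipeline[OF rank_doubling_prog]]; use * in simp)+
qed

text \<open>The exponent collects one factor \<open>D\<close> from the number of ranks, one from the
  number of zones in a block, and \<open>D powr (1 / p)\<close> from passing from coordinates to the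
  distance.\<close>

lemma lp_instance_ranks:
  fixes I :: lp_inst
  assumes I: "valid_lp_inst p I" and p: "1 \<le> p"
    and t: "conn_inst.rank_input (num_points I) (distance I) (num_clusters I) (edges I) r t"
      "nats t ''dim'' = nats (encode_lp I) ''dim''" "reals t ''coord'' = reals (encode_lp I) ''coord''"
  shows "conn_inst.ranks (num_points I) (distance I) (edges I) lp_prog r
    (16 * real (space_dim I) powr (2 + real_of_ereal (1 / p))) t"
proof -
  let ?D = "space_dim I" and ?c = "real (space_dim I) powr real_of_ereal (1 / p)"
  have v: "valid_inst I" and D: "1 \<le> ?D"
    and dist: "\<And>x y. x < num_points I \<Longrightarrow> y < num_points I \<Longrightarrow> distance I x y = lp_dist p ?D (coord I x) (coord I y)"
    using I by (auto simp: valid_lp_inst_def)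
  have co: "reals t ''coord'' x j = coord I x j" if "x < num_points I" "j < ?D" for x j
    using that by (simp add: t(3) encode_lp_def)
  have "nats t ''dim'' 0 0 = ?D" by (simp add: t(2) encode_lp_def)
  moreover have "0 \<le> real_of_ereal (1 / p)" using p by (cases p) (auto simp: one_ereal_def)
  then have "1 \<le> ?c" using D by (intro ge_one_powr_ge_zero) auto
  moreover have "\<forall>x<num_points I. \<forall>y<num_points I. \<forall>j<?D. \<bar>reals t ''coord'' x j - reals t ''coord'' y j\<bar> \<le> distance I x y"
    using lp_dist_coordinate[OF p] by (simp add: co dist)
  moreover have "\<forall>x<num_points I. \<forall>y<num_points I. \<forall>M\<ge>0.
      (\<forall>j<?D. \<bar>reals t ''coord'' x j - reals t ''coord'' y j\<bar> \<le> M) \<longrightarrow> distance I x y \<le> ?c * M"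
    using lp_dist_le[OF p D] by (simp add: co dist)
  ultimately have "conn_inst.ranks (num_points I) (distance I) (edges I) lp_prog r (16 * (real ?D * real ?D * ?c)) t"
    using conn_inst.lp_ranks[OF conn_inst_valid[OF v] t(1) _ D] by blast
  moreover have "real ?D * real ?D * ?c = real ?D powr (2 + real_of_ereal (1 / p))"
    using D by (simp add: powr_add power2_eq_square)
  ultimately show ?thesis by (simp only:)
qed

text \<open>The program is the same for all \<open>p\<close>, and so is the constant 32:
  \<open>p\<close> enters through the distances and through the exponent only.\<close>

lemma lp_approx:
  assumes p: "1 \<le> p"
  shows "lp_approx_alg p connected_k_center (\<lambda>I. 32 * real (space_dim I) powr (2 + real_of_ereal (1 / p))) (com_of (pipeline lp_prog))"
    "lp_approx_alg p connected_k_diameter (\<lambda>I. 32 * real (space_dim I) powr (2 + real_of_ereal (1 / p))) (com_of (pipeline lp_prog))"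
proof -
  have *: "solved connected_k_center I (ev (pipeline lp_prog) (encode_lp I)) (32 * real (space_dim I) powr (2 + real_of_ereal (1 / p))) \<and>
      solved connected_k_diameter I (ev (pipeline lp_prog) (encode_lp I)) (32 * real (space_dim I) powr (2 + real_of_ereal (1 / p)))"
    if I: "valid_lp_inst p I" for I :: lp_inst
  proof -
    have v: "valid_inst I" using I by (simp add: valid_lp_inst_def)
    have "0 \<le> 16 * real (space_dim I) powr (2 + real_of_ereal (1 / p))" by simp
    note pa = pipeline_approx[OF v input_encode_lp[OF v] rank_lp_prog this]
    have "solved connected_k_center I (ev (pipeline lp_prog) (encode_lp I)) (2 * (16 * real (space_dim I) powr (2 + real_of_ereal (1 / p))))"
      by (rule pa(1)) (rule lp_instance_ranks[OF I p])
    moreover have "solved connected_k_diameter I (ev (pipeline lp_prog) (encode_lp I)) (2 * (16 * real (space_dim I) powr (2 + real_of_ereal (1 / p))))"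
      by (rule pa(2)) (rule lp_instance_ranks[OF I p])
    ultimately show ?thesis by simp
  qed
  show "lp_approx_alg p connected_k_center (\<lambda>I. 32 * real (space_dim I) powr (2 + real_of_ereal (1 / p))) (com_of (pipeline lp_prog))"
    "lp_approx_alg p connected_k_diameter (\<lambda>I. 32 * real (space_dim I) powr (2 + real_of_ereal (1 / p))) (com_of (pipeline lp_prog))"
    by (rule lp_approx_algI[OF wf_pipeline[OF rank_lp_prog]]; use * in simp)+
qed

theorem theorem9:
  shows
    "(\<exists>\<alpha> :: nat \<Rightarrow> real. \<alpha> \<in> O(\<lambda>k. (log 2 (real k))\<^sup>2) \<and>
        (\<exists>prog. approx_alg connected_k_center (\<lambda>I. \<alpha> (num_clusters I)) prog)) \<and>
     (\<exists>\<alpha> :: nat \<Rightarrow> real. \<alpha> \<in> O(\<lambda>k. (log 2 (real k))\<^sup>2) \<and>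
        (\<exists>prog. approx_alg connected_k_diameter (\<lambda>I. \<alpha> (num_clusters I)) prog)) \<and>
     (\<exists>K :: real. \<exists>prog. approx_alg connected_k_center
        (\<lambda>I. K * 2 ^ (3 * doubling_dim (points I) (distance I))) prog) \<and>
     (\<exists>K :: real. \<exists>prog. approx_alg connected_k_diameter
        (\<lambda>I. K * 2 ^ (3 * doubling_dim (points I) (distance I))) prog) \<and>
     (\<exists>K :: real. \<forall>p :: ereal. 1 \<le> p \<longrightarrow> (\<exists>prog. lp_approx_alg p connected_k_center
        (\<lambda>I. K * real (space_dim I) powr (2 + real_of_ereal (1 / p))) prog)) \<and>
     (\<exists>K :: real. \<forall>p :: ereal. 1 \<le> p \<longrightarrow> (\<exists>prog. lp_approx_alg p connected_k_diameter
        (\<lambda>I. K * real (space_dim I) powr (2 + real_of_ereal (1 / p))) prog))"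
  using log_sq_bigo general_approx doubling_approx lp_approx by blast

end
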